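(* Let $p_0=p_{f_0}\in\mathcal{P}$ with $f_0\in\mathcal{F}$, and suppose assumptions (A), (B), (C) and (D) (listed in the context) hold with $\varepsilon=1$. Then $J(p_0\|p_f)<\infty$ for all $f\in\mathcal{F}$. In addition, the following hold. (i) For all $f\in\mathcal{F}$, $$J(f):=J(p_0\|p_f)=\tfrac12\langle f-f_0,C(f-f_0)\rangle_{\mathcal{H}},$$ where $C:\mathcal{H}\to\mathcal{H}$, $C:=\int_\Omega p_0(x)\sum_{i=1}^d\partial_ik(x,\cdot)\otimes\partial_ik(x,\cdot)\,dx$, is a trace-class positive operator with $Cf=\int_\Omega p_0(x)\sum_{i=1}^d\partial_ik(x,\cdot)\,\partial_if(x)\,dx$. (ii) Alternatively, $$J(f)=\tfrac12\langle f,Cf\rangle_{\mathcal{H}}+\langle f,\xi\rangle_{\mathcal{H}}+J(p_0\|q_0),$$ where $\xi:=\int_\Omega p_0(x)\sum_{i=1}^d\left(\partial_ik(x,\cdot)\,\partial_i\log q_0(x)+\partial_i^2k(x,\cdot)\right)dx\in\mathcal{H}$, and $f_0$ satisfies $Cf_0=-\xi$. (iii) For any $\lambda>0$, a unique minimizer $f_\lambda$ of $J_\lambda(f):=J(f)+\frac\lambda2\|f\|_{\mathcal{H}}^2$ over $\mathcal{H}$ exists (where for $f\in\mathcal{H}$, $J(f)$ is given by the expression $\frac12\langle f-f_0,C(f-f_0)\rangle_{\mathcal{H}}$) and is given by $$f_\lambda=-(C+\lambda I)^{-1}\xi=(C+\lambda I)^{-1}Cf_0.$$ (iv) Given samples $(X_a)_{a=1}^n$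 drawn i.i.d. from $p_0$, for any $\lambda>0$ the unique minimizer $f_{\lambda,n}$ of $\hat J_\lambda(f):=\hat J(f)+\frac\lambda2\|f\|_{\mathcal{H}}^2$ over $\mathcal{H}$ exists and is given by $$f_{\lambda,n}=-(\hat C+\lambda I)^{-1}\hat\xi,$$ where $\hat J(f):=\frac12\langle f,\hat Cf\rangle_{\mathcal{H}}+\langle f,\hat\xi\rangle_{\mathcal{H}}+J(p_0\|q_0)$, $\hat C:=\frac1n\sum_{a=1}^n\sum_{i=1}^d\partial_ik(X_a,\cdot)\otimes\partial_ik(X_a,\cdot)$ and $\hat\xi:=\frac1n\sum_{a=1}^n\sum_{i=1}^d\left(\partial_ik(X_a,\cdot)\,\partial_i\log q_0(X_a)+\partial_i^2k(X_a,\cdot)\right)$.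
   Context: Family: $q_0$ is a probability density on $\Omega\subseteq\mathbb{R}^d$; $\mathcal{H}$ is the RKHS on $\Omega$ with reproducing kernel $k$; $A(f):=\log\int_\Omega e^{f}q_0\,dx$; $\mathcal{F}:=\{f\in\mathcal{H}:e^{A(f)}<\infty\}$; $p_f:=e^{f-A(f)}q_0$; $\mathcal{P}:=\{p_f:f\in\mathcal{F}\}$. Fisher divergence: $J(p\|q)=\frac12\int_\Omega p(x)\|\nabla\log p(x)-\nabla\log q(x)\|_2^2\,dx$. Derivatives: $[d]=\{1,\dots,d\}$; for $k$ on $\Omega\times\Omega$, $\partial_i$ and $\partial_{i+d}$ denote partial derivatives in the $i$-th coordinate of the first and second argument, respectively; $\partial_ik(x,\cdot)$ and $\partial_i^2k(x,\cdot)$ (derivatives in the first argument) are elements of $\mathcal{H}$; $\partial^{\alpha,\alpha}k:=\partial_1^{\alpha_1}\cdots\partial_d^{\alpha_d}\partial_{1+d}^{\alpha_1}\cdots\partial_{2d}^{\alpha_d}k$ for multi-indices $\alpha$. For $u,v\in\mathcal{H}$, $(u\otimes v)w=u\langle v,w\rangle_{\mathcal{H}}$. $\mathcal{H}$-valued and operator-valued integrals are Bochner integrals. Assumptions: (A) $\Omega$ is a non-empty open subset of $\mathbb{R}^d$ with a piecewise smooth boundary $\partial\Omega:=\overline\Omega\setminus\Omega$. (B) $p_0$ is continuously extendible to $\overline\Omega$; $k$ is twice continuously differentiable on $\Omega\times\Omega$ (i.e. $\partial^{\alpha,\alpha}k$ exists and is continuous for $|\alpha|\le2$) with continuous extension of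 $\partial^{\alpha,\alpha}k$ to $\overline\Omega\times\overline\Omega$ for $|\alpha|\le2$. (C) For all $i\in[d]$: $\partial_i\partial_{i+d}k(x,x)p_0(x)=0$ for $x\in\partial\Omega$, and $\sqrt{\partial_i\partial_{i+d}k(x,x)}\,p_0(x)=o(\|x\|_2^{1-d})$ as $x\in\Omega$, $\|x\|_2\to\infty$. (D) ($\varepsilon$-integrability) $q_0\in C^1(\Omega)$, and for some $\varepsilon\ge1$ and all $i\in[d]$, the functions $x\mapsto\partial_i\partial_{i+d}k(x,x)$, $\sqrt{\partial_i^2\partial_{i+d}^2k(x,x)}$ and $\sqrt{\partial_i\partial_{i+d}k(x,x)}\,\partial_i\log q_0(x)$ belong to $L^\varepsilon(\Omega,p_0)$. *)

theory Defs
  imports "HOL-Probability.Probability" "HOL-Library.Landau_Symbols"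
begin

section \<open>Partial derivatives\<close>

definition dir_deriv :: "'v::real_normed_vector \<Rightarrow> ('v \<Rightarrow> real) \<Rightarrow> 'v \<Rightarrow> real" where
  "dir_deriv v f x = deriv (\<lambda>t. f (x + t *\<^sub>R v)) 0"

text \<open>Iterated derivatives: the last direction in the list is applied first.\<close>

definition dir_derivs :: "'v::real_normed_vector list \<Rightarrow> ('v \<Rightarrow> real) \<Rightarrow> 'v \<Rightarrow> real" where
  "dir_derivs vs f = foldr dir_deriv vs f"

fun has_dir_derivs_on :: "'v::real_normed_vector set \<Rightarrow> 'v list \<Rightarrow> ('v \<Rightarrow> real) \<Rightarrow> bool" where
  "has_dir_derivs_on S [] f \<longleftrightarrow> True"
| "has_dir_derivs_on S (v # vs) f \<longleftrightarrow> has_dir_derivs_on S vs f \<and>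
     (\<forall>x\<in>S. (\<lambda>t. dir_derivs vs f (x + t *\<^sub>R v)) differentiable (at 0))"

definition partial :: "'n::finite \<Rightarrow> (real^'n \<Rightarrow> real) \<Rightarrow> real^'n \<Rightarrow> real" where
  "partial i = dir_deriv (axis i 1)"

definition grad :: "(real^'n::finite \<Rightarrow> real) \<Rightarrow> real^'n \<Rightarrow> real^'n" where
  "grad f x = (\<chi> i. partial i f x)"

text \<open>Only used for open \<open>S\<close>.\<close>

definition C1_on :: "(real^'n::finite) set \<Rightarrow> (real^'n \<Rightarrow> real) \<Rightarrow> bool" where
  "C1_on S f \<longleftrightarrow>
     (\<forall>i. has_dir_derivs_on S [axis i 1] f \<and> continuous_on S (partial i f))"

text \<open>A kernel is a function on pairs; \<open>fst_dir i\<close> and \<open>snd_dir i\<close> are the directions of the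
  \<open>i\<close>-th coordinate of its first and of its second argument.\<close>

definition fst_dir :: "'n::finite \<Rightarrow> (real^'n) \<times> (real^'n)" where
  "fst_dir i = (axis i 1, 0)"

definition snd_dir :: "'n::finite \<Rightarrow> (real^'n) \<times> (real^'n)" where
  "snd_dir i = (0, axis i 1)"

text \<open>The coordinates of a multi-index in increasing order, each repeated according to its
  multiplicity.\<close>

definition coords_of :: "('n::{finite,linorder} \<Rightarrow> nat) \<Rightarrow> 'n list" where
  "coords_of \<alpha> = concat (map (\<lambda>i. replicate (\<alpha> i) i) (sorted_list_of_set UNIV))"

definition kernel_dirs :: "('n::{finite,linorder} \<Rightarrow> nat) \<Rightarrow> ((real^'n::{finite,linorder}) \<times> (real^'n::{finite,linorder})) list" where
  "kernel_dirs \<alpha> = map fst_dir (coords_of \<alpha>) @ map snd_dir (coords_of \<alpha>)"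

section \<open>Continuous extension to the closure\<close>

definition cont_extendible :: "'v::real_normed_vector set \<Rightarrow> ('v \<Rightarrow> real) \<Rightarrow> bool" where
  "cont_extendible S f \<longleftrightarrow> (\<exists>g. continuous_on (closure S) g \<and> (\<forall>x\<in>S. g x = f x))"

text \<open>The values on \<open>closure S\<close> are uniquely determined when an extension exists.\<close>

definition cont_extension :: "'v::real_normed_vector set \<Rightarrow> ('v \<Rightarrow> real) \<Rightarrow> 'v \<Rightarrow> real" where
  "cont_extension S f = (SOME g. continuous_on (closure S) g \<and> (\<forall>x\<in>S. g x = f x))"

definition kernel_twice_cont_diff :: "(real^'n::{finite,linorder}) set \<Rightarrow> ((real^'n::{finite,linorder}) \<times> (real^'n::{finite,linorder}) \<Rightarrow> real) \<Rightarrow> bool" where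
  "kernel_twice_cont_diff \<Omega> k \<longleftrightarrow> (\<forall>\<alpha>. (\<Sum>i\<in>UNIV. \<alpha> i) \<le> 2 \<longrightarrow>
     has_dir_derivs_on (\<Omega> \<times> \<Omega>) (kernel_dirs \<alpha>) k \<and>
     continuous_on (\<Omega> \<times> \<Omega>) (dir_derivs (kernel_dirs \<alpha>) k))"

section \<open>Piecewise smooth boundary\<close>

text \<open>Sets of vanishing \<open>(d - 1)\<close>-dimensional Hausdorff measure. For \<open>d = 1\<close> every term of the sum
  is \<open>1\<close>, so only the empty set qualifies.\<close>

definition hypersurface_null :: "(real^'n::finite) set \<Rightarrow> bool" where
  "hypersurface_null N \<longleftrightarrow> (\<forall>\<epsilon>>0. \<exists>(I::nat set) c r.
     (\<forall>j\<in>I. 0 < r j) \<and> N \<subseteq> (\<Union>j\<in>I. ball (c j) (r j)) \<and>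
     (\<lambda>j. r j ^ (CARD('n) - 1)) summable_on I \<and>
     (\<Sum>\<^sub>\<infinity>j\<in>I. r j ^ (CARD('n) - 1)) < (\<epsilon>::real))"

text \<open>Near a regular point the set \<open>B\<close> is a \<open>C\<^sup>1\<close> hypersurface.\<close>

definition regular_point :: "(real^'n::finite) set \<Rightarrow> real^'n \<Rightarrow> bool" where
  "regular_point B x \<longleftrightarrow> (\<exists>U g. open U \<and> x \<in> U \<and> C1_on U g \<and>
     (\<forall>y\<in>U. grad g y \<noteq> 0) \<and> B \<inter> U = {y\<in>U. g y = 0})"

definition piecewise_smooth_boundary :: "(real^'n::finite) set \<Rightarrow> bool" where
  "piecewise_smooth_boundary \<Omega> \<longleftrightarrow>
     hypersurface_null {x \<in> closure \<Omega> - \<Omega>. \<not> regular_point (closure \<Omega> - \<Omega>) x}"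

section \<open>Reproducing kernel Hilbert spaces\<close>

text \<open>The space is a Hilbert space type whose elements are identified with functions on \<open>\<Omega>\<close> by the
  linear evaluation \<open>evf\<close>, which is injective when restricted to \<open>\<Omega>\<close>.\<close>

definition rkhs_on :: "'a set \<Rightarrow> ('a \<times> 'a \<Rightarrow> real) \<Rightarrow> ('h::{real_inner,banach} \<Rightarrow> 'a \<Rightarrow> real) \<Rightarrow> bool" where
  "rkhs_on \<Omega> k evf \<longleftrightarrow>
     (\<forall>x\<in>\<Omega>. linear (\<lambda>f. evf f x)) \<and>
     (\<forall>f g. (\<forall>x\<in>\<Omega>. evf f x = evf g x) \<longrightarrow> f = g) \<and>
     (\<forall>x\<in>\<Omega>. \<exists>K. (\<forall>y\<in>\<Omega>. evf K y = k (x, y)) \<and> (\<forall>f. evf f x = f \<bullet> K))"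

text \<open>The element of the space that is the given function on \<open>\<Omega>\<close>.\<close>

definition rkhs_elem :: "'a set \<Rightarrow> ('h \<Rightarrow> 'a \<Rightarrow> real) \<Rightarrow> ('a \<Rightarrow> real) \<Rightarrow> 'h" where
  "rkhs_elem \<Omega> evf g = (THE h. \<forall>y\<in>\<Omega>. evf h y = g y)"

text \<open>The elements \<open>\<partial>\<^sub>i k(x,\<cdot>)\<close> and \<open>\<partial>\<^sub>i\<^sup>2 k(x,\<cdot>)\<close>.\<close>

definition dk1 :: "(real^'n::finite) set \<Rightarrow> ((real^'n) \<times> (real^'n) \<Rightarrow> real) \<Rightarrow> ('h \<Rightarrow> real^'n \<Rightarrow> real) \<Rightarrow> 'n \<Rightarrow> real^'n \<Rightarrow> 'h" where
  "dk1 \<Omega> k evf i x = rkhs_elem \<Omega> evf (\<lambda>y. dir_derivs [fst_dir i] k (x, y))"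

definition dk2 :: "(real^'n::finite) set \<Rightarrow> ((real^'n) \<times> (real^'n) \<Rightarrow> real) \<Rightarrow> ('h \<Rightarrow> real^'n \<Rightarrow> real) \<Rightarrow> 'n \<Rightarrow> real^'n \<Rightarrow> 'h" where
  "dk2 \<Omega> k evf i x = rkhs_elem \<Omega> evf (\<lambda>y. dir_derivs [fst_dir i, fst_dir i] k (x, y))"

section \<open>Operators\<close>

lift_definition tensor_op :: "'h::real_inner \<Rightarrow> 'h \<Rightarrow> 'h \<Rightarrow>\<^sub>L 'h" is
  "\<lambda>u v w. (v \<bullet> w) *\<^sub>R u"
  by (intro bounded_linear_intros)

definition positive_op :: "('h::real_inner \<Rightarrow>\<^sub>L 'h) \<Rightarrow> bool" where
  "positive_op T \<longleftrightarrow> (\<forall>f g. T f \<bullet> g = f \<bullet> T g) \<and> (\<forall>f. 0 \<le> f \<bullet> T f)"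

definition orthonormal_basis :: "'h::real_inner set \<Rightarrow> bool" where
  "orthonormal_basis E \<longleftrightarrow> pairwise orthogonal E \<and> (\<forall>e\<in>E. norm e = 1) \<and> closure (span E) = UNIV"

text \<open>The operator \<open>S\<close> below is the absolute value of \<open>T\<close>, that is, the positive square root of
  \<open>T* T\<close>.\<close>

definition trace_class :: "('h::real_inner \<Rightarrow>\<^sub>L 'h) \<Rightarrow> bool" where
  "trace_class T \<longleftrightarrow> (\<exists>S. positive_op S \<and> (\<forall>f g. S f \<bullet> S g = T f \<bullet> T g) \<and>
     (\<exists>E. orthonormal_basis E \<and> (\<lambda>e. e \<bullet> S e) summable_on E))"

section \<open>Bochner integral\<close>

text \<open>Same as \<open>has_bochner_integral\<close>, but without the restriction of the value space to second countable
  spaces: spaces of bounded operators are in general not separable.\<close>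

definition has_bochner :: "'a measure \<Rightarrow> ('a \<Rightarrow> 'b::real_normed_vector) \<Rightarrow> 'b \<Rightarrow> bool" where
  "has_bochner M f y \<longleftrightarrow> f \<in> borel_measurable M \<and>
     (\<exists>s. (\<forall>j. Bochner_Integration.simple_bochner_integrable M (s j)) \<and>
       (\<lambda>j::nat. \<integral>\<^sup>+x. ennreal (norm (f x - s j x)) \<partial>M) \<longlonglongrightarrow> 0 \<and>
       (\<lambda>j. Bochner_Integration.simple_bochner_integral M (s j)) \<longlonglongrightarrow> y)"

definition bochner_integrable :: "'a measure \<Rightarrow> ('a \<Rightarrow> 'b::real_normed_vector) \<Rightarrow> bool" where
  "bochner_integrable M f \<longleftrightarrow> (\<exists>y. has_bochner M f y)"

definition bochner :: "'a measure \<Rightarrow> ('a \<Rightarrow> 'b::real_normed_vector) \<Rightarrow> 'b" where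
  "bochner M f = (THE y. has_bochner M f y)"

section \<open>Densities and the exponential family\<close>

abbreviation leb_on :: "'a::euclidean_space set \<Rightarrow> 'a measure" where
  "leb_on \<Omega> \<equiv> restrict_space lborel \<Omega>"

definition prob_density_on :: "'a::euclidean_space set \<Rightarrow> ('a \<Rightarrow> real) \<Rightarrow> bool" where
  "prob_density_on \<Omega> q \<longleftrightarrow> q \<in> borel_measurable (leb_on \<Omega>) \<and> (\<forall>x\<in>\<Omega>. 0 \<le> q x) \<and>
     (\<integral>\<^sup>+x. ennreal (q x) \<partial>leb_on \<Omega>) = 1"

text \<open>\<open>exp_partition\<close> is \<open>e\<^bsup>A(f)\<^esup>\<close>, with values in \<open>[0, \<infinity>]\<close>; the log-partition function \<open>A\<close> is meaningful
  where it is finite.\<close>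

definition exp_partition :: "'a::euclidean_space set \<Rightarrow> ('a \<Rightarrow> real) \<Rightarrow> ('a \<Rightarrow> real) \<Rightarrow> ennreal" where
  "exp_partition \<Omega> q0 f = (\<integral>\<^sup>+x. ennreal (exp (f x) * q0 x) \<partial>leb_on \<Omega>)"

definition log_partition :: "'a::euclidean_space set \<Rightarrow> ('a \<Rightarrow> real) \<Rightarrow> ('a \<Rightarrow> real) \<Rightarrow> real" where
  "log_partition \<Omega> q0 f = ln (enn2real (exp_partition \<Omega> q0 f))"

definition natural_params :: "'a::euclidean_space set \<Rightarrow> ('a \<Rightarrow> real) \<Rightarrow> ('h \<Rightarrow> 'a \<Rightarrow> real) \<Rightarrow> 'h set" where
  "natural_params \<Omega> q0 evf = {f. exp_partition \<Omega> q0 (evf f) < \<infinity>}"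

definition exp_density :: "'a::euclidean_space set \<Rightarrow> ('a \<Rightarrow> real) \<Rightarrow> ('a \<Rightarrow> real) \<Rightarrow> 'a \<Rightarrow> real" where
  "exp_density \<Omega> q0 f x = exp (f x - log_partition \<Omega> q0 f) * q0 x"

definition fisher_div :: "(real^'n::finite) set \<Rightarrow> (real^'n \<Rightarrow> real) \<Rightarrow> (real^'n \<Rightarrow> real) \<Rightarrow> ennreal" where
  "fisher_div \<Omega> p q = ennreal (1/2) * (\<integral>\<^sup>+x. ennreal (p x *
     (norm (grad (\<lambda>y. ln (p y)) x - grad (\<lambda>y. ln (q y)) x))\<^sup>2) \<partial>leb_on \<Omega>)"

text \<open>\<open>density_measure \<Omega> p\<close> lives on the sample space \<open>\<Omega>\<close>.\<close>

definition density_measure :: "'a::euclidean_space set \<Rightarrow> ('a \<Rightarrow> real) \<Rightarrow> 'a measure" where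
  "density_measure \<Omega> p = density (leb_on \<Omega>) (\<lambda>x. ennreal (p x))"

text \<open>Measurability is only required up to a null set of the measure with density \<open>p\<close>, so that the
  value of \<open>g\<close> at zeros of \<open>p\<close> (for instance that of \<open>\<partial>\<^sub>i log q\<^sub>0\<close>) is irrelevant.\<close>

definition in_Lp_density :: "'a::euclidean_space set \<Rightarrow> ('a \<Rightarrow> real) \<Rightarrow> real \<Rightarrow> ('a \<Rightarrow> real) \<Rightarrow> bool" where
  "in_Lp_density \<Omega> p \<epsilon> g \<longleftrightarrow> (\<exists>h\<in>borel_measurable (density_measure \<Omega> p).
     (AE x in density_measure \<Omega> p. g x = h x) \<and>
     integrable (density_measure \<Omega> p) (\<lambda>x. \<bar>h x\<bar> powr \<epsilon>))"

definition iid_sample :: "'w measure \<Rightarrow> 'a::euclidean_space set \<Rightarrow> ('a \<Rightarrow> real) \<Rightarrow> nat \<Rightarrow> (nat \<Rightarrow> 'w \<Rightarrow> 'a) \<Rightarrow> bool" where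
  "iid_sample M \<Omega> p n X \<longleftrightarrow> prob_space M \<and>
     prob_space.indep_vars M (\<lambda>_. restrict_space borel \<Omega>) X {1..n} \<and>
     (\<forall>a\<in>{1..n}. distributed M (leb_on \<Omega>) (X a) (\<lambda>x. ennreal (p x)))"

section \<open>Assumptions on the domain, the kernel and the densities\<close>

definition domain_assm :: "(real^'n::finite) set \<Rightarrow> bool" where
  "domain_assm \<Omega> \<longleftrightarrow> \<Omega> \<noteq> {} \<and> open \<Omega> \<and> piecewise_smooth_boundary \<Omega>"

definition regularity_assm :: "(real^'n::{finite,linorder}) set \<Rightarrow> ((real^'n::{finite,linorder}) \<times> (real^'n::{finite,linorder}) \<Rightarrow> real) \<Rightarrow> (real^'n::{finite,linorder} \<Rightarrow> real) \<Rightarrow> bool" where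
  "regularity_assm \<Omega> k p0 \<longleftrightarrow> cont_extendible \<Omega> p0 \<and> kernel_twice_cont_diff \<Omega> k \<and>
     (\<forall>\<alpha>. (\<Sum>i\<in>UNIV. \<alpha> i) \<le> 2 \<longrightarrow> cont_extendible (\<Omega> \<times> \<Omega>) (dir_derivs (kernel_dirs \<alpha>) k))"

definition boundary_assm :: "(real^'n::finite) set \<Rightarrow> ((real^'n) \<times> (real^'n) \<Rightarrow> real) \<Rightarrow> (real^'n \<Rightarrow> real) \<Rightarrow> bool" where
  "boundary_assm \<Omega> k p0 \<longleftrightarrow> (\<forall>i.
     (\<forall>x \<in> closure \<Omega> - \<Omega>.
        cont_extension (\<Omega> \<times> \<Omega>) (dir_derivs [fst_dir i, snd_dir i] k) (x, x) * cont_extension \<Omega> p0 x = 0) \<and>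
     (\<lambda>x. sqrt (dir_derivs [fst_dir i, snd_dir i] k (x, x)) * p0 x)
        \<in> o[inf at_infinity (principal \<Omega>)](\<lambda>x. norm x powr (1 - real CARD('n))))"

definition integrability_assm :: "real \<Rightarrow> (real^'n::finite) set \<Rightarrow> ((real^'n) \<times> (real^'n) \<Rightarrow> real) \<Rightarrow>
    (real^'n \<Rightarrow> real) \<Rightarrow> (real^'n \<Rightarrow> real) \<Rightarrow> bool" where
  "integrability_assm \<epsilon> \<Omega> k q0 p0 \<longleftrightarrow> C1_on \<Omega> q0 \<and> \<epsilon> \<ge> 1 \<and> (\<forall>i.
     in_Lp_density \<Omega> p0 \<epsilon> (\<lambda>x. dir_derivs [fst_dir i, snd_dir i] k (x, x)) \<and>
     in_Lp_density \<Omega> p0 \<epsilon> (\<lambda>x. sqrt (dir_derivs [fst_dir i, fst_dir i, snd_dir i, snd_dir i] k (x, x))) \<and>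
     in_Lp_density \<Omega> p0 \<epsilon> (\<lambda>x. sqrt (dir_derivs [fst_dir i, snd_dir i] k (x, x)) *
                                 partial i (\<lambda>y. ln (q0 y)) x))"

section \<open>Population and empirical objects\<close>

definition cov_at :: "(real^'n::finite) set \<Rightarrow> ((real^'n) \<times> (real^'n) \<Rightarrow> real) \<Rightarrow>
    ('h::real_inner \<Rightarrow> real^'n \<Rightarrow> real) \<Rightarrow> real^'n \<Rightarrow> 'h \<Rightarrow>\<^sub>L 'h" where
  "cov_at \<Omega> k evf x = (\<Sum>i\<in>UNIV. tensor_op (dk1 \<Omega> k evf i x) (dk1 \<Omega> k evf i x))"

definition xi_at :: "(real^'n::finite) set \<Rightarrow> ((real^'n) \<times> (real^'n) \<Rightarrow> real) \<Rightarrow> (real^'n \<Rightarrow> real) \<Rightarrow>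
    ('h::real_inner \<Rightarrow> real^'n \<Rightarrow> real) \<Rightarrow> real^'n \<Rightarrow> 'h" where
  "xi_at \<Omega> k q0 evf x =
     (\<Sum>i\<in>UNIV. partial i (\<lambda>y. ln (q0 y)) x *\<^sub>R dk1 \<Omega> k evf i x + dk2 \<Omega> k evf i x)"

definition cov_op :: "(real^'n::finite) set \<Rightarrow> ((real^'n) \<times> (real^'n) \<Rightarrow> real) \<Rightarrow> (real^'n \<Rightarrow> real) \<Rightarrow>
    ('h::real_inner \<Rightarrow> real^'n \<Rightarrow> real) \<Rightarrow> 'h \<Rightarrow>\<^sub>L 'h" where
  "cov_op \<Omega> k p0 evf = bochner (leb_on \<Omega>) (\<lambda>x. p0 x *\<^sub>R cov_at \<Omega> k evf x)"

definition xi_vec :: "(real^'n::finite) set \<Rightarrow> ((real^'n) \<times> (real^'n) \<Rightarrow> real) \<Rightarrow> (real^'n \<Rightarrow> real) \<Rightarrow>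
    (real^'n \<Rightarrow> real) \<Rightarrow> ('h::real_inner \<Rightarrow> real^'n \<Rightarrow> real) \<Rightarrow> 'h" where
  "xi_vec \<Omega> k q0 p0 evf = bochner (leb_on \<Omega>) (\<lambda>x. p0 x *\<^sub>R xi_at \<Omega> k q0 evf x)"

definition emp_cov_op :: "(real^'n::finite) set \<Rightarrow> ((real^'n) \<times> (real^'n) \<Rightarrow> real) \<Rightarrow>
    ('h::real_inner \<Rightarrow> real^'n \<Rightarrow> real) \<Rightarrow> nat \<Rightarrow> (nat \<Rightarrow> real^'n) \<Rightarrow> 'h \<Rightarrow>\<^sub>L 'h" where
  "emp_cov_op \<Omega> k evf n x = (1 / real n) *\<^sub>R (\<Sum>a=1..n. cov_at \<Omega> k evf (x a))"

definition emp_xi :: "(real^'n::finite) set \<Rightarrow> ((real^'n) \<times> (real^'n) \<Rightarrow> real) \<Rightarrow> (real^'n \<Rightarrow> real) \<Rightarrow>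
    ('h::real_inner \<Rightarrow> real^'n \<Rightarrow> real) \<Rightarrow> nat \<Rightarrow> (nat \<Rightarrow> real^'n) \<Rightarrow> 'h" where
  "emp_xi \<Omega> k q0 evf n x = (1 / real n) *\<^sub>R (\<Sum>a=1..n. xi_at \<Omega> k q0 evf (x a))"

definition ridge_op :: "('h::real_inner \<Rightarrow>\<^sub>L 'h) \<Rightarrow> real \<Rightarrow> 'h \<Rightarrow>\<^sub>L 'h" where
  "ridge_op T lam = T + lam *\<^sub>R id_blinfun"

abbreviation op_inv :: "('h::real_inner \<Rightarrow>\<^sub>L 'h) \<Rightarrow> 'h \<Rightarrow> 'h" where
  "op_inv T \<equiv> inv (blinfun_apply T)"

end

theory Submission
  imports Defs
begin

text \<open>
  The reproducing property turns the score matching problem into a quadratic one. Write \<open>K x\<close> for the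
  feature \<open>k(x,\<cdot>)\<close>. Since \<open>K x \<bullet> K y = k(x,y)\<close>, the scalar products of the difference quotients of \<open>K\<close>
  are difference quotients of \<open>k\<close>, so the derivatives \<open>D i x = \<partial>\<^sub>i k(x,\<cdot>)\<close> and \<open>W i x = \<partial>\<^sub>i\<^sup>2 k(x,\<cdot>)\<close> exist
  as limits in the Hilbert space, are continuous in \<open>x\<close>, and \<open>\<partial>\<^sub>i f(x) = f \<bullet> D i x\<close> for every element
  \<open>f\<close> (\<open>feature_derivative\<close>, \<open>feature_second_derivative\<close>).

  The log-partition function is constant in \<open>x\<close>, so the gradients of \<open>log p\<^sub>0\<close> and \<open>log p\<^sub>f\<close> differ by the
  gradient of \<open>f\<^sub>0 - f\<close>, and \<open>J(f)\<close> is half the integral of \<open>p\<^sub>0 (\<Sum>i. ((f - f\<^sub>0) \<bullet> D i)\<^sup>2)\<close>. This is the quadratic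
  form of \<open>C\<close>; the integrability assumptions make the Bochner integrals \<open>C\<close> and \<open>\<xi>\<close> exist.
  The trace of \<open>C\<close> is bounded by the integral of \<open>p\<^sub>0 (\<Sum>i. norm (D i)\<^sup>2)\<close>.

  The identity \<open>C f\<^sub>0 = - \<xi>\<close> is an integration by parts. Paired with \<open>g\<close>, it says that the sum over \<open>i\<close> of the
  integrals of \<open>\<partial>\<^sub>i (p\<^sub>0 (g \<bullet> D i))\<close> over \<open>\<Omega>\<close> is zero, and each summand is zero separately. By the boundary
  condition, \<open>v = p\<^sub>0 (g \<bullet> D i)\<close> extends by zero to a continuous function on the whole space, and \<open>v\<close> is
  integrable. On almost every line in direction \<open>i\<close> the increment of \<open>v\<close> is the integral of its derivative
  \<open>w\<close> on \<open>\<Omega>\<close> (\<open>integral_derivative_of_zero_extension\<close>), hence by Fubini and translation invariance the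
  integral of \<open>w\<close> equals the integral of \<open>v(x + e\<^sub>i) - v(x)\<close>, which is zero
  (\<open>integral_dir_deriv_of_zero_extension\<close>). Expanding the quadratic form with \<open>C f\<^sub>0 = - \<xi>\<close> gives the second
  formula for \<open>J\<close>.

  The regularized objectives, population and empirical, are quadratic with the operator \<open>T + \<lambda> I\<close> for a
  positive \<open>T\<close>. This operator is coercive, hence bijective (\<open>bij_ridge_op\<close>), and completing the square
  identifies the unique minimizer (\<open>ridge_minimizer\<close>).
\<close>

section \<open>Bochner integrals in spaces that need not be separable\<close>

lemma borel_measurable_norm_diff_simple:
  fixes f s :: "'a \<Rightarrow> 'b::real_normed_vector"
  assumes f: "f \<in> borel_measurable M" and s: "simple_function M s"
  shows "(\<lambda>x. norm (f x - s x)) \<in> borel_measurable M"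
proof (rule measurable_compose_countable'[where g = s and I = "s ` space M"])
  show "(\<lambda>x. norm (f x - c)) \<in> borel_measurable M" for c
    by (rule borel_measurable_continuous_on[OF _ f, where f = "\<lambda>y. norm (y - c)"])
      (intro continuous_intros)
  have "s \<in> measurable M (count_space UNIV)"
    using s by (rule measurable_simple_function)
  then show "s \<in> measurable M (count_space (s ` space M))"
    unfolding measurable_def by auto
  show "countable (s ` space M)"
    using s by (simp add: simple_function_def countable_finite)
qed

lemma norm_simple_integral_diff_le:
  fixes f s t :: "'a \<Rightarrow> 'b::real_normed_vector"
  assumes f: "f \<in> borel_measurable M"
    and s: "Bochner_Integration.simple_bochner_integrable M s"
    and t: "Bochner_Integration.simple_bochner_integrable M t"
  shows "ennreal (norm (Bochner_Integration.simple_bochner_integral M s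
        - Bochner_Integration.simple_bochner_integral M t))
      \<le> (\<integral>\<^sup>+x. ennreal (norm (f x - s x)) \<partial>M) + (\<integral>\<^sup>+x. ennreal (norm (f x - t x)) \<partial>M)"
proof -
  let ?I = "Bochner_Integration.simple_bochner_integral M"
  have ss: "simple_function M s" "simple_function M t"
    using s t by (simp_all add: simple_bochner_integrable.simps)
  have st: "Bochner_Integration.simple_bochner_integrable M (\<lambda>x. s x - t x)"
    using s t by (intro simple_bochner_integrable_compose2[where p = "(-)"]) simp_all
  have nst: "Bochner_Integration.simple_bochner_integrable M (\<lambda>x. norm (s x - t x))"
    using s t by (intro simple_bochner_integrable_compose2[where p = "\<lambda>a b. norm (a - b)"]) simp_all
  have "ennreal (norm (?I s - ?I t)) = ennreal (norm (?I (\<lambda>x. s x - t x)))"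
    by (simp add: simple_bochner_integral_diff[OF s t])
  also have "\<dots> \<le> ennreal (Bochner_Integration.simple_bochner_integral M (\<lambda>x. norm (s x - t x)))"
    by (rule ennreal_leI[OF simple_bochner_integral_norm_bound[OF st]])
  also have "\<dots> = (\<integral>\<^sup>+x. ennreal (norm (s x - t x)) \<partial>M)"
    by (rule simple_bochner_integral_eq_nn_integral[OF nst]) simp
  also have "\<dots> \<le> (\<integral>\<^sup>+x. ennreal (norm (f x - s x)) + ennreal (norm (f x - t x)) \<partial>M)"
  proof (rule nn_integral_mono)
    fix x
    have "norm (s x - t x) \<le> norm (f x - s x) + norm (f x - t x)"
      using norm_triangle_ineq4[of "f x - t x" "f x - s x"] by simp
    then show "ennreal (norm (s x - t x)) \<le> ennreal (norm (f x - s x)) + ennreal (norm (f x - t x))"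
      by (metis ennreal_leI ennreal_plus norm_ge_zero)
  qed
  also have "\<dots> = (\<integral>\<^sup>+x. ennreal (norm (f x - s x)) \<partial>M) + (\<integral>\<^sup>+x. ennreal (norm (f x - t x)) \<partial>M)"
    using borel_measurable_norm_diff_simple[OF f ss(1)] borel_measurable_norm_diff_simple[OF f ss(2)]
    by (intro nn_integral_add) simp_all
  finally show ?thesis .
qed

lemma has_bochner_unique:
  fixes f :: "'a \<Rightarrow> 'b::real_normed_vector"
  assumes "has_bochner M f y" and "has_bochner M f z"
  shows "y = z"
proof -
  have f: "f \<in> borel_measurable M"
    using assms(1) by (simp add: has_bochner_def)
  obtain s where s: "\<And>j. Bochner_Integration.simple_bochner_integrable M (s j)"
      and s0: "(\<lambda>j::nat. \<integral>\<^sup>+x. ennreal (norm (f x - s j x)) \<partial>M) \<longlonglongrightarrow> 0"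
      and sy: "(\<lambda>j. Bochner_Integration.simple_bochner_integral M (s j)) \<longlonglongrightarrow> y"
    using assms(1) by (auto simp: has_bochner_def)
  obtain t where t: "\<And>j. Bochner_Integration.simple_bochner_integrable M (t j)"
      and t0: "(\<lambda>j::nat. \<integral>\<^sup>+x. ennreal (norm (f x - t j x)) \<partial>M) \<longlonglongrightarrow> 0"
      and tz: "(\<lambda>j. Bochner_Integration.simple_bochner_integral M (t j)) \<longlonglongrightarrow> z"
    using assms(2) by (auto simp: has_bochner_def)
  let ?I = "Bochner_Integration.simple_bochner_integral M"
  let ?d = "\<lambda>j. ennreal (norm (?I (s j) - ?I (t j)))"
  have "?d \<longlonglongrightarrow> 0"
  proof (rule tendsto_sandwich[of "\<lambda>_. 0"])
    show "(\<lambda>j. (\<integral>\<^sup>+x. ennreal (norm (f x - s j x)) \<partial>M) + (\<integral>\<^sup>+x. ennreal (norm (f x - t j x)) \<partial>M))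
        \<longlonglongrightarrow> 0"
      using tendsto_add[OF s0 t0] by simp
    show "\<forall>\<^sub>F j in sequentially. ?d j
        \<le> (\<integral>\<^sup>+x. ennreal (norm (f x - s j x)) \<partial>M) + (\<integral>\<^sup>+x. ennreal (norm (f x - t j x)) \<partial>M)"
      using norm_simple_integral_diff_le[OF f s t] by (simp add: always_eventually)
  qed auto
  moreover have "?d \<longlonglongrightarrow> ennreal (norm (y - z))"
    by (intro tendsto_intros sy tz)
  ultimately have "ennreal (norm (y - z)) = 0"
    using LIMSEQ_unique by blast
  then show "y = z" by simp
qed

lemma bochner_eq:
  fixes f :: "'a \<Rightarrow> 'b::real_normed_vector"
  assumes "has_bochner M f y"
  shows "bochner M f = y"
  unfolding bochner_def using assms has_bochner_unique by blast

lemma has_bochner_bochner: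
  fixes f :: "'a \<Rightarrow> 'b::real_normed_vector"
  assumes "bochner_integrable M f"
  shows "has_bochner M f (bochner M f)"
  using assms bochner_eq unfolding bochner_integrable_def by fastforce

lemma has_bochner_cong:
  fixes f g :: "'a \<Rightarrow> 'b::real_normed_vector"
  assumes "\<And>x. x \<in> space M \<Longrightarrow> f x = g x"
  shows "has_bochner M f y \<longleftrightarrow> has_bochner M g y"
proof -
  have "f \<in> borel_measurable M \<longleftrightarrow> g \<in> borel_measurable M"
    using assms by (rule measurable_cong)
  moreover have "(\<integral>\<^sup>+x. ennreal (norm (f x - s x)) \<partial>M) = (\<integral>\<^sup>+x. ennreal (norm (g x - s x)) \<partial>M)"
    for s :: "'a \<Rightarrow> 'b"
    by (rule nn_integral_cong) (simp add: assms)
  ultimately show ?thesis by (simp add: has_bochner_def)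
qed

text \<open>Pairing with vectors reduces the operator-valued and vector-valued integrals to Lebesgue
  integrals of real functions.\<close>

lemma has_bochner_bounded_linear:
  fixes f :: "'a \<Rightarrow> 'b::real_normed_vector" and T :: "'b \<Rightarrow> 'c::real_normed_vector"
  assumes "has_bochner M f y" and T: "bounded_linear T"
  shows "has_bochner M (\<lambda>x. T (f x)) (T y)"
proof -
  interpret T: bounded_linear T by (rule T)
  have f: "f \<in> borel_measurable M"
    using assms(1) by (simp add: has_bochner_def)
  obtain s where s: "\<And>j. Bochner_Integration.simple_bochner_integrable M (s j)"
      and s0: "(\<lambda>j::nat. \<integral>\<^sup>+x. ennreal (norm (f x - s j x)) \<partial>M) \<longlonglongrightarrow> 0"
      and sy: "(\<lambda>j. Bochner_Integration.simple_bochner_integral M (s j)) \<longlonglongrightarrow> y"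
    using assms(1) by (auto simp: has_bochner_def)
  obtain K where K: "K > 0" "\<And>x. norm (T x) \<le> norm x * K"
    using T.pos_bounded by blast
  have meas: "(\<lambda>x. T (f x)) \<in> borel_measurable M"
    using f by (rule borel_measurable_continuous_on[OF T.continuous_on[OF continuous_on_id]])
  have int: "Bochner_Integration.simple_bochner_integrable M (\<lambda>x. T (s j x))" for j
    using simple_bochner_integrable_compose2[OF _ s s, where p = "\<lambda>a b. T a"] by (simp add: T.zero)
  have val: "Bochner_Integration.simple_bochner_integral M (\<lambda>x. T (s j x))
      = T (Bochner_Integration.simple_bochner_integral M (s j))" for j
    by (rule simple_bochner_integral_linear[OF T.linear_axioms s])
  have fs: "(\<lambda>x. norm (f x - s j x)) \<in> borel_measurable M" for j
    using borel_measurable_norm_diff_simple[OF f] s by (simp add: simple_bochner_integrable.simps)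
  have "(\<lambda>j::nat. \<integral>\<^sup>+x. ennreal (norm (T (f x) - T (s j x))) \<partial>M) \<longlonglongrightarrow> 0"
  proof (rule tendsto_sandwich[of "\<lambda>_. 0"])
    show "(\<lambda>j. ennreal K * (\<integral>\<^sup>+x. ennreal (norm (f x - s j x)) \<partial>M)) \<longlonglongrightarrow> 0"
      using ennreal_tendsto_cmult[OF _ s0, of "ennreal K"] by simp
    have "(\<integral>\<^sup>+x. ennreal (norm (T (f x) - T (s j x))) \<partial>M)
        \<le> ennreal K * (\<integral>\<^sup>+x. ennreal (norm (f x - s j x)) \<partial>M)" for j
    proof -
      have "(\<integral>\<^sup>+x. ennreal (norm (T (f x) - T (s j x))) \<partial>M)
          \<le> (\<integral>\<^sup>+x. ennreal K * ennreal (norm (f x - s j x)) \<partial>M)"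
        using K by (intro nn_integral_mono)
          (simp add: T.diff[symmetric] ennreal_mult[symmetric] mult.commute[of K])
      then show ?thesis using fs by (simp add: nn_integral_cmult)
    qed
    then show "\<forall>\<^sub>F j in sequentially. (\<integral>\<^sup>+x. ennreal (norm (T (f x) - T (s j x))) \<partial>M)
        \<le> ennreal K * (\<integral>\<^sup>+x. ennreal (norm (f x - s j x)) \<partial>M)" by simp
  qed auto
  moreover have "(\<lambda>j. Bochner_Integration.simple_bochner_integral M (\<lambda>x. T (s j x))) \<longlonglongrightarrow> T y"
    unfolding val by (rule T.tendsto[OF sy])
  ultimately show ?thesis
    unfolding has_bochner_def using meas int
    by (intro conjI exI[where x = "\<lambda>j x. T (s j x)"] allI)
qed

lemma has_bochner_real_iff:
  fixes f :: "'a \<Rightarrow> real"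
  shows "has_bochner M f y \<longleftrightarrow> has_bochner_integral M f y"
  by (auto simp: has_bochner_def has_bochner_integral.simps)

text \<open>Simple approximations of a continuous map are obtained by composing it with simple
  approximations \<open>r j\<close> of the identity of the domain, which is separable even when the target is
  not. Discarding the values whose norm exceeds twice that of the limit keeps the approximation
  dominated by the integrable function \<open>2 * norm (h x)\<close>.\<close>

lemma continuous_imp_bochner_integrable:
  fixes h :: "'a::euclidean_space \<Rightarrow> 'b::banach"
  assumes \<Omega>: "open \<Omega>" and h: "continuous_on \<Omega> h"
    and fin: "(\<integral>\<^sup>+x. ennreal (norm (h x)) \<partial>leb_on \<Omega>) < \<infinity>"
  shows "bochner_integrable (leb_on \<Omega>) h"
proof -
  let ?M = "leb_on \<Omega>"
  have sp: "space ?M = \<Omega>" by (simp add: space_restrict_space)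
  have hm: "h \<in> borel_measurable ?M"
    using borel_measurable_continuous_on_restrict[OF h]
    by (simp cong: measurable_cong_sets sets_restrict_space_cong)
  have nm: "(\<lambda>x. norm (h x)) \<in> borel_measurable ?M"
    using borel_measurable_continuous_on_restrict[OF continuous_on_norm[OF h]]
    by (simp cong: measurable_cong_sets sets_restrict_space_cong)
  have idm: "(\<lambda>x. x) \<in> borel_measurable ?M"
    by (rule measurable_restrict_space1) simp
  obtain r where r: "\<And>j::nat. simple_function ?M (r j)"
    and rlim: "\<And>x. x \<in> \<Omega> \<Longrightarrow> (\<lambda>j. r j x) \<longlonglongrightarrow> x"
    using borel_measurable_implies_sequence_metric[OF idm, of 0] unfolding sp by metis
  define s where "s j x = (if r j x \<in> \<Omega> \<and> norm (h (r j x)) \<le> 2 * norm (h x) then h (r j x) else 0)"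
    for j x
  have s_simple: "simple_function ?M (s j)" for j
  proof -
    have "finite (r j ` \<Omega>)" using r[of j] unfolding simple_function_def sp by simp
    moreover have "s j ` \<Omega> \<subseteq> insert 0 (h ` r j ` \<Omega>)" by (auto simp: s_def)
    ultimately have fin: "finite (s j ` \<Omega>)" by (meson finite.insertI finite_imageI finite_subset)
    have meas: "s j -` {y} \<inter> \<Omega> \<in> sets ?M" if "y \<in> s j ` \<Omega>" for y
    proof -
      have A: "{x\<in>\<Omega>. r j x = c \<and> c \<in> \<Omega> \<and> norm (h c) \<le> 2 * norm (h x)} \<in> sets ?M" for c
      proof -
        have 1: "r j -` {c} \<inter> space ?M \<in> sets ?M" by (rule simple_functionD(2)[OF r])
        have 2: "{x \<in> space ?M. norm (h c) \<le> 2 * norm (h x)} \<in> sets ?M"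
          using nm by measurable
        have "{x\<in>\<Omega>. r j x = c \<and> c \<in> \<Omega> \<and> norm (h c) \<le> 2 * norm (h x)}
          = (if c \<in> \<Omega> then (r j -` {c} \<inter> space ?M) \<inter> {x \<in> space ?M. norm (h c) \<le> 2 * norm (h x)} else {})"
          unfolding sp by auto
        then show ?thesis using 1 2 by auto
      qed
      define G where "G = (\<Union>c\<in>r j ` \<Omega>. {x\<in>\<Omega>. r j x = c \<and> c \<in> \<Omega> \<and> norm (h c) \<le> 2 * norm (h x)})"
      have G: "G \<in> sets ?M" unfolding G_def using \<open>finite (r j ` \<Omega>)\<close> A by blast
      have O: "\<Omega> \<in> sets ?M" using sets.top[of ?M] by (simp add: sp)
      define P where "P = (\<Union>c\<in>{c\<in>r j ` \<Omega>. h c = y}.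
          {x\<in>\<Omega>. r j x = c \<and> c \<in> \<Omega> \<and> norm (h c) \<le> 2 * norm (h x)})"
      have P: "P \<in> sets ?M" unfolding P_def using \<open>finite (r j ` \<Omega>)\<close> A by (intro sets.finite_UN) auto
      have "s j -` {y} \<inter> \<Omega> = P \<union> (if y = 0 then \<Omega> - G else {})"
        by (auto simp: s_def P_def G_def split: if_splits)
      then show ?thesis using P G O by auto
    qed
    show ?thesis unfolding simple_function_def sp using fin meas by blast
  qed
  have s_bound: "norm (s j x) \<le> 2 * norm (h x)" for j x by (simp add: s_def)
  have s_int: "Bochner_Integration.simple_bochner_integrable ?M (s j)" for j
  proof (rule simple_bochner_integrableI_bounded[OF s_simple])
    have "(\<integral>\<^sup>+x. ennreal (norm (s j x)) \<partial>?M) \<le> (\<integral>\<^sup>+x. 2 * ennreal (norm (h x)) \<partial>?M)"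
    proof (rule nn_integral_mono)
      fix x
      have "ennreal (norm (s j x)) \<le> ennreal (2 * norm (h x))" using s_bound by (rule ennreal_leI)
      then show "ennreal (norm (s j x)) \<le> 2 * ennreal (norm (h x))" by (simp add: ennreal_mult)
    qed
    also have "\<dots> = 2 * (\<integral>\<^sup>+x. ennreal (norm (h x)) \<partial>?M)"
      using nm by (intro nn_integral_cmult) simp
    also have "\<dots> < \<infinity>" using fin by (simp add: ennreal_mult_less_top)
    finally show "(\<integral>\<^sup>+x. ennreal (norm (s j x)) \<partial>?M) < \<infinity>" .
  qed
  have s_lim: "(\<lambda>j. s j x) \<longlonglongrightarrow> h x" if x: "x \<in> \<Omega>" for x
  proof -
    have ev: "\<forall>\<^sub>F j in sequentially. r j x \<in> \<Omega>"
      using topological_tendstoD[OF rlim[OF x] \<Omega> x] .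
    have hr: "(\<lambda>j. h (r j x)) \<longlonglongrightarrow> h x"
      using continuous_on_tendsto_compose[OF h rlim[OF x] x ev] .
    show ?thesis
    proof (cases "h x = 0")
      case True
      then have "s j x = 0" for j by (simp add: s_def)
      then show ?thesis using True by simp
    next
      case False
      then have "norm (h x) < 2 * norm (h x)" by simp
      then have "\<forall>\<^sub>F j in sequentially. norm (h (r j x)) < 2 * norm (h x)"
        using order_tendstoD(2)[OF tendsto_norm[OF hr]] by blast
      with ev have "\<forall>\<^sub>F j in sequentially. h (r j x) = s j x"
        by eventually_elim (simp add: s_def)
      then show ?thesis by (rule Lim_transform_eventually[OF hr])
    qed
  qed
  have nmeas: "(\<lambda>x. norm (h x - s j x)) \<in> borel_measurable ?M" for j
    by (rule borel_measurable_norm_diff_simple[OF hm s_simple])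
  have conv: "(\<lambda>j. \<integral>\<^sup>+x. ennreal (norm (h x - s j x)) \<partial>?M) \<longlonglongrightarrow> 0"
  proof -
    have "(\<lambda>j. \<integral>\<^sup>+x. ennreal (norm (h x - s j x)) \<partial>?M) \<longlonglongrightarrow> (\<integral>\<^sup>+x. 0 \<partial>?M)"
    proof (rule nn_integral_dominated_convergence[where w = "\<lambda>x. ennreal (3 * norm (h x))"])
      show "AE x in ?M. ennreal (norm (h x - s j x)) \<le> ennreal (3 * norm (h x))" for j
      proof (rule AE_I2, rule ennreal_leI)
        fix x
        show "norm (h x - s j x) \<le> 3 * norm (h x)"
          using norm_triangle_ineq4[of "h x" "s j x"] s_bound[of j x] by linarith
      qed
      have "(\<integral>\<^sup>+x. ennreal (3 * norm (h x)) \<partial>?M) = 3 * (\<integral>\<^sup>+x. ennreal (norm (h x)) \<partial>?M)"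
        using nm by (subst nn_integral_cmult[symmetric]) (simp_all add: ennreal_mult)
      then show "(\<integral>\<^sup>+x. ennreal (3 * norm (h x)) \<partial>?M) < \<infinity>"
        using fin by (simp add: ennreal_mult_less_top)
      show "AE x in ?M. (\<lambda>j. ennreal (norm (h x - s j x))) \<longlonglongrightarrow> 0"
      proof (rule AE_I2)
        fix x assume "x \<in> space ?M"
        then have "(\<lambda>j. s j x) \<longlonglongrightarrow> h x" using s_lim sp by simp
        then have "(\<lambda>j. norm (h x - s j x)) \<longlonglongrightarrow> norm (h x - h x)" by (intro tendsto_intros)
        then show "(\<lambda>j. ennreal (norm (h x - s j x))) \<longlonglongrightarrow> 0"
          using tendsto_ennrealI by fastforce
      qed
    qed (use nm nmeas in measurable)
    then show ?thesis by simp
  qed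
  let ?I = "\<lambda>j. Bochner_Integration.simple_bochner_integral ?M (s j)"
  have "Cauchy ?I"
  proof (rule metric_CauchyI)
    fix e :: real assume "0 < e"
    then have "0 < ennreal (e/2)" by simp
    then have "\<forall>\<^sub>F j in sequentially. (\<integral>\<^sup>+x. ennreal (norm (h x - s j x)) \<partial>?M) < ennreal (e/2)"
      using order_tendstoD(2)[OF conv] by blast
    then obtain N where N: "\<And>j. j \<ge> N \<Longrightarrow> (\<integral>\<^sup>+x. ennreal (norm (h x - s j x)) \<partial>?M) < ennreal (e/2)"
      unfolding eventually_sequentially by blast
    have "dist (?I i) (?I j) < e" if "i \<ge> N" "j \<ge> N" for i j
    proof -
      have "ennreal (dist (?I i) (?I j))
          \<le> (\<integral>\<^sup>+x. ennreal (norm (h x - s i x)) \<partial>?M) + (\<integral>\<^sup>+x. ennreal (norm (h x - s j x)) \<partial>?M)"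
        unfolding dist_norm by (rule norm_simple_integral_diff_le[OF hm s_int s_int])
      also have "\<dots> < ennreal (e/2) + ennreal (e/2)"
        using N that by (intro add_strict_mono) auto
      also have "\<dots> = ennreal e" using \<open>0 < e\<close> by (simp add: ennreal_plus[symmetric] del: ennreal_plus)
      finally show ?thesis using \<open>0 < e\<close> by (simp add: ennreal_less_iff)
    qed
    then show "\<exists>N. \<forall>m\<ge>N. \<forall>n\<ge>N. dist (?I m) (?I n) < e" by blast
  qed
  then obtain y where "?I \<longlonglongrightarrow> y" using Cauchy_convergent convergentD by blast
  then show ?thesis
    unfolding bochner_integrable_def has_bochner_def using hm s_int conv by blast
qed

section \<open>Orthonormal bases of a Hilbert space\<close>

lemma parallelogram:
  fixes a b :: "'h::real_inner"
  shows "(norm (a - b))\<^sup>2 = 2 * (norm a)\<^sup>2 + 2 * (norm b)\<^sup>2 - (norm (a + b))\<^sup>2"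
  by (simp add: power2_norm_eq_inner inner_simps inner_commute)

text \<open>A minimizing sequence for the distance from \<open>x\<close> to \<open>S\<close> is Cauchy by the parallelogram law,
  and the residual at the nearest point is orthogonal to \<open>S\<close>.\<close>

lemma exists_nonzero_orthogonal:
  fixes S :: "'h::{real_inner,banach} set"
  assumes S: "subspace S" "closed S" and x: "x \<notin> S"
  obtains z where "z \<noteq> 0" "\<And>y. y \<in> S \<Longrightarrow> z \<bullet> y = 0"
proof -
  define d where "d = infdist x S"
  have ne: "S \<noteq> {}" using S(1) subspace_0 by blast
  have d0: "0 \<le> d" unfolding d_def by (rule infdist_nonneg)
  have dle: "d \<le> norm (x - y)" if "y \<in> S" for y
    unfolding d_def using infdist_le[OF that, of x] by (simp add: dist_norm)
  have "\<exists>y\<in>S. norm (x - y) < d + e" if "0 < e" for e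
  proof (rule ccontr)
    assume "\<not> (\<exists>y\<in>S. norm (x - y) < d + e)"
    then have "d + e \<le> d"
      unfolding d_def infdist_notempty[OF ne] by (intro cINF_greatest ne) (force simp: dist_norm)
    then show False using that by simp
  qed
  then have "\<forall>n. \<exists>y\<in>S. norm (x - y) < d + 1 / real (Suc n)" by simp
  then obtain u where u: "\<And>n. u n \<in> S" "\<And>n. norm (x - u n) < d + 1 / real (Suc n)"
    by metis
  have lim: "(\<lambda>n. norm (x - u n)) \<longlonglongrightarrow> d"
  proof (rule tendsto_sandwich[of "\<lambda>_. d"])
    show "(\<lambda>n. d + 1 / real (Suc n)) \<longlonglongrightarrow> d"
      using tendsto_add[OF tendsto_const LIMSEQ_Suc[OF lim_1_over_n], of d] by simp
  qed (use u dle in \<open>auto intro!: always_eventually less_imp_le\<close>)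
  have "Cauchy u"
  proof (rule metric_CauchyI)
    fix e :: real assume e: "0 < e"
    have "(\<lambda>n. (norm (x - u n))\<^sup>2) \<longlonglongrightarrow> d\<^sup>2" by (intro tendsto_intros lim)
    moreover have "d\<^sup>2 < d\<^sup>2 + e\<^sup>2 / 4" using e by simp
    ultimately have "\<forall>\<^sub>F n in sequentially. (norm (x - u n))\<^sup>2 < d\<^sup>2 + e\<^sup>2 / 4"
      by (rule order_tendstoD(2))
    then obtain N where N: "\<And>n. n \<ge> N \<Longrightarrow> (norm (x - u n))\<^sup>2 < d\<^sup>2 + e\<^sup>2 / 4"
      unfolding eventually_sequentially by blast
    have "dist (u m) (u n) < e" if "m \<ge> N" "n \<ge> N" for m n
    proof -
      have "(1/2) *\<^sub>R (u m + u n) \<in> S" using S(1) u(1) by (simp add: subspace_add subspace_scale)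
      from dle[OF this] have "2 * d \<le> 2 * norm (x - (1/2) *\<^sub>R (u m + u n))" by simp
      also have "\<dots> = norm ((x - u m) + (x - u n))"
      proof -
        have "(x - u m) + (x - u n) = 2 *\<^sub>R (x - (1/2) *\<^sub>R (u m + u n))"
          by (simp add: algebra_simps scaleR_2)
        then show ?thesis by simp
      qed
      finally have "(2 * d)\<^sup>2 \<le> (norm ((x - u m) + (x - u n)))\<^sup>2" using d0 by (intro power_mono) auto
      then have "(norm ((x - u m) - (x - u n)))\<^sup>2 < e\<^sup>2"
        using parallelogram[of "x - u m" "x - u n"] N[OF that(1)] N[OF that(2)]
        by (simp add: power_mult_distrib)
      then have "norm ((x - u m) - (x - u n)) < e" using e by (simp add: power2_less_imp_less)
      then show ?thesis by (simp add: dist_norm norm_minus_commute)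
    qed
    then show "\<exists>N. \<forall>m\<ge>N. \<forall>n\<ge>N. dist (u m) (u n) < e" by blast
  qed
  then obtain p where p: "u \<longlonglongrightarrow> p" using Cauchy_convergent convergentD by blast
  have pS: "p \<in> S" using closed_sequentially[OF S(2) u(1) p] .
  have "(\<lambda>n. norm (x - u n)) \<longlonglongrightarrow> norm (x - p)" by (intro tendsto_intros p)
  with lim have dp: "norm (x - p) = d" using LIMSEQ_unique by blast
  define z where "z = x - p"
  have "z \<noteq> 0" using pS x by (auto simp: z_def)
  moreover have "z \<bullet> y = 0" if y: "y \<in> S" for y
  proof (cases "y = 0")
    case False
    define t where "t = (z \<bullet> y) / (y \<bullet> y)"
    have yy: "0 < y \<bullet> y" using False by simp
    have "p + t *\<^sub>R y \<in> S" using S(1) pS y by (simp add: subspace_add subspace_scale)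
    from dle[OF this] have "norm z \<le> norm (z - t *\<^sub>R y)"
      by (simp add: dp[symmetric] z_def algebra_simps)
    then have "(norm z)\<^sup>2 \<le> (norm (z - t *\<^sub>R y))\<^sup>2" by (intro power_mono) auto
    also have "\<dots> = (norm z)\<^sup>2 - (z \<bullet> y)\<^sup>2 / (y \<bullet> y)"
      unfolding power2_norm_eq_inner
      using yy by (simp add: inner_simps inner_commute t_def field_simps power2_eq_square)
    finally have "(z \<bullet> y)\<^sup>2 / (y \<bullet> y) \<le> 0" by simp
    then have "(z \<bullet> y)\<^sup>2 \<le> 0" using yy by (simp add: divide_le_0_iff)
    then show ?thesis by simp
  qed simp
  ultimately show ?thesis using that by blast
qed

lemma subspace_closure:
  fixes S :: "'h::real_normed_vector set"
  assumes S: "subspace S"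
  shows "subspace (closure S)"
proof (rule subspaceI)
  show "0 \<in> closure S" using S closure_subset subspace_0 by blast
  fix x y assume "x \<in> closure S" "y \<in> closure S"
  then obtain u w where "\<And>n. u n \<in> S" "u \<longlonglongrightarrow> x" "\<And>n. w n \<in> S" "w \<longlonglongrightarrow> y"
    by (auto simp: closure_sequential)
  then have "\<And>n. u n + w n \<in> S" "(\<lambda>n. u n + w n) \<longlonglongrightarrow> x + y"
    using S by (auto intro: subspace_add tendsto_add)
  then show "x + y \<in> closure S"
    unfolding closure_sequential by (intro exI[where x = "\<lambda>n. u n + w n"]) simp
next
  fix c x assume "x \<in> closure S"
  then obtain u where "\<And>n. u n \<in> S" "u \<longlonglongrightarrow> x" by (auto simp: closure_sequential)
  then have "\<And>n. c *\<^sub>R u n \<in> S" "(\<lambda>n. c *\<^sub>R u n) \<longlonglongrightarrow> c *\<^sub>R x"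
    using S by (auto intro: subspace_scale tendsto_intros)
  then show "c *\<^sub>R x \<in> closure S"
    unfolding closure_sequential by (intro exI[where x = "\<lambda>n. c *\<^sub>R u n"]) simp
qed

text \<open>A maximal orthonormal set is a basis, because a nonzero vector orthogonal to the closure of its
  span could be normalized and added.\<close>

lemma exists_orthonormal_basis: "\<exists>E :: 'h::{real_inner,banach} set. orthonormal_basis E"
proof -
  define ON :: "'h set set" where "ON = {E. pairwise orthogonal E \<and> (\<forall>e\<in>E. norm e = 1)}"
  have "\<exists>E\<in>ON. \<forall>X\<in>ON. E \<subseteq> X \<longrightarrow> X = E"
  proof (rule subset_Zorn')
    fix c assume c: "subset.chain ON c"
    have "pairwise orthogonal (\<Union>c)"
      using c unfolding ON_def by (intro pairwise_chain_Union) (auto simp: subset_chain_def chain_subset_def)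
    then show "\<Union>c \<in> ON" using c by (auto simp: ON_def subset_chain_def)
  qed
  then obtain E where E: "E \<in> ON" and max: "\<And>X. X \<in> ON \<Longrightarrow> E \<subseteq> X \<Longrightarrow> X = E" by blast
  have "closure (span E) = UNIV"
  proof (rule ccontr)
    assume "closure (span E) \<noteq> UNIV"
    then obtain x where x: "x \<notin> closure (span E)" by blast
    obtain z where z: "z \<noteq> 0" "\<And>y. y \<in> closure (span E) \<Longrightarrow> z \<bullet> y = 0"
      using exists_nonzero_orthogonal[OF _ closed_closure x] by (auto simp: subspace_span subspace_closure)
    define w where "w = z /\<^sub>R norm z"
    have w: "norm w = 1" using z(1) by (simp add: w_def)
    have wE: "w \<bullet> e = 0" if "e \<in> E" for e
      using z(2)[of e] that closure_subset span_base by (fastforce simp: w_def)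
    have "insert w E \<in> ON"
      using E w wE by (auto simp: ON_def pairwise_insert orthogonal_def inner_commute)
    then have "w \<in> E" using max[of "insert w E"] by blast
    then show False using wE[of w] w by (simp add: norm_eq_sqrt_inner)
  qed
  then show ?thesis using E by (auto simp: ON_def orthonormal_basis_def)
qed

lemma bessel_inequality:
  fixes v :: "'h::real_inner"
  assumes "finite F" and orth: "pairwise orthogonal F" and unit: "\<And>e. e \<in> F \<Longrightarrow> norm e = 1"
  shows "(\<Sum>e\<in>F. (v \<bullet> e)\<^sup>2) \<le> (norm v)\<^sup>2"
proof -
  define p where "p = (\<Sum>e\<in>F. (v \<bullet> e) *\<^sub>R e)"
  have ee: "e \<bullet> e' = (if e = e' then 1 else 0)" if "e \<in> F" "e' \<in> F" for e e'
    using that orth unit[of e] by (auto simp: pairwise_def orthogonal_def norm_eq_sqrt_inner)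
  then have pe: "p \<bullet> e = v \<bullet> e" if "e \<in> F" for e
  proof -
    have "p \<bullet> e = (\<Sum>e'\<in>F. if e' = e then v \<bullet> e' else 0)"
      unfolding p_def inner_sum_left using that ee
      by (intro sum.cong) auto
    then show ?thesis using that \<open>finite F\<close> by simp
  qed
  have "p \<bullet> p = (\<Sum>e\<in>F. (v \<bullet> e)\<^sup>2)"
  proof -
    have "p \<bullet> p = (\<Sum>e\<in>F. (v \<bullet> e) * (p \<bullet> e))" by (subst (2) p_def) (simp add: inner_sum_right)
    then show ?thesis using pe by (simp add: power2_eq_square)
  qed
  moreover have "v \<bullet> p = (\<Sum>e\<in>F. (v \<bullet> e)\<^sup>2)"
    by (simp add: p_def inner_sum_right power2_eq_square)
  moreover have "0 \<le> (v - p) \<bullet> (v - p)" by simp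
  ultimately show ?thesis
    by (simp add: inner_simps inner_commute power2_norm_eq_inner)
qed

section \<open>Regularized quadratic functionals\<close>

lemma blinfun_apply_ridge_op [simp]: "blinfun_apply (ridge_op T lam) f = T f + lam *\<^sub>R f"
  by (simp add: ridge_op_def blinfun.add_left blinfun.scaleR_left)

text \<open>Solving \<open>(T + lam I) f = g\<close> amounts to finding a fixed point of
  \<open>f \<mapsto> f - t ((T + lam I) f - g)\<close>. Positivity makes this a contraction for the small step
  \<open>t = lam / L\<^sup>2\<close>, where \<open>L\<close> bounds the norm of \<open>T + lam I\<close>, since then
  \<open>norm (h - t (T + lam I) h)\<^sup>2 \<le> (1 - t lam) (norm h)\<^sup>2\<close>.\<close>

lemma bij_ridge_op:
  fixes T :: "'h::{real_inner,banach} \<Rightarrow>\<^sub>L 'h"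
  assumes T: "positive_op T" and lam: "0 < lam"
  shows "bij (blinfun_apply (ridge_op T lam))"
proof (rule bijI)
  define A where "A = ridge_op T lam"
  have coercive: "lam * (norm h)\<^sup>2 \<le> h \<bullet> A h" for h
    using T by (simp add: A_def positive_op_def inner_simps power2_norm_eq_inner)
  show "inj (blinfun_apply (ridge_op T lam))"
  proof (rule injI)
    fix f g assume "blinfun_apply (ridge_op T lam) f = blinfun_apply (ridge_op T lam) g"
    then have "A (f - g) = 0" by (simp add: A_def[symmetric] blinfun.diff_right)
    then have "lam * (norm (f - g))\<^sup>2 \<le> 0" using coercive[of "f - g"] by simp
    then show "f = g" using lam by (simp add: mult_le_0_iff)
  qed
  show "surj (blinfun_apply (ridge_op T lam))"
    unfolding A_def[symmetric]
  proof (rule surjI)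
    fix g
    define L where "L = norm A + lam"
    define t where "t = lam / L\<^sup>2"
    define c where "c = sqrt (1 - t * lam)"
    have L: "lam \<le> L" "0 < L" using lam by (auto simp: L_def add_nonneg_pos)
    have t: "0 < t" using lam L by (simp add: t_def)
    have "lam\<^sup>2 \<le> L\<^sup>2" using lam L by (intro power_mono) auto
    then have tl: "t * lam \<le> 1" using L by (simp add: t_def power2_eq_square)
    have tL: "t\<^sup>2 * L\<^sup>2 = t * lam" using L by (simp add: t_def power2_eq_square)
    have step: "norm (h - t *\<^sub>R A h) \<le> c * norm h" for h
    proof (rule power2_le_imp_le)
      have "norm (A h) \<le> L * norm h"
        using norm_blinfun[of A h] lam by (simp add: L_def distrib_right add_increasing2)
      then have Ah: "(norm (A h))\<^sup>2 \<le> L\<^sup>2 * (norm h)\<^sup>2"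
        using power_mono[of "norm (A h)" "L * norm h" 2] by (simp add: power_mult_distrib)
      have "(norm (h - t *\<^sub>R A h))\<^sup>2 = (norm h)\<^sup>2 - 2 * t * (h \<bullet> A h) + t\<^sup>2 * (norm (A h))\<^sup>2"
        unfolding power2_norm_eq_inner
        by (simp add: inner_simps inner_commute power2_eq_square[of t] algebra_simps)
      also have "\<dots> \<le> (norm h)\<^sup>2 - 2 * t * (lam * (norm h)\<^sup>2) + t\<^sup>2 * (L\<^sup>2 * (norm h)\<^sup>2)"
        using t coercive[of h] Ah by (intro add_mono diff_mono mult_left_mono) auto
      also have "\<dots> = (1 - t * lam) * (norm h)\<^sup>2"
        using tL by (simp add: algebra_simps)
      also have "\<dots> = (c * norm h)\<^sup>2" using tl by (simp add: c_def power_mult_distrib)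
      finally show "(norm (h - t *\<^sub>R A h))\<^sup>2 \<le> (c * norm h)\<^sup>2" .
      show "0 \<le> c * norm h" using tl by (simp add: c_def)
    qed
    have c: "0 \<le> c" "c < 1" using tl t lam by (auto simp: c_def)
    have "\<exists>!f. f - t *\<^sub>R (A f - g) = f"
    proof (rule banach_fix_type[OF c])
      show "\<forall>x y. dist (x - t *\<^sub>R (A x - g)) (y - t *\<^sub>R (A y - g)) \<le> c * dist x y"
      proof (intro allI)
        fix x y
        have eq: "(x - t *\<^sub>R (A x - g)) - (y - t *\<^sub>R (A y - g)) = (x - y) - t *\<^sub>R A (x - y)"
          by (simp add: blinfun.diff_right algebra_simps)
        show "dist (x - t *\<^sub>R (A x - g)) (y - t *\<^sub>R (A y - g)) \<le> c * dist x y"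
          unfolding dist_norm eq by (rule step)
      qed
    qed
    then obtain f where "f - t *\<^sub>R (A f - g) = f" by blast
    then have "A f = g" using t by simp
    then show "A (SOME f. A f = g) = g" by (rule someI)
  qed
qed

text \<open>Completing the square at the solution \<open>f0\<close> of \<open>(T + lam I) f0 = - b\<close> turns the objective into
  \<open>Q f0 + (f - f0) \<bullet> (T + lam I) (f - f0) / 2\<close>.\<close>

lemma ridge_minimizer:
  fixes T :: "'h::{real_inner,banach} \<Rightarrow>\<^sub>L 'h"
  assumes T: "positive_op T" and lam: "0 < lam"
    and Q: "\<And>f. Q f = 1/2 * (f \<bullet> T f) + f \<bullet> b + c + lam/2 * (norm f)\<^sup>2"
  shows "is_arg_min Q (\<lambda>_. True) f \<longleftrightarrow> f = - op_inv (ridge_op T lam) b"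
proof -
  define A where "A = ridge_op T lam"
  define f0 where "f0 = - op_inv A b"
  have sym: "T f \<bullet> g = f \<bullet> T g" and pos: "0 \<le> f \<bullet> T f" for f g
    using T by (auto simp: positive_op_def)
  have "A (op_inv A b) = b"
    unfolding A_def by (rule surj_f_inv_f[OF bij_is_surj[OF bij_ridge_op[OF T lam]]])
  then have "A f0 = - b"
    by (simp add: f0_def blinfun.minus_right)
  then have f0: "T f0 + lam *\<^sub>R f0 = - b"
    by (simp add: A_def)
  have square: "Q f = Q f0 + 1/2 * ((f - f0) \<bullet> T (f - f0)) + lam/2 * (norm (f - f0))\<^sup>2" for f
  proof -
    have "b = - (T f0 + lam *\<^sub>R f0)" using f0 by simp
    then have b: "g \<bullet> b = - (g \<bullet> T f0) - lam * (g \<bullet> f0)" for g by (simp add: inner_simps)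
    show ?thesis
      unfolding Q b using sym[of f0 f]
      by (simp add: blinfun.diff_right inner_simps power2_norm_eq_inner inner_commute algebra_simps)
  qed
  have lt: "Q f0 < Q f" if "f \<noteq> f0" for f
  proof -
    have "0 < lam/2 * (norm (f - f0))\<^sup>2" using lam that by simp
    then show ?thesis using square[of f] pos[of "f - f0"] by simp
  qed
  show ?thesis
    unfolding is_arg_min_def f0_def[unfolded A_def, symmetric] using lt by (metis less_asym less_irrefl)
qed

lemma positive_op_tensor_op: "positive_op (tensor_op u u)"
  by (auto simp: positive_op_def tensor_op.rep_eq inner_commute)

lemma positive_op_add: "positive_op S \<Longrightarrow> positive_op T \<Longrightarrow> positive_op (S + T)"
  by (simp add: positive_op_def blinfun.add_left inner_simps)

lemma positive_op_scaleR: "0 \<le> c \<Longrightarrow> positive_op T \<Longrightarrow> positive_op (c *\<^sub>R T)"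
  by (simp add: positive_op_def blinfun.scaleR_left)

lemma positive_op_sum:
  assumes "\<And>a. a \<in> I \<Longrightarrow> positive_op (T a)"
  shows "positive_op (\<Sum>a\<in>I. T a)"
  using assms
proof (induction I rule: infinite_finite_induct)
  case (insert a I)
  then show ?case by (simp add: positive_op_add)
qed (simp_all add: positive_op_def)

section \<open>Differentiating the feature map of a kernel\<close>

lemma mean_value_signed:
  fixes f :: "real \<Rightarrow> real"
  assumes der: "\<And>s. \<bar>s\<bar> \<le> \<bar>h\<bar> \<Longrightarrow> (f has_real_derivative f' s) (at s)"
  obtains \<theta> where "\<bar>\<theta>\<bar> \<le> \<bar>h\<bar>" "f h - f 0 = h * f' \<theta>"
proof -
  consider "h > 0" | "h < 0" | "h = 0" by linarith
  then show ?thesis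
  proof cases
    case 1
    from MVT2[OF 1, of f f'] der obtain z where "0 < z" "z < h" "f h - f 0 = (h - 0) * f' z" by auto
    then show ?thesis using that[of z] by simp
  next
    case 2
    from MVT2[OF 2, of f f'] der obtain z where "h < z" "z < 0" "f 0 - f h = (0 - h) * f' z" by auto
    then show ?thesis using that[of z] by simp
  next
    case 3
    then show ?thesis using that[of 0] by simp
  qed
qed

lemma mean_value_second_difference:
  fixes f :: "real \<Rightarrow> real"
  assumes d1: "\<And>s. \<bar>s\<bar> \<le> \<bar>h\<bar> + \<bar>l\<bar> \<Longrightarrow> (f has_real_derivative f' s) (at s)"
    and d2: "\<And>s. \<bar>s\<bar> \<le> \<bar>h\<bar> + \<bar>l\<bar> \<Longrightarrow> (f' has_real_derivative f'' s) (at s)"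
  obtains \<theta> where "\<bar>\<theta>\<bar> \<le> \<bar>h\<bar> + \<bar>l\<bar>" "f (h + l) - f h - f l + f 0 = h * l * f'' \<theta>"
proof -
  have "((\<lambda>s. f (s + l) - f s) has_real_derivative f' (s + l) - f' s) (at s)" if "\<bar>s\<bar> \<le> \<bar>h\<bar>" for s
  proof (rule DERIV_diff)
    show "((\<lambda>s. f (s + l)) has_real_derivative f' (s + l)) (at s)"
      using d1[of "s + l"] that by (simp add: DERIV_shift)
    show "(f has_real_derivative f' s) (at s)" using that by (intro d1) simp
  qed
  then obtain \<theta>1 where \<theta>1: "\<bar>\<theta>1\<bar> \<le> \<bar>h\<bar>"
      "(f (h + l) - f h) - (f (0 + l) - f 0) = h * (f' (\<theta>1 + l) - f' \<theta>1)"
    by (rule mean_value_signed)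
  have "((\<lambda>s. f' (\<theta>1 + s)) has_real_derivative f'' (\<theta>1 + s)) (at s)" if "\<bar>s\<bar> \<le> \<bar>l\<bar>" for s
    using d2[of "\<theta>1 + s"] that \<theta>1(1) DERIV_shift[of f' _ s \<theta>1] by (simp add: add.commute)
  then obtain \<theta>2 where \<theta>2: "\<bar>\<theta>2\<bar> \<le> \<bar>l\<bar>" "f' (\<theta>1 + l) - f' (\<theta>1 + 0) = l * f'' (\<theta>1 + \<theta>2)"
    by (rule mean_value_signed)
  show ?thesis
  proof (rule that)
    show "\<bar>\<theta>1 + \<theta>2\<bar> \<le> \<bar>h\<bar> + \<bar>l\<bar>" using \<theta>1(1) \<theta>2(1) by linarith
    show "f (h + l) - f h - f l + f 0 = h * l * f'' (\<theta>1 + \<theta>2)"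
      using \<theta>1(2) \<theta>2(2) by simp
  qed
qed

lemma
  fixes g :: "'v::real_normed_vector \<times> 'v \<Rightarrow> real"
  shows has_real_derivative_fst_arg:
    "\<lbrakk>\<forall>z\<in>\<Omega> \<times> \<Omega>. (\<lambda>t. g (z + t *\<^sub>R (e, 0))) differentiable (at 0); x + s *\<^sub>R e \<in> \<Omega>; y \<in> \<Omega>\<rbrakk>
      \<Longrightarrow> ((\<lambda>s. g (x + s *\<^sub>R e, y)) has_real_derivative dir_deriv (e, 0) g (x + s *\<^sub>R e, y)) (at s)"
    and has_real_derivative_snd_arg:
    "\<lbrakk>\<forall>z\<in>\<Omega> \<times> \<Omega>. (\<lambda>t. g (z + t *\<^sub>R (0, e))) differentiable (at 0); x \<in> \<Omega>; y + s *\<^sub>R e \<in> \<Omega>\<rbrakk>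
      \<Longrightarrow> ((\<lambda>s. g (x, y + s *\<^sub>R e)) has_real_derivative dir_deriv (0, e) g (x, y + s *\<^sub>R e)) (at s)"
proof -
  have shift: "((\<lambda>s. g (z + s *\<^sub>R v)) has_real_derivative dir_deriv v g (z + s *\<^sub>R v)) (at s)"
    if "(\<lambda>t. g ((z + s *\<^sub>R v) + t *\<^sub>R v)) differentiable (at 0)" for z v s
  proof -
    have "((\<lambda>t. g ((z + s *\<^sub>R v) + t *\<^sub>R v)) has_real_derivative dir_deriv v g (z + s *\<^sub>R v)) (at 0)"
      using that unfolding dir_deriv_def by (simp add: DERIV_deriv_iff_real_differentiable)
    then have "((\<lambda>t. g (z + (t + s) *\<^sub>R v)) has_real_derivative dir_deriv v g (z + s *\<^sub>R v)) (at 0)"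
      by (simp add: algebra_simps)
    then show ?thesis using DERIV_shift[of "\<lambda>t. g (z + t *\<^sub>R v)" _ 0 s] by simp
  qed
  {
    assume "\<forall>z\<in>\<Omega> \<times> \<Omega>. (\<lambda>t. g (z + t *\<^sub>R (e, 0))) differentiable (at 0)" "x + s *\<^sub>R e \<in> \<Omega>" "y \<in> \<Omega>"
    then have "(\<lambda>t. g (((x, y) + s *\<^sub>R (e, 0)) + t *\<^sub>R (e, 0))) differentiable (at 0)"
      by (intro bspec[where x = "(x, y) + s *\<^sub>R (e, 0)"]) auto
    from shift[OF this]
    show "((\<lambda>s. g (x + s *\<^sub>R e, y)) has_real_derivative dir_deriv (e, 0) g (x + s *\<^sub>R e, y)) (at s)"
      by simp
  }
  {
    assume "\<forall>z\<in>\<Omega> \<times> \<Omega>. (\<lambda>t. g (z + t *\<^sub>R (0, e))) differentiable (at 0)" "x \<in> \<Omega>" "y + s *\<^sub>R e \<in> \<Omega>"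
    then have "(\<lambda>t. g (((x, y) + s *\<^sub>R (0, e)) + t *\<^sub>R (0, e))) differentiable (at 0)"
      by (intro bspec[where x = "(x, y) + s *\<^sub>R (0, e)"]) auto
    from shift[OF this]
    show "((\<lambda>s. g (x, y + s *\<^sub>R e)) has_real_derivative dir_deriv (0, e) g (x, y + s *\<^sub>R e)) (at s)"
      by simp
  }
qed

text \<open>The Gram function determines convergence: if \<open>q a \<bullet> q b\<close> tends to a limit as \<open>a\<close> and \<open>b\<close> vary
  independently, then \<open>norm (q a - q b)\<^sup>2 = q a \<bullet> q a - 2 (q a \<bullet> q b) + q b \<bullet> q b\<close> tends to \<open>0\<close>.\<close>

lemma gram_limit_imp_convergent:
  fixes q :: "'a \<Rightarrow> 'h::{real_inner,banach}"
  assumes F: "F \<noteq> bot" and lim: "((\<lambda>(a, b). q a \<bullet> q b) \<longlongrightarrow> L) (F \<times>\<^sub>F F)"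
  obtains W where "(q \<longlongrightarrow> W) F"
proof -
  have "cauchy_filter (filtermap q F)"
    unfolding cauchy_filter_metric_filtermap
  proof (intro allI impI)
    fix e :: real assume e: "0 < e"
    then have "\<forall>\<^sub>F p in F \<times>\<^sub>F F. dist (case p of (a, b) \<Rightarrow> q a \<bullet> q b) L < e\<^sup>2 / 4"
      by (intro tendstoD[OF lim]) simp
    then obtain P where P: "eventually P F"
        "\<And>a b. P a \<Longrightarrow> P b \<Longrightarrow> \<bar>q a \<bullet> q b - L\<bar> < e\<^sup>2 / 4"
      unfolding eventually_prod_same by (auto simp: dist_real_def)
    have "dist (q a) (q b) < e" if "P a" "P b" for a b
    proof -
      have "(dist (q a) (q b))\<^sup>2 = q a \<bullet> q a - 2 * (q a \<bullet> q b) + q b \<bullet> q b"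
        unfolding dist_norm power2_norm_eq_inner by (simp add: inner_simps inner_commute)
      also have "\<dots> < e\<^sup>2"
        using P(2)[OF that(1) that(1)] P(2)[OF that] P(2)[OF that(2) that(2)] by linarith
      finally show ?thesis using e by (simp add: power2_less_imp_less)
    qed
    then show "\<exists>P. eventually P F \<and> (\<forall>x y. P x \<and> P y \<longrightarrow> dist (q x) (q y) < e)" using P(1) by blast
  qed
  moreover have "filtermap q F \<noteq> bot" using F by (simp add: filtermap_bot_iff)
  ultimately obtain W where "filtermap q F \<le> nhds W"
    using cauchy_filter_complete_converges[OF _ complete_UNIV] by auto
  then show ?thesis using that by (simp add: filterlim_def)
qed

lemma gram_limits:
  fixes q :: "'p \<Rightarrow> 'a \<Rightarrow> 'h::{real_inner,banach}"
  assumes F: "F \<noteq> bot"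
    and lim: "\<And>x y. x \<in> S \<Longrightarrow> y \<in> S \<Longrightarrow> ((\<lambda>(a, b). q x a \<bullet> q y b) \<longlongrightarrow> L (x, y)) (F \<times>\<^sub>F F)"
  obtains W where "\<And>x. x \<in> S \<Longrightarrow> (q x \<longlongrightarrow> W x) F"
    and "\<And>x y. x \<in> S \<Longrightarrow> y \<in> S \<Longrightarrow> W x \<bullet> W y = L (x, y)"
proof -
  have "\<forall>x\<in>S. \<exists>w. (q x \<longlongrightarrow> w) F"
    using gram_limit_imp_convergent[OF F lim] by metis
  then obtain W where W: "\<And>x. x \<in> S \<Longrightarrow> (q x \<longlongrightarrow> W x) F" by metis
  have "W x \<bullet> W y = L (x, y)" if "x \<in> S" "y \<in> S" for x y
  proof (rule tendsto_unique)
    show "F \<times>\<^sub>F F \<noteq> bot" using F by (simp add: prod_filter_eq_bot)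
    show "((\<lambda>(a, b). q x a \<bullet> q y b) \<longlongrightarrow> L (x, y)) (F \<times>\<^sub>F F)" by (rule lim[OF that])
    have "((\<lambda>p. q x (fst p) \<bullet> q y (snd p)) \<longlongrightarrow> W x \<bullet> W y) (F \<times>\<^sub>F F)"
      by (intro tendsto_inner filterlim_compose[OF W[OF that(1)] filterlim_fst]
        filterlim_compose[OF W[OF that(2)] filterlim_snd])
    then show "((\<lambda>(a, b). q x a \<bullet> q y b) \<longlongrightarrow> W x \<bullet> W y) (F \<times>\<^sub>F F)"
      by (simp add: case_prod_unfold)
  qed
  with W that show ?thesis by blast
qed

lemma continuous_on_if_gram_continuous:
  fixes D :: "'v::topological_space \<Rightarrow> 'h::real_inner"
  assumes gram: "\<And>x y. x \<in> \<Omega> \<Longrightarrow> y \<in> \<Omega> \<Longrightarrow> D x \<bullet> D y = g (x, y)"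
    and g: "continuous_on (\<Omega> \<times> \<Omega>) g"
  shows "continuous_on \<Omega> D"
  unfolding continuous_on_def
proof
  fix x assume x: "x \<in> \<Omega>"
  have "continuous_on \<Omega> (\<lambda>y. g (y, y))" "continuous_on \<Omega> (\<lambda>y. g (y, x))"
    by (rule continuous_on_compose2[OF g]; use x in \<open>auto intro!: continuous_intros\<close>)+
  then have lims: "((\<lambda>y. g (y, y)) \<longlongrightarrow> g (x, x)) (at x within \<Omega>)" "((\<lambda>y. g (y, x)) \<longlongrightarrow> g (x, x)) (at x within \<Omega>)"
    using x by (auto simp: continuous_on_def)
  have "((\<lambda>y. sqrt (g (y, y) - 2 * g (y, x) + g (x, x))) \<longlongrightarrow> sqrt (g (x, x) - 2 * g (x, x) + g (x, x)))
      (at x within \<Omega>)"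
    by (intro tendsto_intros lims)
  moreover have "\<forall>\<^sub>F y in at x within \<Omega>. sqrt (g (y, y) - 2 * g (y, x) + g (x, x)) = norm (D y - D x)"
  proof -
    have "\<forall>\<^sub>F y in at x within \<Omega>. y \<in> \<Omega>" by (simp add: eventually_at_filter)
    then show ?thesis
    proof eventually_elim
      case (elim y)
      then show ?case
        using x by (simp add: gram[symmetric] norm_eq_sqrt_inner inner_simps inner_commute)
    qed
  qed
  ultimately have "((\<lambda>y. norm (D y - D x)) \<longlongrightarrow> 0) (at x within \<Omega>)"
    using Lim_transform_eventually by fastforce
  then show "(D \<longlongrightarrow> D x) (at x within \<Omega>)"
    using Lim_null tendsto_norm_zero_iff by blast
qed

lemma continuous_small_box:
  fixes g :: "'v::real_normed_vector \<times> 'v \<Rightarrow> real"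
  assumes \<Omega>: "open \<Omega>" and g: "continuous_on (\<Omega> \<times> \<Omega>) g" and xy: "x \<in> \<Omega>" "y \<in> \<Omega>" and \<epsilon>: "0 < \<epsilon>"
  obtains \<delta> :: real where "0 < \<delta>"
    and "\<And>s t. \<bar>s\<bar> < \<delta> \<Longrightarrow> \<bar>t\<bar> < \<delta> \<Longrightarrow> x + s *\<^sub>R e \<in> \<Omega> \<and> y + t *\<^sub>R e \<in> \<Omega>
      \<and> \<bar>g (x + s *\<^sub>R e, y + t *\<^sub>R e) - g (x, y)\<bar> < \<epsilon>"
proof -
  have o: "open (\<Omega> \<times> \<Omega>)" using \<Omega> by (intro open_Times)
  have fs: "(fst \<longlongrightarrow> 0) (nhds (0::real) \<times>\<^sub>F nhds (0::real))" "(snd \<longlongrightarrow> 0) (nhds (0::real) \<times>\<^sub>F nhds (0::real))"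
    by (rule filterlim_fst filterlim_snd)+
  have m: "((\<lambda>p. (x + fst p *\<^sub>R e, y + snd p *\<^sub>R e)) \<longlongrightarrow> (x + 0 *\<^sub>R e, y + 0 *\<^sub>R e))
      (nhds (0::real) \<times>\<^sub>F nhds (0::real))"
    by (intro tendsto_intros fs)
  have inn: "\<forall>\<^sub>F p in nhds (0::real) \<times>\<^sub>F nhds (0::real). (x + fst p *\<^sub>R e, y + snd p *\<^sub>R e) \<in> \<Omega> \<times> \<Omega>"
    using topological_tendstoD[OF m o] xy by simp
  have "((\<lambda>p. g (x + fst p *\<^sub>R e, y + snd p *\<^sub>R e)) \<longlongrightarrow> g (x + 0 *\<^sub>R e, y + 0 *\<^sub>R e))
      (nhds (0::real) \<times>\<^sub>F nhds (0::real))"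
    by (rule continuous_on_tendsto_compose[OF g m _ inn]) (use xy in simp)
  from tendstoD[OF this \<epsilon>] inn
  have "\<forall>\<^sub>F p in nhds (0::real) \<times>\<^sub>F nhds (0::real). x + fst p *\<^sub>R e \<in> \<Omega> \<and> y + snd p *\<^sub>R e \<in> \<Omega>
      \<and> \<bar>g (x + fst p *\<^sub>R e, y + snd p *\<^sub>R e) - g (x, y)\<bar> < \<epsilon>"
    by eventually_elim (simp add: dist_real_def)
  then obtain P where P: "eventually P (nhds (0::real))"
      "\<And>s t. P s \<Longrightarrow> P t \<Longrightarrow> x + s *\<^sub>R e \<in> \<Omega> \<and> y + t *\<^sub>R e \<in> \<Omega>
      \<and> \<bar>g (x + s *\<^sub>R e, y + t *\<^sub>R e) - g (x, y)\<bar> < \<epsilon>"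
    unfolding eventually_prod_same by auto
  from P(1) obtain \<delta> where \<delta>: "0 < \<delta>" "\<And>s. dist s 0 < \<delta> \<Longrightarrow> P s"
    unfolding eventually_nhds_metric by blast
  show ?thesis
  proof (rule that[OF \<delta>(1)])
    fix s t :: real assume "\<bar>s\<bar> < \<delta>" "\<bar>t\<bar> < \<delta>"
    then show "x + s *\<^sub>R e \<in> \<Omega> \<and> y + t *\<^sub>R e \<in> \<Omega> \<and> \<bar>g (x + s *\<^sub>R e, y + t *\<^sub>R e) - g (x, y)\<bar> < \<epsilon>"
      by (intro P(2) \<delta>(2)) (simp_all add: dist_real_def)
  qed
qed

text \<open>\<open>K x\<close> is the feature \<open>k(x,\<cdot>)\<close> of the point \<open>x\<close>.\<close>

locale feature_map =
  fixes \<Omega> :: "'v::real_normed_vector set" and k :: "'v \<times> 'v \<Rightarrow> real"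
    and K :: "'v \<Rightarrow> 'h::{real_inner,banach}"
  assumes open_domain: "open \<Omega>"
    and gram: "\<And>x y. x \<in> \<Omega> \<Longrightarrow> y \<in> \<Omega> \<Longrightarrow> k (x, y) = K x \<bullet> K y"
begin

definition diff_quot :: "'v \<Rightarrow> 'v \<Rightarrow> real \<Rightarrow> 'h" where
  "diff_quot e x h = (K (x + h *\<^sub>R e) - K x) /\<^sub>R h"

definition diff_quot2 :: "'v \<Rightarrow> 'v \<Rightarrow> real \<times> real \<Rightarrow> 'h" where
  "diff_quot2 e x = (\<lambda>(h, l).
     (K (x + (h + l) *\<^sub>R e) - K (x + h *\<^sub>R e) - K (x + l *\<^sub>R e) + K x) /\<^sub>R (h * l))"

lemma eventually_small: "0 < \<delta> \<Longrightarrow> \<forall>\<^sub>F h in at (0::real). h \<noteq> 0 \<and> \<bar>h\<bar> < \<delta>"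
  unfolding eventually_at by (intro exI[of _ \<delta>]) (simp add: dist_real_def)

text \<open>The mean value theorem in the second and then in the first argument of \<open>k\<close> expresses the scalar
  product of two difference quotients as the mixed derivative at an intermediate point, which is
  where the order of differentiation matters.\<close>

lemma gram_diff_quot:
  assumes dd: "has_dir_derivs_on (\<Omega> \<times> \<Omega>) [(e, 0), (0, e)] k"
    and cont: "continuous_on (\<Omega> \<times> \<Omega>) (dir_derivs [(e, 0), (0, e)] k)"
    and xy: "x \<in> \<Omega>" "y \<in> \<Omega>"
  shows "((\<lambda>(a, b). diff_quot e x a \<bullet> diff_quot e y b) \<longlongrightarrow> dir_derivs [(e, 0), (0, e)] k (x, y))
    (at 0 \<times>\<^sub>F at 0)"
proof (rule tendstoI)
  fix \<epsilon> :: real assume "0 < \<epsilon>"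
  let ?kt = "dir_deriv (0, e) k" and ?kst = "dir_derivs [(e, 0), (0, e)] k"
  have d: "\<forall>z\<in>\<Omega> \<times> \<Omega>. (\<lambda>t. k (z + t *\<^sub>R (0, e))) differentiable (at 0)"
      "\<forall>z\<in>\<Omega> \<times> \<Omega>. (\<lambda>t. ?kt (z + t *\<^sub>R (e, 0))) differentiable (at 0)"
    using dd by (simp_all add: dir_derivs_def)
  obtain \<delta> where \<delta>: "0 < \<delta>"
    and box: "\<And>s t. \<bar>s\<bar> < \<delta> \<Longrightarrow> \<bar>t\<bar> < \<delta> \<Longrightarrow> x + s *\<^sub>R e \<in> \<Omega> \<and> y + t *\<^sub>R e \<in> \<Omega>
      \<and> \<bar>?kst (x + s *\<^sub>R e, y + t *\<^sub>R e) - ?kst (x, y)\<bar> < \<epsilon>"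
    using continuous_small_box[OF open_domain cont xy \<open>0 < \<epsilon>\<close>, of e] by blast
  have close: "dist (diff_quot e x a \<bullet> diff_quot e y b) (?kst (x, y)) < \<epsilon>"
    if a: "a \<noteq> 0 \<and> \<bar>a\<bar> < \<delta>" and b: "b \<noteq> 0 \<and> \<bar>b\<bar> < \<delta>" for a b
  proof -
    have in1: "x + s *\<^sub>R e \<in> \<Omega>" if "\<bar>s\<bar> \<le> \<bar>a\<bar>" for s using box[of s 0] that a \<delta> by simp
    have in2: "y + t *\<^sub>R e \<in> \<Omega>" if "\<bar>t\<bar> \<le> \<bar>b\<bar>" for t using box[of 0 t] that b \<delta> by simp
    obtain \<tau> where \<tau>: "\<bar>\<tau>\<bar> \<le> \<bar>b\<bar>"
      "(k (x + a *\<^sub>R e, y + b *\<^sub>R e) - k (x, y + b *\<^sub>R e)) - (k (x + a *\<^sub>R e, y + 0 *\<^sub>R e) - k (x, y + 0 *\<^sub>R e))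
       = b * (?kt (x + a *\<^sub>R e, y + \<tau> *\<^sub>R e) - ?kt (x, y + \<tau> *\<^sub>R e))"
      by (rule mean_value_signed[of b "\<lambda>t. k (x + a *\<^sub>R e, y + t *\<^sub>R e) - k (x, y + t *\<^sub>R e)"
          "\<lambda>t. ?kt (x + a *\<^sub>R e, y + t *\<^sub>R e) - ?kt (x, y + t *\<^sub>R e)"])
        (intro DERIV_diff has_real_derivative_snd_arg[OF d(1)] in1 in2 xy; simp)
    obtain \<sigma> where \<sigma>: "\<bar>\<sigma>\<bar> \<le> \<bar>a\<bar>"
      "?kt (x + a *\<^sub>R e, y + \<tau> *\<^sub>R e) - ?kt (x + 0 *\<^sub>R e, y + \<tau> *\<^sub>R e)
       = a * dir_deriv (e, 0) ?kt (x + \<sigma> *\<^sub>R e, y + \<tau> *\<^sub>R e)"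
      by (rule mean_value_signed[of a "\<lambda>s. ?kt (x + s *\<^sub>R e, y + \<tau> *\<^sub>R e)"
          "\<lambda>s. dir_deriv (e, 0) ?kt (x + s *\<^sub>R e, y + \<tau> *\<^sub>R e)"])
        (intro has_real_derivative_fst_arg[OF d(2)] in1 in2 \<tau>; simp)
    have "diff_quot e x a \<bullet> diff_quot e y b
        = ((k (x + a *\<^sub>R e, y + b *\<^sub>R e) - k (x, y + b *\<^sub>R e)) - (k (x + a *\<^sub>R e, y) - k (x, y))) / (a * b)"
      using in1[of a] in2[of b] xy a b
      by (simp add: gram diff_quot_def inner_simps field_simps)
    also have "\<dots> = ?kst (x + \<sigma> *\<^sub>R e, y + \<tau> *\<^sub>R e)"
      using \<tau>(2) \<sigma>(2) a b by (simp add: dir_derivs_def)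
    finally show ?thesis using box[of \<sigma> \<tau>] \<sigma>(1) \<tau>(1) a b by (simp add: dist_real_def)
  qed
  have "\<forall>\<^sub>F p in at 0 \<times>\<^sub>F at (0::real). (fst p \<noteq> 0 \<and> \<bar>fst p\<bar> < \<delta>) \<and> (snd p \<noteq> 0 \<and> \<bar>snd p\<bar> < \<delta>)"
    by (intro eventually_prodI eventually_small \<delta>)
  then show "\<forall>\<^sub>F p in at 0 \<times>\<^sub>F at 0.
      dist (case p of (a, b) \<Rightarrow> diff_quot e x a \<bullet> diff_quot e y b) (?kst (x, y)) < \<epsilon>"
    by eventually_elim (auto simp: case_prod_beta intro: close)
qed

text \<open>The same with second differences in each argument; halving \<open>\<delta>\<close> keeps the points at distance
  \<open>h + l\<close> inside the neighbourhood.\<close>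

lemma gram_diff_quot2:
  assumes dd: "has_dir_derivs_on (\<Omega> \<times> \<Omega>) [(e, 0), (e, 0), (0, e), (0, e)] k"
    and cont: "continuous_on (\<Omega> \<times> \<Omega>) (dir_derivs [(e, 0), (e, 0), (0, e), (0, e)] k)"
    and xy: "x \<in> \<Omega>" "y \<in> \<Omega>"
  shows "((\<lambda>(p, p'). diff_quot2 e x p \<bullet> diff_quot2 e y p')
      \<longlongrightarrow> dir_derivs [(e, 0), (e, 0), (0, e), (0, e)] k (x, y))
    ((at 0 \<times>\<^sub>F at 0) \<times>\<^sub>F (at 0 \<times>\<^sub>F at 0))"
proof (rule tendstoI)
  fix \<epsilon> :: real assume "0 < \<epsilon>"
  let ?kt = "dir_deriv (0, e) k" and ?ksstt = "dir_derivs [(e, 0), (e, 0), (0, e), (0, e)] k"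
  let ?ktt = "dir_deriv (0, e) ?kt"
  let ?kstt = "dir_deriv (e, 0) ?ktt"
  have d: "\<forall>z\<in>\<Omega> \<times> \<Omega>. (\<lambda>t. k (z + t *\<^sub>R (0, e))) differentiable (at 0)"
      "\<forall>z\<in>\<Omega> \<times> \<Omega>. (\<lambda>t. ?kt (z + t *\<^sub>R (0, e))) differentiable (at 0)"
      "\<forall>z\<in>\<Omega> \<times> \<Omega>. (\<lambda>t. ?ktt (z + t *\<^sub>R (e, 0))) differentiable (at 0)"
      "\<forall>z\<in>\<Omega> \<times> \<Omega>. (\<lambda>t. ?kstt (z + t *\<^sub>R (e, 0))) differentiable (at 0)"
    using dd by (simp_all add: dir_derivs_def)
  obtain \<delta> where \<delta>: "0 < \<delta>"
    and box: "\<And>s t. \<bar>s\<bar> < \<delta> \<Longrightarrow> \<bar>t\<bar> < \<delta> \<Longrightarrow> x + s *\<^sub>R e \<in> \<Omega> \<and> y + t *\<^sub>R e \<in> \<Omega>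
      \<and> \<bar>?ksstt (x + s *\<^sub>R e, y + t *\<^sub>R e) - ?ksstt (x, y)\<bar> < \<epsilon>"
    using continuous_small_box[OF open_domain cont xy \<open>0 < \<epsilon>\<close>, of e] by blast
  have close: "dist (diff_quot2 e x (a, b) \<bullet> diff_quot2 e y (a', b')) (?ksstt (x, y)) < \<epsilon>"
    if a: "a \<noteq> 0 \<and> \<bar>a\<bar> < \<delta> / 2" and b: "b \<noteq> 0 \<and> \<bar>b\<bar> < \<delta> / 2"
    and a': "a' \<noteq> 0 \<and> \<bar>a'\<bar> < \<delta> / 2" and b': "b' \<noteq> 0 \<and> \<bar>b'\<bar> < \<delta> / 2" for a b a' b'
  proof -
    have in1: "x + s *\<^sub>R e \<in> \<Omega>" if "\<bar>s\<bar> \<le> \<bar>a\<bar> + \<bar>b\<bar>" for s using box[of s 0] that a b \<delta> by simp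
    have in2: "y + t *\<^sub>R e \<in> \<Omega>" if "\<bar>t\<bar> \<le> \<bar>a'\<bar> + \<bar>b'\<bar>" for t using box[of 0 t] that a' b' \<delta> by simp
    define \<Delta> where "\<Delta> g t = g (x + (a + b) *\<^sub>R e, y + t *\<^sub>R e) - g (x + a *\<^sub>R e, y + t *\<^sub>R e)
        - g (x + b *\<^sub>R e, y + t *\<^sub>R e) + g (x, y + t *\<^sub>R e)" for g :: "'v \<times> 'v \<Rightarrow> real" and t
    have \<Delta>_der: "(\<Delta> g has_real_derivative \<Delta> (dir_deriv (0, e) g) t) (at t)"
      if "\<forall>z\<in>\<Omega> \<times> \<Omega>. (\<lambda>t. g (z + t *\<^sub>R (0, e))) differentiable (at 0)" "\<bar>t\<bar> \<le> \<bar>a'\<bar> + \<bar>b'\<bar>" for g t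
      unfolding \<Delta>_def
      by (intro DERIV_diff DERIV_add has_real_derivative_snd_arg[OF that(1)] in1 in2 xy that(2)) auto
    obtain \<tau> where \<tau>: "\<bar>\<tau>\<bar> \<le> \<bar>a'\<bar> + \<bar>b'\<bar>"
      "\<Delta> k (a' + b') - \<Delta> k a' - \<Delta> k b' + \<Delta> k 0 = a' * b' * \<Delta> ?ktt \<tau>"
      by (rule mean_value_second_difference[of a' b' "\<Delta> k" "\<Delta> ?kt" "\<Delta> ?ktt"])
        (intro \<Delta>_der d; simp)+
    have "((\<lambda>s. ?ktt (x + s *\<^sub>R e, y + \<tau> *\<^sub>R e)) has_real_derivative ?kstt (x + s *\<^sub>R e, y + \<tau> *\<^sub>R e)) (at s)"
      "((\<lambda>s. ?kstt (x + s *\<^sub>R e, y + \<tau> *\<^sub>R e)) has_real_derivative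
          dir_deriv (e, 0) ?kstt (x + s *\<^sub>R e, y + \<tau> *\<^sub>R e)) (at s)" if "\<bar>s\<bar> \<le> \<bar>a\<bar> + \<bar>b\<bar>" for s
      by (intro has_real_derivative_fst_arg[OF d(3)] has_real_derivative_fst_arg[OF d(4)] in1 in2 \<tau> that)+
    then obtain \<sigma> where \<sigma>: "\<bar>\<sigma>\<bar> \<le> \<bar>a\<bar> + \<bar>b\<bar>"
      "?ktt (x + (a + b) *\<^sub>R e, y + \<tau> *\<^sub>R e) - ?ktt (x + a *\<^sub>R e, y + \<tau> *\<^sub>R e)
        - ?ktt (x + b *\<^sub>R e, y + \<tau> *\<^sub>R e) + ?ktt (x + 0 *\<^sub>R e, y + \<tau> *\<^sub>R e)
       = a * b * dir_deriv (e, 0) ?kstt (x + \<sigma> *\<^sub>R e, y + \<tau> *\<^sub>R e)"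
      by (rule mean_value_second_difference)
    have k_inner: "k (x + s *\<^sub>R e, y + t *\<^sub>R e) = K (x + s *\<^sub>R e) \<bullet> K (y + t *\<^sub>R e)"
      if "\<bar>s\<bar> \<le> \<bar>a\<bar> + \<bar>b\<bar>" "\<bar>t\<bar> \<le> \<bar>a'\<bar> + \<bar>b'\<bar>" for s t
      using in1[OF that(1)] in2[OF that(2)] by (rule gram)
    define Z where "Z = K (x + (a + b) *\<^sub>R e) - K (x + a *\<^sub>R e) - K (x + b *\<^sub>R e) + K x"
    have \<Delta>k: "\<Delta> k t = Z \<bullet> K (y + t *\<^sub>R e)" if "\<bar>t\<bar> \<le> \<bar>a'\<bar> + \<bar>b'\<bar>" for t
      using k_inner[of "a + b" t] k_inner[of a t] k_inner[of b t] k_inner[of 0 t] that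
      by (simp add: \<Delta>_def Z_def inner_simps)
    have "diff_quot2 e x (a, b) \<bullet> diff_quot2 e y (a', b')
        = (Z \<bullet> (K (y + (a' + b') *\<^sub>R e) - K (y + a' *\<^sub>R e) - K (y + b' *\<^sub>R e) + K y)) / (a * b * (a' * b'))"
      by (simp add: diff_quot2_def Z_def divide_inverse)
    also have "\<dots> = (\<Delta> k (a' + b') - \<Delta> k a' - \<Delta> k b' + \<Delta> k 0) / (a * b * (a' * b'))"
      by (simp add: \<Delta>k inner_diff_right inner_add_right)
    also have "\<dots> = ?ksstt (x + \<sigma> *\<^sub>R e, y + \<tau> *\<^sub>R e)"
      unfolding \<tau>(2) using \<sigma>(2) a b a' b' by (simp add: \<Delta>_def dir_derivs_def)
    finally show ?thesis using box[of \<sigma> \<tau>] \<sigma>(1) \<tau>(1) a b a' b' by (simp add: dist_real_def)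
  qed
  have small2: "\<forall>\<^sub>F p in at 0 \<times>\<^sub>F at (0::real).
      (fst p \<noteq> 0 \<and> \<bar>fst p\<bar> < \<delta> / 2) \<and> (snd p \<noteq> 0 \<and> \<bar>snd p\<bar> < \<delta> / 2)"
    using \<delta> by (intro eventually_prodI eventually_small) auto
  from eventually_prodI[OF small2 small2]
  show "\<forall>\<^sub>F r in (at 0 \<times>\<^sub>F at 0) \<times>\<^sub>F (at 0 \<times>\<^sub>F at 0).
      dist (case r of (p, p') \<Rightarrow> diff_quot2 e x p \<bullet> diff_quot2 e y p') (?ksstt (x, y)) < \<epsilon>"
    by eventually_elim (auto intro: close)
qed

lemma feature_derivative:
  assumes dd: "has_dir_derivs_on (\<Omega> \<times> \<Omega>) [(e, 0), (0, e)] k"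
    and cont: "continuous_on (\<Omega> \<times> \<Omega>) (dir_derivs [(e, 0), (0, e)] k)"
  obtains D where "\<And>x. x \<in> \<Omega> \<Longrightarrow> (diff_quot e x \<longlongrightarrow> D x) (at 0)"
    and "\<And>x y. x \<in> \<Omega> \<Longrightarrow> y \<in> \<Omega> \<Longrightarrow> D x \<bullet> D y = dir_derivs [(e, 0), (0, e)] k (x, y)"
  by (rule gram_limits[where q = "diff_quot e" and F = "at 0" and S = \<Omega>, OF _ gram_diff_quot[OF dd cont]]) (auto intro: that)

text \<open>The double limit \<open>W x\<close> of the second difference quotients is the derivative of \<open>D\<close>, because the
  inner limit \<open>l \<rightarrow> 0\<close> of the quotient at \<open>(h, l)\<close> is the difference quotient of \<open>D\<close> at \<open>h\<close>. Second
  differences are used because the assumption on \<open>k\<close> takes both derivatives in the second argument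
  before those in the first one, an order in which the derivatives of \<open>D x \<bullet> D y\<close> do not appear.\<close>

lemma feature_second_derivative:
  assumes dd: "has_dir_derivs_on (\<Omega> \<times> \<Omega>) [(e, 0), (e, 0), (0, e), (0, e)] k"
    and cont: "continuous_on (\<Omega> \<times> \<Omega>) (dir_derivs [(e, 0), (e, 0), (0, e), (0, e)] k)"
    and D: "\<And>x. x \<in> \<Omega> \<Longrightarrow> (diff_quot e x \<longlongrightarrow> D x) (at 0)"
  obtains W where "\<And>x. x \<in> \<Omega> \<Longrightarrow> ((\<lambda>h. (D (x + h *\<^sub>R e) - D x) /\<^sub>R h) \<longlongrightarrow> W x) (at 0)"
    and "\<And>x y. x \<in> \<Omega> \<Longrightarrow> y \<in> \<Omega> \<Longrightarrow> W x \<bullet> W y = dir_derivs [(e, 0), (e, 0), (0, e), (0, e)] k (x, y)"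
proof -
  obtain W where W: "\<And>x. x \<in> \<Omega> \<Longrightarrow> (diff_quot2 e x \<longlongrightarrow> W x) (at 0 \<times>\<^sub>F at 0)"
    and WW: "\<And>x y. x \<in> \<Omega> \<Longrightarrow> y \<in> \<Omega> \<Longrightarrow> W x \<bullet> W y = dir_derivs [(e, 0), (e, 0), (0, e), (0, e)] k (x, y)"
    by (rule gram_limits[where q = "diff_quot2 e" and F = "at 0 \<times>\<^sub>F at 0" and S = \<Omega>,
          OF _ gram_diff_quot2[OF dd cont]]) (auto simp: prod_filter_eq_bot)
  have "((\<lambda>h. (D (x + h *\<^sub>R e) - D x) /\<^sub>R h) \<longlongrightarrow> W x) (at 0)" if x: "x \<in> \<Omega>" for x
  proof (rule tendstoI)
    fix \<epsilon> :: real assume \<epsilon>: "0 < \<epsilon>"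
    have "\<forall>\<^sub>F p in at 0 \<times>\<^sub>F at 0. dist (diff_quot2 e x p) (W x) < \<epsilon> / 2"
      using \<epsilon> by (intro tendstoD[OF W[OF x]]) simp
    then obtain P where P: "eventually P (at (0::real))"
        "\<And>h l. P h \<Longrightarrow> P l \<Longrightarrow> dist (diff_quot2 e x (h, l)) (W x) < \<epsilon> / 2"
      unfolding eventually_prod_same by auto
    have "((\<lambda>h. x + h *\<^sub>R e) \<longlongrightarrow> x + 0 *\<^sub>R e) (at 0)" by (intro tendsto_intros)
    then have "\<forall>\<^sub>F h in at 0. x + h *\<^sub>R e \<in> \<Omega>"
      using topological_tendstoD[OF _ open_domain] x by simp
    moreover have "\<forall>\<^sub>F h in at (0::real). h \<noteq> 0" by (simp add: eventually_at_filter)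
    ultimately show "\<forall>\<^sub>F h in at 0. dist ((D (x + h *\<^sub>R e) - D x) /\<^sub>R h) (W x) < \<epsilon>"
      using P(1)
    proof eventually_elim
      case (elim h)
      have "((\<lambda>l. (diff_quot e (x + h *\<^sub>R e) l - diff_quot e x l) /\<^sub>R h) \<longlongrightarrow> (D (x + h *\<^sub>R e) - D x) /\<^sub>R h) (at 0)"
        by (intro tendsto_intros D x elim)
      moreover have "(diff_quot e (x + h *\<^sub>R e) l - diff_quot e x l) /\<^sub>R h = diff_quot2 e x (h, l)" for l
        by (simp add: diff_quot_def diff_quot2_def algebra_simps)
      ultimately have "((\<lambda>l. diff_quot2 e x (h, l)) \<longlongrightarrow> (D (x + h *\<^sub>R e) - D x) /\<^sub>R h) (at 0)" by simp
      then have "((\<lambda>l. dist (diff_quot2 e x (h, l)) (W x)) \<longlongrightarrow> dist ((D (x + h *\<^sub>R e) - D x) /\<^sub>R h) (W x)) (at 0)"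
        by (intro tendsto_intros)
      moreover have "\<forall>\<^sub>F l in at 0. dist (diff_quot2 e x (h, l)) (W x) \<le> \<epsilon> / 2"
        using P(1) by eventually_elim (use P(2)[OF elim(3)] in \<open>auto intro: less_imp_le\<close>)
      ultimately have "dist ((D (x + h *\<^sub>R e) - D x) /\<^sub>R h) (W x) \<le> \<epsilon> / 2"
        by (rule tendsto_upperbound) simp
      then show ?case using \<epsilon> by simp
    qed
  qed
  with WW that show ?thesis by blast
qed

end

section \<open>Integrating a derivative that vanishes off an open set\<close>

lemma countable_if_all_isolated:
  fixes N :: "'a::second_countable_topology set"
  assumes "\<And>x. x \<in> N \<Longrightarrow> \<not> x islimpt N"
  shows "countable N"
proof -
  obtain B :: "'a set set" where B: "countable B" "topological_basis B"
    using ex_countable_basis by blast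
  have "\<exists>b\<in>B. b \<inter> N = {x}" if "x \<in> N" for x
  proof -
    have "\<exists>U. open U \<and> x \<in> U \<and> (\<forall>y\<in>N. y \<in> U \<longrightarrow> y = x)"
      using assms[OF that] unfolding islimpt_def by blast
    then obtain U where U: "open U" "x \<in> U" "\<And>y. y \<in> N \<Longrightarrow> y \<in> U \<Longrightarrow> y = x"
      by blast
    obtain b where "b \<in> B" "x \<in> b" "b \<subseteq> U" using topological_basisE[OF B(2) U(1,2)] by blast
    moreover have "b \<inter> N = {x}" using calculation U(3) that by auto
    ultimately show ?thesis by blast
  qed
  then obtain b where b: "\<And>x. x \<in> N \<Longrightarrow> b x \<in> B \<and> b x \<inter> N = {x}" by metis
  have "inj_on b N" using b by (metis inj_onI singleton_inject)
  moreover have "countable (b ` N)"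
  proof (rule countable_subset[OF _ B(1)])
    show "b ` N \<subseteq> B" using b by auto
  qed
  ultimately show ?thesis by (metis countable_image_inj_on)
qed

lemma zeros_with_nonzero_derivative_isolated:
  fixes v :: "real \<Rightarrow> real"
  assumes d: "(v has_real_derivative d) (at t)" "d \<noteq> 0" and z: "v t = 0"
  shows "\<forall>\<^sub>F s in at t. v s \<noteq> 0"
proof -
  have "((\<lambda>s. (v s - v t) / (s - t)) \<longlongrightarrow> d) (at t)"
    using d(1) by (simp add: has_field_derivative_iff)
  from tendsto_imp_eventually_ne[OF this d(2)] show ?thesis
    by eventually_elim (auto simp: z)
qed

text \<open>A family of continuously differentiable functions that vanish near \<open>0\<close>, converge to the
  identity as \<open>e\<close> tends to \<open>0\<close>, and have uniformly bounded derivatives.\<close>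

definition cutoff :: "real \<Rightarrow> real \<Rightarrow> real" where
  "cutoff e y = y * (max 0 (1 - e / y\<^sup>2))\<^sup>2"

text \<open>The case \<open>y = 0\<close> is separate because \<open>e / 0 = 0\<close> would turn the formula into \<open>1\<close>.\<close>

definition cutoff_deriv :: "real \<Rightarrow> real \<Rightarrow> real" where
  "cutoff_deriv e y = (if y = 0 then 0
     else (max 0 (1 - e / y\<^sup>2))\<^sup>2 + 4 * (max 0 (1 - e / y\<^sup>2)) * (e / y\<^sup>2))"

lemma has_real_derivative_max_sq:
  "((\<lambda>z::real. (max 0 z)\<^sup>2) has_real_derivative 2 * max 0 z) (at z)"
proof -
  consider "z > 0" | "z < 0" | "z = 0" by linarith
  then show ?thesis
  proof cases
    case 1
    have "((\<lambda>z::real. z\<^sup>2) has_real_derivative 2 * max 0 z) (at z)"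
      using 1 by (auto intro!: derivative_eq_intros)
    then show ?thesis
      by (rule has_field_derivative_transform_within_open[where S = "{0<..}"]) (use 1 in auto)
  next
    case 2
    have "((\<lambda>z::real. 0) has_real_derivative 2 * max 0 z) (at z)"
      using 2 by simp
    then show ?thesis
      by (rule has_field_derivative_transform_within_open[where S = "{..<0}"]) (use 2 in auto)
  next
    case 3
    have "((\<lambda>s::real. (max 0 s)\<^sup>2 / s) \<longlongrightarrow> 0) (at 0)"
    proof (rule Lim_null_comparison)
      show "\<forall>\<^sub>F s in at 0. norm ((max 0 s)\<^sup>2 / s) \<le> \<bar>s::real\<bar>"
        by (rule always_eventually) (auto simp: max_def power2_eq_square)
      show "((\<lambda>s::real. \<bar>s\<bar>) \<longlongrightarrow> 0) (at 0)" using tendsto_rabs[OF tendsto_ident_at[of 0 UNIV]] by simp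
    qed
    then show ?thesis using 3 by (simp add: has_field_derivative_iff)
  qed
qed

lemma cutoff_eq_0: "y\<^sup>2 < e \<Longrightarrow> cutoff e y = 0"
  by (cases "y = 0") (simp_all add: cutoff_def max_def field_simps)

lemma has_real_derivative_cutoff:
  assumes e: "0 < e"
  shows "(cutoff e has_real_derivative cutoff_deriv e y) (at y)"
proof (cases "y = 0")
  case True
  have "open {y::real. y\<^sup>2 < e}" by (intro open_Collect_less continuous_intros)
  moreover have "((\<lambda>_. 0) has_real_derivative 0) (at (0::real))" by simp
  ultimately have "(cutoff e has_real_derivative 0) (at 0)"
    using e has_field_derivative_transform_within_open[where S = "{y::real. y\<^sup>2 < e}" and f = "\<lambda>_. 0"]
    by (simp add: cutoff_eq_0)
  then show ?thesis using True by (simp add: cutoff_deriv_def)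
next
  case False
  have inner: "((\<lambda>y. 1 - e / y\<^sup>2) has_real_derivative 2 * e / y ^ 3) (at y)"
    using False by (auto intro!: derivative_eq_intros simp: field_simps power2_eq_square power3_eq_cube)
  have "((\<lambda>y. (max 0 (1 - e / y\<^sup>2))\<^sup>2) has_real_derivative
      2 * max 0 (1 - e / y\<^sup>2) * (2 * e / y ^ 3)) (at y)"
    using DERIV_chain2[OF has_real_derivative_max_sq inner] .
  from DERIV_mult[OF DERIV_ident this] show ?thesis
    unfolding cutoff_def[abs_def] using False
    by (simp add: cutoff_deriv_def algebra_simps power2_eq_square power3_eq_cube)
qed

lemma cutoff_deriv_bound:
  assumes e: "0 < e"
  shows "\<bar>cutoff_deriv e y\<bar> \<le> 5"
proof (cases "y = 0")
  case False
  define m where "m = max 0 (1 - e / y\<^sup>2)"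
  have m: "0 \<le> m" "m \<le> 1" using e by (auto simp: m_def)
  have "m * (e / y\<^sup>2) \<le> 1"
  proof (cases "e / y\<^sup>2 \<le> 1")
    case True
    then show ?thesis using mult_mono[OF m(2) True] e by simp
  next
    case False
    then show ?thesis by (simp add: m_def)
  qed
  moreover have "0 \<le> m * (e / y\<^sup>2)" using m e by simp
  moreover have "m\<^sup>2 \<le> 1" using m by (simp add: power_le_one)
  ultimately have "\<bar>m\<^sup>2 + 4 * (m * (e / y\<^sup>2))\<bar> \<le> 5" using zero_le_power2[of m] by linarith
  then show ?thesis using False by (simp add: cutoff_deriv_def m_def mult.assoc)
qed (simp add: cutoff_deriv_def)

lemma tendsto_cutoff_factor:
  fixes y :: real
  assumes "y \<noteq> 0" and "e \<longlonglongrightarrow> 0"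
  shows "(\<lambda>n. max 0 (1 - e n / y\<^sup>2)) \<longlonglongrightarrow> 1"
proof -
  have "(\<lambda>n. max 0 (1 - e n / y\<^sup>2)) \<longlonglongrightarrow> max 0 (1 - 0 / y\<^sup>2)"
    using assms by (intro tendsto_intros) auto
  then show ?thesis by simp
qed

lemma tendsto_cutoff:
  assumes "e \<longlonglongrightarrow> 0"
  shows "(\<lambda>n. cutoff (e n) y) \<longlonglongrightarrow> y"
proof (cases "y = 0")
  case False
  have "(\<lambda>n. y * (max 0 (1 - e n / y\<^sup>2))\<^sup>2) \<longlonglongrightarrow> y * 1\<^sup>2"
    by (intro tendsto_intros tendsto_cutoff_factor False assms)
  then show ?thesis by (simp add: cutoff_def)
qed (simp add: cutoff_def)

lemma tendsto_cutoff_deriv: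
  assumes "e \<longlonglongrightarrow> 0"
  shows "(\<lambda>n. cutoff_deriv (e n) y) \<longlonglongrightarrow> (if y = 0 then 0 else 1)"
proof (cases "y = 0")
  case False
  have "(\<lambda>n. (max 0 (1 - e n / y\<^sup>2))\<^sup>2 + 4 * (max 0 (1 - e n / y\<^sup>2)) * (e n / y\<^sup>2))
      \<longlonglongrightarrow> 1\<^sup>2 + 4 * 1 * (0 / y\<^sup>2)"
    using False by (intro tendsto_intros tendsto_cutoff_factor assms) auto
  then show ?thesis using False by (simp add: cutoff_deriv_def)
qed (simp add: cutoff_deriv_def)

text \<open>At the boundary of \<open>U\<close> the function \<open>v\<close> need not be differentiable, and the boundary may be
  uncountable. The composition \<open>cutoff e \<circ> v\<close> vanishes near the complement of \<open>U\<close>, hence is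
  differentiable everywhere; in the limit \<open>e \<rightarrow> 0\<close> its derivative only misses \<open>w\<close> on the zeros of \<open>v\<close>
  in \<open>U\<close>, where \<open>w\<close> vanishes up to countably many points.\<close>

lemma integral_derivative_of_zero_extension:
  fixes v w :: "real \<Rightarrow> real"
  assumes ab: "a \<le> b" and v: "continuous_on UNIV v"
    and der: "\<And>t. t \<in> U \<Longrightarrow> (v has_real_derivative w t) (at t)"
    and v0: "\<And>t. t \<notin> U \<Longrightarrow> v t = 0" and w0: "\<And>t. t \<notin> U \<Longrightarrow> w t = 0"
    and int: "set_integrable lborel {a..b} w"
  shows "(LBINT t:{a..b}. w t) = v b - v a"
proof -
  define e where "e n = 1 / real (Suc n)" for n
  have e: "0 < e n" "e \<longlonglongrightarrow> 0" for n
    unfolding e_def using LIMSEQ_Suc[OF lim_1_over_n] by auto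
  have vm[measurable]: "v \<in> borel_measurable borel" using v by (rule borel_measurable_continuous_onI)
  have cm[measurable]: "cutoff_deriv c \<in> borel_measurable borel" for c
    unfolding cutoff_deriv_def[abs_def] by measurable
  have wm: "(\<lambda>t. indicator {a..b} t *\<^sub>R w t) \<in> borel_measurable lborel"
    using int unfolding set_integrable_def by (rule borel_measurable_integrable)
  have comp: "((\<lambda>t. cutoff (e n) (v t)) has_real_derivative cutoff_deriv (e n) (v t) * w t) (at t)"
    for n t
  proof (cases "t \<in> U")
    case True
    show ?thesis using DERIV_chain2[OF has_real_derivative_cutoff[OF e(1)] der[OF True]] .
  next
    case False
    have "open {t. (v t)\<^sup>2 < e n}" by (intro open_Collect_less continuous_intros v)
    moreover have "t \<in> {t. (v t)\<^sup>2 < e n}" using v0[OF False] e(1) by simp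
    moreover have "((\<lambda>_. 0) has_real_derivative 0) (at t)" by simp
    ultimately have "((\<lambda>t. cutoff (e n) (v t)) has_real_derivative 0) (at t)"
      using has_field_derivative_transform_within_open[where S = "{t. (v t)\<^sup>2 < e n}" and f = "\<lambda>_. 0"]
      by (simp add: cutoff_eq_0)
    then show ?thesis using w0[OF False] by simp
  qed
  have bound: "\<bar>cutoff_deriv (e n) (v t) * (indicator {a..b} t *\<^sub>R w t)\<bar>
      \<le> 5 * \<bar>indicator {a..b} t *\<^sub>R w t\<bar>" for n t
    unfolding abs_mult by (intro mult_right_mono cutoff_deriv_bound e) simp
  have int_n: "set_integrable lborel {a..b} (\<lambda>t. cutoff_deriv (e n) (v t) * w t)" for n
  proof -
    have "integrable lborel (\<lambda>t. cutoff_deriv (e n) (v t) * (indicator {a..b} t *\<^sub>R w t))"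
    proof (rule Bochner_Integration.integrable_bound)
      show "integrable lborel (\<lambda>t. 5 * \<bar>indicator {a..b} t *\<^sub>R w t\<bar>)"
        using int unfolding set_integrable_def by (intro integrable_mult_right integrable_abs)
      show "(\<lambda>t. cutoff_deriv (e n) (v t) * (indicator {a..b} t *\<^sub>R w t)) \<in> borel_measurable lborel"
        using wm by measurable
    qed (use bound in auto)
    then show ?thesis unfolding set_integrable_def by (simp add: mult.left_commute)
  qed
  have ftc: "(LBINT t:{a..b}. cutoff_deriv (e n) (v t) * w t) = cutoff (e n) (v b) - cutoff (e n) (v a)"
    for n
  proof -
    have "((\<lambda>t. cutoff_deriv (e n) (v t) * w t) has_integral
        cutoff (e n) (v b) - cutoff (e n) (v a)) {a..b}"
    proof (rule fundamental_theorem_of_calculus[OF ab])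
      show "((\<lambda>t. cutoff (e n) (v t)) has_vector_derivative cutoff_deriv (e n) (v t) * w t)
          (at t within {a..b})" for t
        using comp[of n t] by (auto simp: has_real_derivative_iff_has_vector_derivative
          intro: has_vector_derivative_at_within)
    qed
    then show ?thesis using set_borel_integral_eq_integral(2)[OF int_n] by (simp add: integral_unique)
  qed
  have "(\<lambda>n. LBINT t:{a..b}. cutoff_deriv (e n) (v t) * w t)
      \<longlonglongrightarrow> (LBINT t:{a..b}. (if v t = 0 then 0 else 1) * w t)"
    unfolding set_lebesgue_integral_def
  proof (rule integral_dominated_convergence[where w = "\<lambda>t. 5 * \<bar>indicator {a..b} t *\<^sub>R w t\<bar>"])
    have "(\<lambda>t. (if v t = 0 then 0 else 1) * (indicator {a..b} t *\<^sub>R w t)) \<in> borel_measurable lborel"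
      using wm by measurable
    then show "(\<lambda>t. indicator {a..b} t *\<^sub>R ((if v t = 0 then 0 else 1) * w t)) \<in> borel_measurable lborel"
      by (simp add: mult.left_commute)
    show "(\<lambda>t. indicator {a..b} t *\<^sub>R (cutoff_deriv (e n) (v t) * w t)) \<in> borel_measurable lborel" for n
      using int_n unfolding set_integrable_def by (rule borel_measurable_integrable)
    show "integrable lborel (\<lambda>t. 5 * \<bar>indicator {a..b} t *\<^sub>R w t\<bar>)"
      using int unfolding set_integrable_def by (intro integrable_mult_right integrable_abs)
    show "AE t in lborel. norm (indicator {a..b} t *\<^sub>R (cutoff_deriv (e n) (v t) * w t))
        \<le> 5 * \<bar>indicator {a..b} t *\<^sub>R w t\<bar>" for n
      using bound[of n] by (intro AE_I2) (simp add: mult.left_commute)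
    show "AE t in lborel. (\<lambda>n. indicator {a..b} t *\<^sub>R (cutoff_deriv (e n) (v t) * w t))
        \<longlonglongrightarrow> indicator {a..b} t *\<^sub>R ((if v t = 0 then 0 else 1) * w t)"
      by (intro AE_I2 tendsto_intros tendsto_cutoff_deriv e)
  qed
  moreover have "(\<lambda>n. LBINT t:{a..b}. cutoff_deriv (e n) (v t) * w t) \<longlonglongrightarrow> v b - v a"
    unfolding ftc by (intro tendsto_intros tendsto_cutoff e)
  ultimately have "(LBINT t:{a..b}. (if v t = 0 then 0 else 1) * w t) = v b - v a"
    using LIMSEQ_unique by blast
  moreover have "(LBINT t:{a..b}. (if v t = 0 then 0 else 1) * w t) = (LBINT t:{a..b}. w t)"
    unfolding set_lebesgue_integral_def
  proof (rule integral_cong_AE)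
    define N where "N = {t\<in>U. v t = 0 \<and> w t \<noteq> 0}"
    have "\<not> t islimpt N" if "t \<in> N" for t
    proof -
      have "\<forall>\<^sub>F s in at t. v s \<noteq> 0"
        using that der by (intro zeros_with_nonzero_derivative_isolated) (auto simp: N_def)
      then have "\<forall>\<^sub>F s in at t. s \<notin> N" by eventually_elim (simp add: N_def)
      then show ?thesis by (simp add: islimpt_iff_eventually)
    qed
    then have "countable N" by (rule countable_if_all_isolated)
    then have "AE t in lborel. t \<notin> N" by (intro AE_not_in countable_imp_null_set_lborel)
    then show "AE t in lborel. indicator {a..b} t *\<^sub>R ((if v t = 0 then 0 else 1) * w t)
        = indicator {a..b} t *\<^sub>R w t"
    proof eventually_elim
      case (elim t)
      then show ?case using w0[of t] by (auto simp: N_def)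
    qed
    have "(\<lambda>t. (if v t = 0 then 0 else 1) * (indicator {a..b} t *\<^sub>R w t)) \<in> borel_measurable lborel"
      using wm by measurable
    then show "(\<lambda>t. indicator {a..b} t *\<^sub>R ((if v t = 0 then 0 else 1) * w t)) \<in> borel_measurable lborel"
      by (simp add: mult.left_commute)
  qed (rule wm)
  ultimately show ?thesis by simp
qed

lemma
  fixes f :: "'a::euclidean_space \<Rightarrow> real"
  assumes "integrable lborel f"
  shows integrable_lborel_translate: "integrable lborel (\<lambda>x. f (x + c))"
    and integral_lborel_translate: "(\<integral>x. f (x + c) \<partial>lborel) = integral\<^sup>L lborel f"
proof -
  have f: "integrable (distr lborel borel ((+) c)) f"
    using assms by (simp add: lborel_distr_plus)
  have m: "(+) c \<in> measurable lborel borel" by simp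
  have fm: "f \<in> borel_measurable borel" using borel_measurable_integrable[OF assms] by simp
  show "integrable lborel (\<lambda>x. f (x + c))"
    using integrable_distr[OF m f] by (simp add: add.commute)
  show "(\<integral>x. f (x + c) \<partial>lborel) = integral\<^sup>L lborel f"
    using integral_distr[OF m fm] by (simp add: lborel_distr_plus add.commute)
qed

text \<open>Averaging over the translates of \<open>w\<close> by \<open>t e\<close>, \<open>0 \<le> t \<le> 1\<close>, does not change its integral, and by
  Fubini the average is the integral of \<open>v (x + e) - v x\<close>, which is zero because \<open>v\<close> is integrable.\<close>

lemma integral_dir_deriv_of_zero_extension:
  fixes v w :: "'a::euclidean_space \<Rightarrow> real"
  assumes v: "continuous_on UNIV v" "integrable lborel v" and w: "integrable lborel w"
    and der: "\<And>x. x \<in> \<Omega> \<Longrightarrow> ((\<lambda>t. v (x + t *\<^sub>R e)) has_real_derivative w x) (at 0)"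
    and v0: "\<And>x. x \<notin> \<Omega> \<Longrightarrow> v x = 0" and w0: "\<And>x. x \<notin> \<Omega> \<Longrightarrow> w x = 0"
  shows "integral\<^sup>L lborel w = 0"
proof -
  define g where "g x t = indicator {0..1} t *\<^sub>R w (x + t *\<^sub>R e)" for x and t :: real
  have wm[measurable]: "w \<in> borel_measurable borel" using borel_measurable_integrable[OF w] by simp
  have "integrable (lborel \<Otimes>\<^sub>M lborel) (\<lambda>(t, x). g x t)"
  proof (rule lborel_pair.Fubini_integrable)
    show "(\<lambda>(t, x). g x t) \<in> borel_measurable (lborel \<Otimes>\<^sub>M lborel)"
      unfolding g_def by measurable
    have "(\<integral>x. norm (g x t) \<partial>lborel) = indicator {0..1} t *\<^sub>R (\<integral>x. \<bar>w x\<bar> \<partial>lborel)" for t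
      using integral_lborel_translate[OF integrable_abs[OF w], of "t *\<^sub>R e"] by (simp add: g_def abs_mult)
    then show "integrable lborel (\<lambda>t. \<integral>x. norm (case (t, x) of (t, x) \<Rightarrow> g x t) \<partial>lborel)"
      by (simp)
    show "AE t in lborel. integrable lborel (\<lambda>x. case (t, x) of (t, x) \<Rightarrow> g x t)"
      using integrable_lborel_translate[OF w] by (simp add: g_def)
  qed
  from lborel_pair.integrable_product_swap[OF this]
  have g: "integrable (lborel \<Otimes>\<^sub>M lborel) (\<lambda>(x, t). g x t)" by simp
  have line: "(\<integral>t. g x t \<partial>lborel) = v (x + e) - v x" if "integrable lborel (g x)" for x
  proof -
    have "(LBINT t:{0..1}. w (x + t *\<^sub>R e)) = v (x + 1 *\<^sub>R e) - v (x + 0 *\<^sub>R e)"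
    proof (rule integral_derivative_of_zero_extension[where U = "{t. x + t *\<^sub>R e \<in> \<Omega>}"])
      show "continuous_on UNIV (\<lambda>t. v (x + t *\<^sub>R e))"
        by (rule continuous_on_compose2[OF v(1)]) (auto intro!: continuous_intros)
      show "((\<lambda>t. v (x + t *\<^sub>R e)) has_real_derivative w (x + t *\<^sub>R e)) (at t)"
        if "t \<in> {t. x + t *\<^sub>R e \<in> \<Omega>}" for t
      proof -
        have "((\<lambda>s. v (x + t *\<^sub>R e + s *\<^sub>R e)) has_real_derivative w (x + t *\<^sub>R e)) (at 0)"
          using der[of "x + t *\<^sub>R e"] that by simp
        then have "((\<lambda>s. v (x + (s + t) *\<^sub>R e)) has_real_derivative w (x + t *\<^sub>R e)) (at 0)"
          by (simp add: algebra_simps)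
        then show ?thesis using DERIV_shift[of "\<lambda>s. v (x + s *\<^sub>R e)" _ 0 t] by simp
      qed
      show "set_integrable lborel {0..1} (\<lambda>t. w (x + t *\<^sub>R e))"
        using that by (simp add: set_integrable_def g_def[abs_def])
    qed (auto simp: v0 w0)
    then show ?thesis by (simp add: set_lebesgue_integral_def g_def)
  qed
  have "integral\<^sup>L lborel w = (\<integral>t. (\<integral>x. g x t \<partial>lborel) \<partial>lborel)"
    using integral_lborel_translate[OF w] by (simp add: g_def)
  also have "\<dots> = (\<integral>x. (\<integral>t. g x t \<partial>lborel) \<partial>lborel)"
    using g by (rule lborel_pair.Fubini_integral)
  also have "\<dots> = (\<integral>x. v (x + e) - v x \<partial>lborel)"
  proof (rule integral_cong_AE)
    show "AE x in lborel. (\<integral>t. g x t \<partial>lborel) = v (x + e) - v x"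
      using lborel_pair.AE_integrable_fst'[OF g] by eventually_elim (simp add: line)
    show "(\<lambda>x. \<integral>t. g x t \<partial>lborel) \<in> borel_measurable lborel"
      using lborel_pair.integrable_fst'[OF g] by (auto dest: borel_measurable_integrable)
    show "(\<lambda>x. v (x + e) - v x) \<in> borel_measurable lborel"
      using integrable_lborel_translate[OF v(2)] v(2) by (auto dest: borel_measurable_integrable)
  qed
  also have "\<dots> = 0"
    using integrable_lborel_translate[OF v(2)] v(2) by (simp add: integral_lborel_translate)
  finally show ?thesis .
qed

section \<open>Kernel regularity, weighted integrability and continuous extension\<close>

lemma coords_of_single: "coords_of (\<lambda>j. if j = i then m else 0) = replicate m i"
proof -
  have "concat (map (\<lambda>j. replicate (if j = i then m else 0) j) xs)
      = (if i \<in> set xs then replicate m i else [])" if "distinct xs" for xs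
    using that by (induction xs) auto
  then show ?thesis unfolding coords_of_def by simp
qed

lemma regularity_assm_single:
  fixes i :: "'n::{finite,linorder}"
  assumes "regularity_assm \<Omega> k p0" and "m \<le> 2"
  defines "dirs \<equiv> replicate m (fst_dir i) @ replicate m (snd_dir i)"
  shows "has_dir_derivs_on (\<Omega> \<times> \<Omega>) dirs k" "continuous_on (\<Omega> \<times> \<Omega>) (dir_derivs dirs k)"
    "cont_extendible (\<Omega> \<times> \<Omega>) (dir_derivs dirs k)"
proof -
  let ?\<alpha> = "\<lambda>j. if j = i then m else 0"
  have "(\<Sum>j\<in>UNIV. ?\<alpha> j) \<le> 2" using assms(2) by simp
  moreover have "kernel_dirs ?\<alpha> = dirs"
    by (simp add: kernel_dirs_def coords_of_single dirs_def)
  ultimately show "has_dir_derivs_on (\<Omega> \<times> \<Omega>) dirs k" "continuous_on (\<Omega> \<times> \<Omega>) (dir_derivs dirs k)"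
    "cont_extendible (\<Omega> \<times> \<Omega>) (dir_derivs dirs k)"
    using assms(1) unfolding regularity_assm_def kernel_twice_cont_diff_def by metis+
qed

lemma
  assumes "regularity_assm \<Omega> k p0"
  shows regularity_assm_1:
      "has_dir_derivs_on (\<Omega> \<times> \<Omega>) [fst_dir i, snd_dir i] k"
      "continuous_on (\<Omega> \<times> \<Omega>) (dir_derivs [fst_dir i, snd_dir i] k)"
      "cont_extendible (\<Omega> \<times> \<Omega>) (dir_derivs [fst_dir i, snd_dir i] k)"
    and regularity_assm_2:
      "has_dir_derivs_on (\<Omega> \<times> \<Omega>) [fst_dir i, fst_dir i, snd_dir i, snd_dir i] k"
      "continuous_on (\<Omega> \<times> \<Omega>) (dir_derivs [fst_dir i, fst_dir i, snd_dir i, snd_dir i] k)"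
    and regularity_assm_0: "continuous_on (\<Omega> \<times> \<Omega>) k"
proof -
  have dirs1: "replicate 1 (fst_dir i) @ replicate 1 (snd_dir i) = [fst_dir i, snd_dir i]"
    and dirs2: "replicate 2 (fst_dir i) @ replicate 2 (snd_dir i) = [fst_dir i, fst_dir i, snd_dir i, snd_dir i]"
    by (simp_all add: numeral_2_eq_2)
  show "has_dir_derivs_on (\<Omega> \<times> \<Omega>) [fst_dir i, snd_dir i] k"
      "continuous_on (\<Omega> \<times> \<Omega>) (dir_derivs [fst_dir i, snd_dir i] k)"
      "cont_extendible (\<Omega> \<times> \<Omega>) (dir_derivs [fst_dir i, snd_dir i] k)"
    using regularity_assm_single[OF assms, of 1 i] unfolding dirs1 by simp_all
  show "has_dir_derivs_on (\<Omega> \<times> \<Omega>) [fst_dir i, fst_dir i, snd_dir i, snd_dir i] k"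
      "continuous_on (\<Omega> \<times> \<Omega>) (dir_derivs [fst_dir i, fst_dir i, snd_dir i, snd_dir i] k)"
    using regularity_assm_single(1,2)[OF assms, of 2 i] unfolding dirs2 by (simp_all only: order_refl)
  have "dir_derivs (replicate 0 (fst_dir i) @ replicate 0 (snd_dir i)) k = k" by (simp add: dir_derivs_def)
  then show "continuous_on (\<Omega> \<times> \<Omega>) k"
    using regularity_assm_single(2)[OF assms, of 0 i] by simp
qed

lemma cont_extension:
  assumes "cont_extendible S f"
  shows "continuous_on (closure S) (cont_extension S f)" "\<And>x. x \<in> S \<Longrightarrow> cont_extension S f x = f x"
proof -
  have "continuous_on (closure S) (cont_extension S f) \<and> (\<forall>x\<in>S. cont_extension S f x = f x)"
    using assms unfolding cont_extendible_def cont_extension_def by (rule someI_ex)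
  then show "continuous_on (closure S) (cont_extension S f)" "\<And>x. x \<in> S \<Longrightarrow> cont_extension S f x = f x"
    by auto
qed

lemma bounded_bilinear_tensor_op: "bounded_bilinear tensor_op"
proof
  show "\<exists>K. \<forall>a b. norm (tensor_op a b :: 'a \<Rightarrow>\<^sub>L 'a) \<le> norm a * norm b * K"
  proof (intro exI allI)
    fix a b :: 'a
    have "norm (tensor_op a b) \<le> norm a * norm b"
    proof (rule norm_blinfun_bound)
      show "norm (blinfun_apply (tensor_op a b) x) \<le> norm a * norm b * norm x" for x
        using mult_left_mono[OF Cauchy_Schwarz_ineq2[of b x], of "norm a"]
        by (simp add: tensor_op.rep_eq mult_ac)
    qed simp
    then show "norm (tensor_op a b) \<le> norm a * norm b * 1" by simp
  qed
qed (auto intro!: blinfun_eqI simp: tensor_op.rep_eq blinfun.add_left blinfun.scaleR_left inner_simps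
    algebra_simps)

lemma norm_tensor_op_le: "norm (tensor_op u u) \<le> (norm u)\<^sup>2"
proof (rule norm_blinfun_bound)
  show "norm (blinfun_apply (tensor_op u u) x) \<le> (norm u)\<^sup>2 * norm x" for x
    using mult_left_mono[OF Cauchy_Schwarz_ineq2[of u x], of "norm u"]
    by (simp add: tensor_op.rep_eq power2_eq_square mult_ac)
qed simp

lemma integrable_continuous_bound:
  fixes f :: "'a::euclidean_space \<Rightarrow> real"
  assumes "continuous_on \<Omega> f" and "integrable (leb_on \<Omega>) B" and "\<And>x. x \<in> \<Omega> \<Longrightarrow> \<bar>f x\<bar> \<le> B x"
  shows "integrable (leb_on \<Omega>) f"
proof (rule Bochner_Integration.integrable_bound[OF assms(2)])
  show "f \<in> borel_measurable (leb_on \<Omega>)"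
    using borel_measurable_continuous_on_restrict[OF assms(1)]
    by (simp cong: measurable_cong_sets sets_restrict_space_cong)
  show "AE x in leb_on \<Omega>. norm (f x) \<le> norm (B x)"
    using assms(3) by (intro AE_I2) (force simp: space_restrict_space)
qed

lemma bochner_integrable_continuous_bound:
  fixes h :: "'a::euclidean_space \<Rightarrow> 'b::banach"
  assumes "open \<Omega>" and h: "continuous_on \<Omega> h"
    and B: "integrable (leb_on \<Omega>) B" "\<And>x. x \<in> \<Omega> \<Longrightarrow> norm (h x) \<le> B x"
  shows "bochner_integrable (leb_on \<Omega>) h"
proof (rule continuous_imp_bochner_integrable[OF assms(1) h])
  have "integrable (leb_on \<Omega>) (\<lambda>x. norm (h x))"
    by (rule integrable_continuous_bound[OF continuous_on_norm[OF h] B(1)]) (simp add: B(2))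
  then show "(\<integral>\<^sup>+x. ennreal (norm (h x)) \<partial>leb_on \<Omega>) < \<infinity>"
    by (simp add: integrable_iff_bounded)
qed

lemma integrable_if_in_L1_density:
  assumes g: "in_Lp_density \<Omega> p 1 g"
    and p: "p \<in> borel_measurable (leb_on \<Omega>)" "\<And>x. x \<in> \<Omega> \<Longrightarrow> 0 \<le> p x"
    and m: "(\<lambda>x. p x * g x) \<in> borel_measurable (leb_on \<Omega>)"
  shows "integrable (leb_on \<Omega>) (\<lambda>x. p x * g x)"
proof -
  obtain h where h: "h \<in> borel_measurable (leb_on \<Omega>)" "AE x in density_measure \<Omega> p. g x = h x"
    and int: "integrable (density_measure \<Omega> p) (\<lambda>x. \<bar>h x\<bar> powr 1)"
    using g by (auto simp: in_Lp_density_def density_measure_def)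
  have p0: "AE x in leb_on \<Omega>. 0 \<le> p x" using p(2) by (intro AE_I2) (simp add: space_restrict_space)
  have "integrable (density (leb_on \<Omega>) p) (\<lambda>x. \<bar>h x\<bar>)"
    using int by (simp add: density_measure_def)
  then have "integrable (leb_on \<Omega>) (\<lambda>x. p x *\<^sub>R \<bar>h x\<bar>)"
    using h(1) p(1) p0 by (subst (asm) integrable_density) auto
  then show ?thesis
  proof (rule Bochner_Integration.integrable_bound[OF _ m])
    have "AE x in leb_on \<Omega>. 0 < ennreal (p x) \<longrightarrow> g x = h x"
      using h(2) p(1) unfolding density_measure_def by (subst (asm) AE_density) auto
    then show "AE x in leb_on \<Omega>. norm (p x * g x) \<le> norm (p x *\<^sub>R \<bar>h x\<bar>)"
      using p0 by eventually_elim (auto simp: abs_mult)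
  qed
qed

text \<open>The majorant \<open>B\<close>, whose continuity up to the boundary is known, forces \<open>f\<close> to tend to zero
  there.\<close>

lemma continuous_on_zero_extension:
  fixes f :: "'a::metric_space \<Rightarrow> real"
  assumes \<Omega>: "open \<Omega>" and f: "continuous_on \<Omega> f"
    and B: "continuous_on (closure \<Omega>) B" "\<And>x. x \<in> \<Omega> \<Longrightarrow> \<bar>f x\<bar> \<le> B x"
    and B0: "\<And>x. x \<in> closure \<Omega> - \<Omega> \<Longrightarrow> B x = 0"
  shows "continuous_on UNIV (\<lambda>x. if x \<in> \<Omega> then f x else 0)"
  unfolding continuous_on_eq_continuous_at[OF open_UNIV]
proof
  fix z :: 'a
  show "isCont (\<lambda>x. if x \<in> \<Omega> then f x else 0) z"
  proof (cases "z \<in> \<Omega>")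
    case True
    then have "isCont f z" using f \<Omega> by (simp add: continuous_on_eq_continuous_at)
    moreover have "\<forall>\<^sub>F x in nhds z. f x = (if x \<in> \<Omega> then f x else 0)"
      using eventually_nhds_in_open[OF \<Omega> True] by eventually_elim simp
    ultimately show ?thesis using isCont_cong by fast
  next
    case False
    have "\<exists>d>0. \<forall>x. dist x z < d \<longrightarrow> dist (if x \<in> \<Omega> then f x else 0) 0 < e" if e: "0 < e" for e
    proof (cases "z \<in> closure \<Omega>")
      case True
      then have "B z = 0" using False B0 by simp
      then obtain d where d: "0 < d" "\<And>x. x \<in> closure \<Omega> \<Longrightarrow> dist x z < d \<Longrightarrow> dist (B x) 0 < e"
        using B(1) True e unfolding continuous_on_iff by metis
      have "dist (if x \<in> \<Omega> then f x else 0) 0 < e" if x: "dist x z < d" for x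
        using B(2)[of x] d(2)[OF _ x] closure_subset[of \<Omega>] e by (force simp: dist_real_def)
      then show ?thesis using d(1) by blast
    next
      case False
      then obtain d where "0 < d" "\<And>x. dist x z < d \<Longrightarrow> x \<notin> closure \<Omega>"
        using open_dist[of "- closure \<Omega>"] by (auto simp: open_Compl)
      then show ?thesis using closure_subset[of \<Omega>] e by (intro exI[of _ d]) auto
    qed
    then show ?thesis using False unfolding continuous_at_eps_delta by simp
  qed
qed

lemma rkhs_elem_eqI:
  assumes "rkhs_on \<Omega> k evf" and "\<And>y. y \<in> \<Omega> \<Longrightarrow> evf h y = g y"
  shows "rkhs_elem \<Omega> evf g = h"
  unfolding rkhs_elem_def
proof (rule the_equality)
  show "\<forall>y\<in>\<Omega>. evf h y = g y" using assms(2) by blast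
  fix h' assume "\<forall>y\<in>\<Omega>. evf h' y = g y"
  then have "\<forall>y\<in>\<Omega>. evf h' y = evf h y" using assms(2) by simp
  then show "h' = h" using assms(1) unfolding rkhs_on_def by blast
qed

lemma has_real_derivative_inner:
  fixes u :: "real \<Rightarrow> 'h::real_inner"
  assumes "((\<lambda>h. (u h - u 0) /\<^sub>R h) \<longlongrightarrow> d) (at 0)"
  shows "((\<lambda>t. f \<bullet> u t) has_real_derivative f \<bullet> d) (at 0)"
proof -
  have "((\<lambda>h. f \<bullet> ((u h - u 0) /\<^sub>R h)) \<longlongrightarrow> f \<bullet> d) (at 0)" by (intro tendsto_intros assms)
  then show ?thesis by (simp add: DERIV_def inner_simps divide_inverse mult.commute)
qed

section \<open>Derivatives of the features of the reproducing kernel\<close>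

locale score_matching =
  fixes \<Omega> :: "(real^'n::{finite,linorder}) set"
    and k :: "(real^'n::{finite,linorder}) \<times> (real^'n::{finite,linorder}) \<Rightarrow> real"
    and q0 p0 :: "real^'n::{finite,linorder} \<Rightarrow> real"
    and evf :: "'h::{real_inner,banach} \<Rightarrow> real^'n::{finite,linorder} \<Rightarrow> real"
    and f0 :: 'h
  assumes q0: "prob_density_on \<Omega> q0"
    and rkhs: "rkhs_on \<Omega> k evf"
    and f0: "f0 \<in> natural_params \<Omega> q0 evf"
    and p0_def: "p0 = exp_density \<Omega> q0 (evf f0)"
    and domain: "domain_assm \<Omega>"
    and regularity: "regularity_assm \<Omega> k p0"
    and boundary: "boundary_assm \<Omega> k p0"
    and integrability: "integrability_assm 1 \<Omega> k q0 p0"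
begin

text \<open>The representer of evaluation at \<open>x\<close>, which \<open>rkhs_on\<close> provides for points of \<open>\<Omega>\<close>.\<close>

definition K :: "real^'n::{finite,linorder} \<Rightarrow> 'h" where
  "K x = (SOME h. (\<forall>y\<in>\<Omega>. evf h y = k (x, y)) \<and> (\<forall>f. evf f x = f \<bullet> h))"

abbreviation D :: "'n::{finite,linorder} \<Rightarrow> real^'n::{finite,linorder} \<Rightarrow> 'h" where "D \<equiv> dk1 \<Omega> k evf"
abbreviation W :: "'n::{finite,linorder} \<Rightarrow> real^'n::{finite,linorder} \<Rightarrow> 'h" where "W \<equiv> dk2 \<Omega> k evf"

lemma open_\<Omega>: "open \<Omega>" using domain by (simp add: domain_assm_def)

lemma
  assumes "x \<in> \<Omega>"
  shows evf_K: "\<And>y. y \<in> \<Omega> \<Longrightarrow> evf (K x) y = k (x, y)"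
    and evf_eq_inner: "evf f x = f \<bullet> K x"
proof -
  have "\<exists>h. (\<forall>y\<in>\<Omega>. evf h y = k (x, y)) \<and> (\<forall>f. evf f x = f \<bullet> h)"
    using rkhs assms by (simp add: rkhs_on_def)
  then have "(\<forall>y\<in>\<Omega>. evf (K x) y = k (x, y)) \<and> (\<forall>f. evf f x = f \<bullet> K x)"
    unfolding K_def by (rule someI_ex)
  then show "\<And>y. y \<in> \<Omega> \<Longrightarrow> evf (K x) y = k (x, y)" "evf f x = f \<bullet> K x" by auto
qed

sublocale feature_map \<Omega> k K
proof
  show "open \<Omega>" by (rule open_\<Omega>)
  show "k (x, y) = K x \<bullet> K y" if "x \<in> \<Omega>" "y \<in> \<Omega>" for x y
    using evf_K[OF that] evf_eq_inner[OF that(2), of "K x"] by simp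
qed

lemma has_derivative_along_axis_cong:
  assumes x: "x \<in> \<Omega>" and "(f has_real_derivative d) (at 0)"
    and eq: "\<And>t. x + t *\<^sub>R e \<in> \<Omega> \<Longrightarrow> f t = g t"
  shows "(g has_real_derivative d) (at 0)"
proof (rule has_field_derivative_transform_within_open[OF assms(2)])
  show "open {t. x + t *\<^sub>R e \<in> \<Omega>}"
    using open_\<Omega> by (intro open_vimage[where f = "\<lambda>t. x + t *\<^sub>R e", unfolded vimage_def] continuous_intros)
qed (use x eq in auto)

text \<open>\<open>D\<close> selects an element by its values on \<open>\<Omega>\<close>. The limit of the difference quotients has these
  values, because evaluation at \<open>y\<close> is the scalar product with \<open>K y\<close>.\<close>

lemma
  assumes x: "x \<in> \<Omega>"
  shows tendsto_dk1: "(diff_quot (axis i 1) x \<longlongrightarrow> D i x) (at 0)"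
    and inner_dk1: "y \<in> \<Omega> \<Longrightarrow> D i x \<bullet> D i y = dir_derivs [fst_dir i, snd_dir i] k (x, y)"
proof -
  note reg = regularity_assm_1[OF regularity, of i, unfolded fst_dir_def snd_dir_def]
  obtain D' where D': "\<And>x. x \<in> \<Omega> \<Longrightarrow> (diff_quot (axis i 1) x \<longlongrightarrow> D' x) (at 0)"
    and D'D': "\<And>x y. x \<in> \<Omega> \<Longrightarrow> y \<in> \<Omega> \<Longrightarrow> D' x \<bullet> D' y = dir_derivs [(axis i 1, 0), (0, axis i 1)] k (x, y)"
    using feature_derivative[OF reg(1,2)] by blast
  have eq: "D i x = D' x" if x: "x \<in> \<Omega>" for x
    unfolding dk1_def
  proof (rule rkhs_elem_eqI[OF rkhs])
    fix y assume y: "y \<in> \<Omega>"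
    have "((\<lambda>t. K y \<bullet> K (x + t *\<^sub>R axis i 1)) has_real_derivative K y \<bullet> D' x) (at 0)"
      using D'[OF x] by (intro has_real_derivative_inner) (simp add: diff_quot_def[abs_def])
    then have "((\<lambda>t. k ((x, y) + t *\<^sub>R (axis i 1, 0))) has_real_derivative K y \<bullet> D' x) (at 0)"
      by (rule has_derivative_along_axis_cong[where e = "axis i 1", OF x]) (simp add: gram y inner_commute)
    then show "evf (D' x) y = dir_derivs [fst_dir i] k (x, y)"
      by (simp add: dir_derivs_def dir_deriv_def fst_dir_def DERIV_imp_deriv evf_eq_inner[OF y] inner_commute)
  qed
  show "(diff_quot (axis i 1) x \<longlongrightarrow> D i x) (at 0)" using D' eq x by simp
  show "y \<in> \<Omega> \<Longrightarrow> D i x \<bullet> D i y = dir_derivs [fst_dir i, snd_dir i] k (x, y)"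
    using D'D' eq x by (simp add: fst_dir_def snd_dir_def)
qed

lemma
  assumes x: "x \<in> \<Omega>"
  shows tendsto_dk2: "((\<lambda>h. (D i (x + h *\<^sub>R axis i 1) - D i x) /\<^sub>R h) \<longlongrightarrow> W i x) (at 0)"
    and inner_dk2: "y \<in> \<Omega> \<Longrightarrow> W i x \<bullet> W i y = dir_derivs [fst_dir i, fst_dir i, snd_dir i, snd_dir i] k (x, y)"
proof -
  note reg = regularity_assm_2[OF regularity, of i, unfolded fst_dir_def snd_dir_def]
  obtain W' where W': "\<And>x. x \<in> \<Omega> \<Longrightarrow> ((\<lambda>h. (D i (x + h *\<^sub>R axis i 1) - D i x) /\<^sub>R h) \<longlongrightarrow> W' x) (at 0)"
    and W'W': "\<And>x y. x \<in> \<Omega> \<Longrightarrow> y \<in> \<Omega>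
      \<Longrightarrow> W' x \<bullet> W' y = dir_derivs [(axis i 1, 0), (axis i 1, 0), (0, axis i 1), (0, axis i 1)] k (x, y)"
    using feature_second_derivative[OF reg(1,2) tendsto_dk1] by blast
  have eq: "W i x = W' x" if x: "x \<in> \<Omega>" for x
    unfolding dk2_def
  proof (rule rkhs_elem_eqI[OF rkhs])
    fix y assume y: "y \<in> \<Omega>"
    have first: "dir_deriv (axis i 1, 0) k (x, y) = K y \<bullet> D i x" if x: "x \<in> \<Omega>" for x
    proof -
      have "((\<lambda>t. K y \<bullet> K (x + t *\<^sub>R axis i 1)) has_real_derivative K y \<bullet> D i x) (at 0)"
        using tendsto_dk1[OF x] by (intro has_real_derivative_inner) (simp add: diff_quot_def[abs_def])
      then have "((\<lambda>t. k ((x, y) + t *\<^sub>R (axis i 1, 0))) has_real_derivative K y \<bullet> D i x) (at 0)"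
        by (rule has_derivative_along_axis_cong[where e = "axis i 1", OF x]) (simp add: gram y inner_commute)
      then show ?thesis by (simp add: dir_deriv_def DERIV_imp_deriv)
    qed
    have "((\<lambda>t. K y \<bullet> D i (x + t *\<^sub>R axis i 1)) has_real_derivative K y \<bullet> W' x) (at 0)"
      using W'[OF x] by (intro has_real_derivative_inner) simp
    then have "((\<lambda>t. dir_deriv (axis i 1, 0) k ((x, y) + t *\<^sub>R (axis i 1, 0)))
        has_real_derivative K y \<bullet> W' x) (at 0)"
      by (rule has_derivative_along_axis_cong[where e = "axis i 1", OF x]) (simp add: first)
    then show "evf (W' x) y = dir_derivs [fst_dir i, fst_dir i] k (x, y)"
      by (simp add: dir_derivs_def fst_dir_def dir_deriv_def[of _ "dir_deriv _ _"] DERIV_imp_deriv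
          evf_eq_inner[OF y] inner_commute)
  qed
  show "((\<lambda>h. (D i (x + h *\<^sub>R axis i 1) - D i x) /\<^sub>R h) \<longlongrightarrow> W i x) (at 0)" using W' eq x by simp
  show "y \<in> \<Omega> \<Longrightarrow> W i x \<bullet> W i y = dir_derivs [fst_dir i, fst_dir i, snd_dir i, snd_dir i] k (x, y)"
    using W'W' eq x by (simp add: fst_dir_def snd_dir_def)
qed

lemma continuous_on_dk1: "continuous_on \<Omega> (D i)"
  using inner_dk1 regularity_assm_1(2)[OF regularity]
  by (rule continuous_on_if_gram_continuous[where g = "dir_derivs [fst_dir i, snd_dir i] k"])

lemma continuous_on_dk2: "continuous_on \<Omega> (W i)"
  using inner_dk2 regularity_assm_2(2)[OF regularity]
  by (rule continuous_on_if_gram_continuous[where g = "dir_derivs [fst_dir i, fst_dir i, snd_dir i, snd_dir i] k"])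

lemma norm_dk1: "x \<in> \<Omega> \<Longrightarrow> sqrt (dir_derivs [fst_dir i, snd_dir i] k (x, x)) = norm (D i x)"
  by (simp add: inner_dk1[symmetric] norm_eq_sqrt_inner)

lemma norm_dk2:
  "x \<in> \<Omega> \<Longrightarrow> sqrt (dir_derivs [fst_dir i, fst_dir i, snd_dir i, snd_dir i] k (x, x)) = norm (W i x)"
  by (simp add: inner_dk2[symmetric] norm_eq_sqrt_inner)

lemma derivative_evf:
  assumes "x \<in> \<Omega>"
  shows "((\<lambda>t. evf f (x + t *\<^sub>R axis i 1)) has_real_derivative f \<bullet> D i x) (at 0)"
proof -
  have "((\<lambda>t. f \<bullet> K (x + t *\<^sub>R axis i 1)) has_real_derivative f \<bullet> D i x) (at 0)"
    using tendsto_dk1[OF assms] by (intro has_real_derivative_inner) (simp add: diff_quot_def[abs_def])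
  then show ?thesis by (rule has_derivative_along_axis_cong[where e = "axis i 1", OF assms]) (simp add: evf_eq_inner)
qed

lemma partial_evf: "x \<in> \<Omega> \<Longrightarrow> partial i (evf f) x = f \<bullet> D i x"
  using derivative_evf by (simp add: partial_def dir_deriv_def DERIV_imp_deriv)

section \<open>The densities and their integrability\<close>

lemma continuous_on_p0: "continuous_on \<Omega> p0"
proof -
  obtain g where g: "continuous_on (closure \<Omega>) g" "\<forall>x\<in>\<Omega>. g x = p0 x"
    using regularity by (auto simp: regularity_assm_def cont_extendible_def)
  have "continuous_on \<Omega> g" using g(1) closure_subset by (rule continuous_on_subset)
  then show ?thesis using g(2) by (simp cong: continuous_on_cong)
qed

text \<open>The density of \<open>p0\<close> relative to \<open>q0\<close>, which is positive.\<close>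

definition ratio :: "real^'n::{finite,linorder} \<Rightarrow> real" where
  "ratio x = exp (evf f0 x - log_partition \<Omega> q0 (evf f0))"

lemma p0_eq: "p0 x = ratio x * q0 x"
  by (simp add: p0_def exp_density_def ratio_def)

lemma ratio_pos: "0 < ratio x" by (simp add: ratio_def)

lemma q0_nonneg: "x \<in> \<Omega> \<Longrightarrow> 0 \<le> q0 x" using q0 by (simp add: prob_density_on_def)

lemma p0_nonneg: "x \<in> \<Omega> \<Longrightarrow> 0 \<le> p0 x" by (simp add: p0_eq q0_nonneg ratio_pos less_imp_le)

lemma derivative_q0:
  assumes "x \<in> \<Omega>"
  shows "((\<lambda>t. q0 (x + t *\<^sub>R axis i 1)) has_real_derivative partial i q0 x) (at 0)"
  using integrability assms
  by (simp add: integrability_assm_def C1_on_def partial_def dir_deriv_def[abs_def] dir_derivs_def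
      DERIV_deriv_iff_real_differentiable)

lemma derivative_ratio:
  assumes "x \<in> \<Omega>"
  shows "((\<lambda>t. ratio (x + t *\<^sub>R axis i 1)) has_real_derivative ratio x * (f0 \<bullet> D i x)) (at 0)"
  unfolding ratio_def using derivative_evf[OF assms, of f0 i]
  by (auto intro!: derivative_eq_intros)

lemma continuous_on_ratio: "continuous_on \<Omega> ratio"
proof -
  have "continuous_on \<Omega> K"
    using regularity_assm_0[OF regularity]
    by (intro continuous_on_if_gram_continuous[of _ _ k]) (auto simp: gram)
  then have "continuous_on \<Omega> (\<lambda>x. f0 \<bullet> K x)" by (intro continuous_intros)
  then have "continuous_on \<Omega> (evf f0)" using evf_eq_inner by (simp cong: continuous_on_cong)
  then show ?thesis unfolding ratio_def by (intro continuous_intros)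
qed

text \<open>The product \<open>p0 * \<partial>\<^sub>i log q0\<close>, written so that continuity is visible also at zeros of \<open>q0\<close>.\<close>

definition dlog :: "'n::{finite,linorder} \<Rightarrow> real^'n::{finite,linorder} \<Rightarrow> real" where
  "dlog i x = ratio x * partial i q0 x"

lemma continuous_on_dlog: "continuous_on \<Omega> (dlog i)"
  using integrability unfolding dlog_def integrability_assm_def C1_on_def
  by (intro continuous_intros continuous_on_ratio) blast

lemma derivative_ln_q0:
  assumes "x \<in> \<Omega>" "0 < q0 x"
  shows "((\<lambda>t. ln (q0 (x + t *\<^sub>R axis i 1))) has_real_derivative partial i q0 x / q0 x) (at 0)"
  using DERIV_ln_divide[OF assms(2)] derivative_q0[OF assms(1), of i] assms(2)
  by (auto intro!: derivative_eq_intros)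

lemma partial_ln_q0: "x \<in> \<Omega> \<Longrightarrow> 0 < q0 x \<Longrightarrow> partial i (\<lambda>y. ln (q0 y)) x = partial i q0 x / q0 x"
  using derivative_ln_q0 by (simp add: partial_def dir_deriv_def DERIV_imp_deriv)

lemma p0_partial_ln_q0:
  assumes x: "x \<in> \<Omega>"
  shows "p0 x * partial i (\<lambda>y. ln (q0 y)) x = dlog i x"
proof (cases "q0 x = 0")
  case True
  \<comment> \<open>An interior zero of the nonnegative function \<open>q0\<close> is a minimum.\<close>
  have "open {t. x + t *\<^sub>R axis i (1::real) \<in> \<Omega>}"
    using open_\<Omega> by (intro open_vimage[where f = "\<lambda>t. x + t *\<^sub>R axis i 1", unfolded vimage_def] continuous_intros)
  moreover have "0 \<in> {t. x + t *\<^sub>R axis i (1::real) \<in> \<Omega>}" using x by simp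
  ultimately obtain d where d: "0 < d" "ball 0 d \<subseteq> {t. x + t *\<^sub>R axis i (1::real) \<in> \<Omega>}"
    using open_contains_ball_eq by blast
  have "partial i q0 x = 0"
    by (rule DERIV_local_min[OF derivative_q0[OF x] d(1)])
      (use d(2) q0_nonneg True in \<open>auto simp: subset_iff dist_real_def\<close>)
  then show ?thesis using True by (simp add: dlog_def p0_eq)
next
  case False
  then have "0 < q0 x" using q0_nonneg[OF x] by simp
  then show ?thesis using x by (simp add: partial_ln_q0 dlog_def p0_eq)
qed

lemma measurable_if_continuous:
  fixes f :: "real^'n::{finite,linorder} \<Rightarrow> real"
  assumes "continuous_on \<Omega> f"
  shows "f \<in> borel_measurable (leb_on \<Omega>)"
  using borel_measurable_continuous_on_restrict[OF assms]
  by (simp cong: measurable_cong_sets sets_restrict_space_cong)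

text \<open>This is the finiteness of the partition function at \<open>f0\<close>.\<close>

lemma integrable_p0: "integrable (leb_on \<Omega>) p0"
proof (rule integrableI_bounded)
  let ?A = "log_partition \<Omega> q0 (evf f0)"
  show "p0 \<in> borel_measurable (leb_on \<Omega>)" by (rule measurable_if_continuous[OF continuous_on_p0])
  have m: "(\<lambda>x. exp (evf f0 x) * q0 x) \<in> borel_measurable (leb_on \<Omega>)"
  proof -
    have "(\<lambda>x. exp ?A * p0 x) \<in> borel_measurable (leb_on \<Omega>)"
      by (intro measurable_if_continuous continuous_intros continuous_on_p0)
    then show ?thesis by (simp add: p0_eq ratio_def exp_diff field_simps)
  qed
  have "(\<integral>\<^sup>+x. ennreal (norm (p0 x)) \<partial>leb_on \<Omega>)
      = (\<integral>\<^sup>+x. ennreal (exp (- ?A)) * ennreal (exp (evf f0 x) * q0 x) \<partial>leb_on \<Omega>)"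
  proof (rule nn_integral_cong)
    fix x assume "x \<in> space (leb_on \<Omega>)"
    then have "0 \<le> q0 x" using q0_nonneg by (simp add: space_restrict_space)
    then show "ennreal (norm (p0 x)) = ennreal (exp (- ?A)) * ennreal (exp (evf f0 x) * q0 x)"
      by (simp add: p0_eq ratio_def abs_mult ennreal_mult[symmetric] mult.assoc[symmetric] exp_add[symmetric])
  qed
  also have "\<dots> = ennreal (exp (- ?A)) * exp_partition \<Omega> q0 (evf f0)"
    using m by (simp add: nn_integral_cmult exp_partition_def)
  also have "\<dots> < \<infinity>" using f0 by (simp add: natural_params_def ennreal_mult_less_top)
  finally show "(\<integral>\<^sup>+x. ennreal (norm (p0 x)) \<partial>leb_on \<Omega>) < \<infinity>" .
qed

lemma
  shows integrable_sq_dk1: "integrable (leb_on \<Omega>) (\<lambda>x. p0 x * (norm (D i x))\<^sup>2)"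
    and integrable_dk2: "integrable (leb_on \<Omega>) (\<lambda>x. p0 x * norm (W i x))"
    and integrable_dlog_dk1: "integrable (leb_on \<Omega>) (\<lambda>x. \<bar>dlog i x\<bar> * norm (D i x))"
proof -
  let ?k1 = "\<lambda>x. dir_derivs [fst_dir i, snd_dir i] k (x, x)"
  let ?k2 = "\<lambda>x. dir_derivs [fst_dir i, fst_dir i, snd_dir i, snd_dir i] k (x, x)"
  note L1 = integrable_if_in_L1_density[OF _ measurable_if_continuous[OF continuous_on_p0] p0_nonneg]
  have tr: "integrable (leb_on \<Omega>) g"
    if eq: "\<And>x. x \<in> \<Omega> \<Longrightarrow> p0 x * f x = g x" and c: "continuous_on \<Omega> g" and L: "in_Lp_density \<Omega> p0 1 f"
    for f g :: "real^'n::{finite,linorder} \<Rightarrow> real"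
  proof -
    have "continuous_on \<Omega> (\<lambda>x. p0 x * f x)" using c eq by (simp cong: continuous_on_cong)
    then have "integrable (leb_on \<Omega>) (\<lambda>x. p0 x * f x)" by (intro L1[OF L] measurable_if_continuous)
    then show ?thesis using eq
      by (subst (asm) Bochner_Integration.integrable_cong[OF refl]) (auto simp: space_restrict_space)
  qed
  have L: "in_Lp_density \<Omega> p0 1 ?k1" "in_Lp_density \<Omega> p0 1 (\<lambda>x. sqrt (?k2 x))"
    "in_Lp_density \<Omega> p0 1 (\<lambda>x. sqrt (?k1 x) * partial i (\<lambda>y. ln (q0 y)) x)"
    using integrability by (auto simp: integrability_assm_def)
  show "integrable (leb_on \<Omega>) (\<lambda>x. p0 x * (norm (D i x))\<^sup>2)"
    by (rule tr[OF _ _ L(1)])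
      (auto intro!: continuous_intros continuous_on_p0 continuous_on_dk1
        simp: inner_dk1[symmetric] power2_norm_eq_inner)
  show "integrable (leb_on \<Omega>) (\<lambda>x. p0 x * norm (W i x))"
    by (rule tr[OF _ _ L(2)])
      (auto intro!: continuous_intros continuous_on_p0 continuous_on_dk2 simp: norm_dk2)
  have "integrable (leb_on \<Omega>) (\<lambda>x. dlog i x * norm (D i x))"
  proof (rule tr[OF _ _ L(3)])
    show "p0 x * (sqrt (?k1 x) * partial i (\<lambda>y. ln (q0 y)) x) = dlog i x * norm (D i x)"
      if "x \<in> \<Omega>" for x
      using that by (simp add: norm_dk1 p0_partial_ln_q0[symmetric])
  qed (intro continuous_intros continuous_on_dlog continuous_on_dk1)
  from integrable_abs[OF this]
  show "integrable (leb_on \<Omega>) (\<lambda>x. \<bar>dlog i x\<bar> * norm (D i x))" by (simp add: abs_mult)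
qed

section \<open>The operator and the vector of the quadratic objective\<close>

abbreviation C :: "'h \<Rightarrow>\<^sub>L 'h" where "C \<equiv> cov_op \<Omega> k p0 evf"
abbreviation \<xi> :: 'h where "\<xi> \<equiv> xi_vec \<Omega> k q0 p0 evf"

lemma cov_at_apply: "blinfun_apply (cov_at \<Omega> k evf x) f = (\<Sum>i\<in>UNIV. (D i x \<bullet> f) *\<^sub>R D i x)"
  by (simp add: cov_at_def blinfun.sum_left tensor_op.rep_eq)

lemma bochner_integrable_cov: "bochner_integrable (leb_on \<Omega>) (\<lambda>x. p0 x *\<^sub>R cov_at \<Omega> k evf x)"
proof (rule bochner_integrable_continuous_bound[OF open_\<Omega>])
  show "continuous_on \<Omega> (\<lambda>x. p0 x *\<^sub>R cov_at \<Omega> k evf x)"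
    unfolding cov_at_def
    by (intro continuous_intros continuous_on_p0
        bounded_bilinear.continuous_on[OF bounded_bilinear_tensor_op] continuous_on_dk1)
  show "integrable (leb_on \<Omega>) (\<lambda>x. \<Sum>i\<in>UNIV. p0 x * (norm (D i x))\<^sup>2)"
    by (intro Bochner_Integration.integrable_sum integrable_sq_dk1)
  show "norm (p0 x *\<^sub>R cov_at \<Omega> k evf x) \<le> (\<Sum>i\<in>UNIV. p0 x * (norm (D i x))\<^sup>2)" if "x \<in> \<Omega>" for x
  proof -
    have "norm (cov_at \<Omega> k evf x) \<le> (\<Sum>i\<in>UNIV. (norm (D i x))\<^sup>2)"
      unfolding cov_at_def by (rule sum_norm_le) (rule norm_tensor_op_le)
    then show ?thesis
      using p0_nonneg[OF that] by (simp add: sum_distrib_left[symmetric] mult_left_mono)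
  qed
qed

lemma has_bochner_cov_apply:
  "has_bochner (leb_on \<Omega>) (\<lambda>x. p0 x *\<^sub>R (\<Sum>i\<in>UNIV. (D i x \<bullet> f) *\<^sub>R D i x)) (C f)"
  using has_bochner_bounded_linear[OF has_bochner_bochner[OF bochner_integrable_cov]
      blinfun.bounded_linear_left[of f]]
  by (simp add: cov_op_def[symmetric] blinfun.scaleR_left cov_at_apply)

lemma has_bochner_integral_cov:
  "has_bochner_integral (leb_on \<Omega>) (\<lambda>x. p0 x * (\<Sum>i\<in>UNIV. (D i x \<bullet> f) * (D i x \<bullet> g))) (g \<bullet> C f)"
proof -
  have "has_bochner (leb_on \<Omega>) (\<lambda>x. g \<bullet> (p0 x *\<^sub>R (\<Sum>i\<in>UNIV. (D i x \<bullet> f) *\<^sub>R D i x))) (g \<bullet> C f)"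
    by (intro has_bochner_bounded_linear[OF has_bochner_cov_apply] bounded_linear_inner_right)
  then show ?thesis by (simp add: has_bochner_real_iff inner_sum_right inner_commute[of g])
qed

lemma positive_op_cov: "positive_op C"
  unfolding positive_op_def
proof (intro conjI allI)
  fix f g
  have "g \<bullet> C f = f \<bullet> C g"
    using has_bochner_integral_eq[OF has_bochner_integral_cov[of f g]] has_bochner_integral_cov[of g f]
    by (simp add: mult.commute)
  then show "C f \<bullet> g = f \<bullet> C g" by (simp add: inner_commute)
  have "f \<bullet> C f = (\<integral>x. p0 x * (\<Sum>i\<in>UNIV. (D i x \<bullet> f) * (D i x \<bullet> f)) \<partial>leb_on \<Omega>)"
    using has_bochner_integral_cov[of f f] by (simp add: has_bochner_integral_integral_eq)
  also have "\<dots> \<ge> 0"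
    by (intro integral_nonneg_AE AE_I2 mult_nonneg_nonneg[OF p0_nonneg] sum_nonneg zero_le_square)
      (simp add: space_restrict_space)
  finally show "0 \<le> f \<bullet> C f" .
qed

text \<open>\<open>C\<close> is its own absolute value, and Bessel's inequality bounds its trace by the integral of
  \<open>p0 * (\<Sum>i. norm (D i)\<^sup>2)\<close>.\<close>

lemma trace_class_cov: "trace_class C"
proof -
  obtain E :: "'h set" where E: "orthonormal_basis E" using exists_orthonormal_basis by blast
  let ?b = "\<lambda>x. \<Sum>i\<in>UNIV. p0 x * (norm (D i x))\<^sup>2"
  have "(\<lambda>e. e \<bullet> C e) summable_on E"
  proof (rule nonneg_bdd_above_summable_on)
    show "0 \<le> e \<bullet> C e" for e using positive_op_cov by (simp add: positive_op_def)
    have "(\<Sum>e\<in>F. e \<bullet> C e) \<le> integral\<^sup>L (leb_on \<Omega>) ?b" if F: "finite F" "F \<subseteq> E" for F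
    proof -
      let ?s = "\<lambda>x. \<Sum>e\<in>F. p0 x * (\<Sum>i\<in>UNIV. (D i x \<bullet> e) * (D i x \<bullet> e))"
      have s: "has_bochner_integral (leb_on \<Omega>) ?s (\<Sum>e\<in>F. e \<bullet> C e)"
        by (intro has_bochner_integral_sum has_bochner_integral_cov)
      then have "(\<Sum>e\<in>F. e \<bullet> C e) = integral\<^sup>L (leb_on \<Omega>) ?s"
        by (simp add: has_bochner_integral_integral_eq)
      also have "\<dots> \<le> integral\<^sup>L (leb_on \<Omega>) ?b"
      proof (rule integral_mono)
        show "integrable (leb_on \<Omega>) ?s" using s by (rule integrable.intros)
        show "integrable (leb_on \<Omega>) ?b" by (intro Bochner_Integration.integrable_sum integrable_sq_dk1)
        fix x assume "x \<in> space (leb_on \<Omega>)"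
        then have p: "0 \<le> p0 x" using p0_nonneg by (simp add: space_restrict_space)
        have "?s x = p0 x * (\<Sum>i\<in>UNIV. \<Sum>e\<in>F. (D i x \<bullet> e)\<^sup>2)"
          by (simp add: sum_distrib_left[symmetric] sum.swap[of _ F] power2_eq_square)
        also have "\<dots> \<le> p0 x * (\<Sum>i\<in>UNIV. (norm (D i x))\<^sup>2)"
          using E F p by (intro mult_left_mono sum_mono bessel_inequality)
            (auto simp: orthonormal_basis_def intro: pairwise_subset)
        finally show "?s x \<le> ?b x" by (simp add: sum_distrib_left)
      qed
      finally show ?thesis .
    qed
    then show "bdd_above (sum (\<lambda>e. e \<bullet> C e) ` {F. F \<subseteq> E \<and> finite F})"
      by (intro bdd_aboveI2[where M = "integral\<^sup>L (leb_on \<Omega>) ?b"]) auto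
  qed
  then show ?thesis unfolding trace_class_def using positive_op_cov E by blast
qed

lemma p0_xi_at:
  "x \<in> \<Omega> \<Longrightarrow> p0 x *\<^sub>R xi_at \<Omega> k q0 evf x = (\<Sum>i\<in>UNIV. dlog i x *\<^sub>R D i x + p0 x *\<^sub>R W i x)"
  by (simp add: xi_at_def scaleR_sum_right scaleR_add_right p0_partial_ln_q0)

lemma bochner_integrable_xi: "bochner_integrable (leb_on \<Omega>) (\<lambda>x. p0 x *\<^sub>R xi_at \<Omega> k q0 evf x)"
proof -
  have "bochner_integrable (leb_on \<Omega>) (\<lambda>x. \<Sum>i\<in>UNIV. dlog i x *\<^sub>R D i x + p0 x *\<^sub>R W i x)"
  proof (rule bochner_integrable_continuous_bound[OF open_\<Omega>])
    show "continuous_on \<Omega> (\<lambda>x. \<Sum>i\<in>UNIV. dlog i x *\<^sub>R D i x + p0 x *\<^sub>R W i x)"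
      by (intro continuous_intros continuous_on_p0 continuous_on_dlog continuous_on_dk1 continuous_on_dk2)
    show "integrable (leb_on \<Omega>) (\<lambda>x. \<Sum>i\<in>UNIV. \<bar>dlog i x\<bar> * norm (D i x) + p0 x * norm (W i x))"
      by (intro Bochner_Integration.integrable_sum Bochner_Integration.integrable_add
          integrable_dlog_dk1 integrable_dk2)
    show "norm (\<Sum>i\<in>UNIV. dlog i x *\<^sub>R D i x + p0 x *\<^sub>R W i x)
        \<le> (\<Sum>i\<in>UNIV. \<bar>dlog i x\<bar> * norm (D i x) + p0 x * norm (W i x))" if "x \<in> \<Omega>" for x
      using p0_nonneg[OF that] by (intro sum_norm_le order_trans[OF norm_triangle_ineq]) simp
  qed
  moreover have "has_bochner (leb_on \<Omega>) (\<lambda>x. p0 x *\<^sub>R xi_at \<Omega> k q0 evf x) y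
      \<longleftrightarrow> has_bochner (leb_on \<Omega>) (\<lambda>x. \<Sum>i\<in>UNIV. dlog i x *\<^sub>R D i x + p0 x *\<^sub>R W i x) y" for y
    by (rule has_bochner_cong[OF p0_xi_at]) (simp add: space_restrict_space)
  ultimately show ?thesis by (simp add: bochner_integrable_def)
qed

lemma has_bochner_integral_xi:
  "has_bochner_integral (leb_on \<Omega>) (\<lambda>x. \<Sum>i\<in>UNIV. dlog i x * (D i x \<bullet> g) + p0 x * (W i x \<bullet> g)) (g \<bullet> \<xi>)"
proof -
  have "has_bochner (leb_on \<Omega>) (\<lambda>x. g \<bullet> (p0 x *\<^sub>R xi_at \<Omega> k q0 evf x)) (g \<bullet> \<xi>)"
    unfolding xi_vec_def
    by (intro has_bochner_bounded_linear[OF has_bochner_bochner[OF bochner_integrable_xi]]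
        bounded_linear_inner_right)
  then have "has_bochner_integral (leb_on \<Omega>) (\<lambda>x. g \<bullet> (p0 x *\<^sub>R xi_at \<Omega> k q0 evf x)) (g \<bullet> \<xi>)"
    by (simp only: has_bochner_real_iff)
  then show ?thesis
    by (subst (asm) has_bochner_integral_cong[OF refl _ refl])
      (simp_all add: space_restrict_space p0_xi_at inner_sum_right inner_add_right inner_commute[of g])
qed

section \<open>The Fisher divergence as a quadratic form\<close>

lemma partial_ln_exp_density:
  assumes x: "x \<in> \<Omega>" and pos: "0 < q0 x"
  shows "partial i (\<lambda>y. ln (exp_density \<Omega> q0 (evf f) y)) x = f \<bullet> D i x + partial i (\<lambda>y. ln (q0 y)) x"
proof -
  let ?E = "\<lambda>t. exp (evf f (x + t *\<^sub>R axis i 1) - log_partition \<Omega> q0 (evf f))"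
  let ?Q = "\<lambda>t. q0 (x + t *\<^sub>R axis i 1)"
  have "((\<lambda>t. ?E t * ?Q t) has_real_derivative ?E 0 * (f \<bullet> D i x) * ?Q 0 + partial i q0 x * ?E 0) (at 0)"
    using derivative_evf[OF x, of f i] derivative_q0[OF x, of i]
    by (intro DERIV_mult) (auto intro!: derivative_eq_intros)
  moreover have pos': "0 < ?E 0 * ?Q 0" using pos by simp
  ultimately have "((\<lambda>t. ln (?E t * ?Q t)) has_real_derivative
      (1 / (?E 0 * ?Q 0)) * (?E 0 * (f \<bullet> D i x) * ?Q 0 + partial i q0 x * ?E 0)) (at 0)"
    by (intro DERIV_chain2[where f = ln and g = "\<lambda>t. ?E t * ?Q t", OF DERIV_ln_divide[OF pos']])
  moreover have "(1 / (?E 0 * ?Q 0)) * (?E 0 * (f \<bullet> D i x) * ?Q 0 + partial i q0 x * ?E 0)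
      = f \<bullet> D i x + partial i q0 x / q0 x"
    using pos by (simp add: field_simps)
  ultimately have "((\<lambda>t. ln (?E t * ?Q t)) has_real_derivative f \<bullet> D i x + partial i q0 x / q0 x) (at 0)"
    by simp
  from DERIV_imp_deriv[OF this] show ?thesis
    unfolding partial_ln_q0[OF x pos] by (simp add: partial_def dir_deriv_def exp_density_def)
qed

text \<open>Stated for a general \<open>q\<close> so as to cover both \<open>p\<^sub>f\<close> and \<open>q0\<close> itself, the case \<open>f = 0\<close>. Zeros of \<open>q0\<close>
  do not contribute, as \<open>p0\<close> vanishes there.\<close>

lemma fisher_div_eq_quadratic:
  assumes q: "\<And>i x. x \<in> \<Omega> \<Longrightarrow> 0 < q0 x
    \<Longrightarrow> partial i (\<lambda>y. ln (q y)) x = f \<bullet> D i x + partial i (\<lambda>y. ln (q0 y)) x"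
  shows "fisher_div \<Omega> p0 q = ennreal (1/2 * ((f - f0) \<bullet> C (f - f0)))"
proof -
  let ?s = "\<lambda>x. p0 x * (\<Sum>i\<in>UNIV. (D i x \<bullet> (f - f0)) * (D i x \<bullet> (f - f0)))"
  have eq: "p0 x * (norm (grad (\<lambda>y. ln (p0 y)) x - grad (\<lambda>y. ln (q y)) x))\<^sup>2 = ?s x"
    if x: "x \<in> \<Omega>" for x
  proof (cases "q0 x = 0")
    case False
    then have pos: "0 < q0 x" using q0_nonneg[OF x] by simp
    have "(grad (\<lambda>y. ln (p0 y)) x - grad (\<lambda>y. ln (q y)) x) $ i = - (D i x \<bullet> (f - f0))" for i
      using partial_ln_exp_density[OF x pos, of i f0] q[OF x pos, of i]
      by (simp add: grad_def p0_def[symmetric] inner_diff_left inner_commute[of "D i x"])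
    then show ?thesis unfolding power2_norm_eq_inner inner_vec_def by simp
  qed (simp add: p0_eq)
  have "(\<integral>\<^sup>+x. ennreal (p0 x * (norm (grad (\<lambda>y. ln (p0 y)) x - grad (\<lambda>y. ln (q y)) x))\<^sup>2) \<partial>leb_on \<Omega>)
      = (\<integral>\<^sup>+x. ennreal (?s x) \<partial>leb_on \<Omega>)"
  proof (rule nn_integral_cong)
    fix x assume "x \<in> space (leb_on \<Omega>)"
    then have "x \<in> \<Omega>" by (simp add: space_restrict_space)
    then show "ennreal (p0 x * (norm (grad (\<lambda>y. ln (p0 y)) x - grad (\<lambda>y. ln (q y)) x))\<^sup>2)
        = ennreal (?s x)" by (simp only: eq)
  qed
  also have "\<dots> = ennreal (\<integral>x. ?s x \<partial>leb_on \<Omega>)"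
  proof (rule nn_integral_eq_integral)
    show "integrable (leb_on \<Omega>) ?s" using has_bochner_integral_cov by (rule integrable.intros)
    show "AE x in leb_on \<Omega>. 0 \<le> ?s x"
      by (intro AE_I2 mult_nonneg_nonneg[OF p0_nonneg] sum_nonneg zero_le_square)
        (simp add: space_restrict_space)
  qed
  also have "(\<integral>x. ?s x \<partial>leb_on \<Omega>) = (f - f0) \<bullet> C (f - f0)"
    using has_bochner_integral_cov by (rule has_bochner_integral_integral_eq)
  finally show ?thesis
    unfolding fisher_div_def using positive_op_cov
    by (simp only: positive_op_def) (subst ennreal_mult[symmetric], simp_all)
qed

lemma fisher_div_exp_density:
  "fisher_div \<Omega> p0 (exp_density \<Omega> q0 (evf f)) = ennreal (1/2 * ((f - f0) \<bullet> C (f - f0)))"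
  by (rule fisher_div_eq_quadratic) (rule partial_ln_exp_density)

lemma fisher_div_q0: "fisher_div \<Omega> p0 q0 = ennreal (1/2 * (f0 \<bullet> C f0))"
  using fisher_div_eq_quadratic[of q0 0] by (simp add: blinfun.minus_right)

section \<open>Integration by parts\<close>

text \<open>Integrability of \<open>p0 * norm (D i)\<close> follows from that of \<open>p0\<close> and \<open>p0 * norm (D i)\<^sup>2\<close>, because
  \<open>y \<le> 1 + y\<^sup>2\<close>.\<close>

lemma integrable_flux: "integrable (leb_on \<Omega>) (\<lambda>x. p0 x * (D i x \<bullet> g))"
proof (rule integrable_continuous_bound)
  show "continuous_on \<Omega> (\<lambda>x. p0 x * (D i x \<bullet> g))"
    by (intro continuous_intros continuous_on_p0 continuous_on_dk1)
  show "integrable (leb_on \<Omega>) (\<lambda>x. norm g * (p0 x + p0 x * (norm (D i x))\<^sup>2))"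
    by (intro integrable_mult_right Bochner_Integration.integrable_add integrable_p0 integrable_sq_dk1)
  fix x assume x: "x \<in> \<Omega>"
  have "\<bar>D i x \<bullet> g\<bar> \<le> norm g * norm (D i x)"
    using Cauchy_Schwarz_ineq2[of "D i x" g] by (simp add: mult.commute)
  also have "\<dots> \<le> norm g * (1 + (norm (D i x))\<^sup>2)"
  proof (rule mult_left_mono)
    have "0 \<le> (norm (D i x) - 1)\<^sup>2 + (norm (D i x))\<^sup>2 + 1" by simp
    then show "norm (D i x) \<le> 1 + (norm (D i x))\<^sup>2"
      by (simp add: power2_diff)
  qed simp
  finally show "\<bar>p0 x * (D i x \<bullet> g)\<bar> \<le> norm g * (p0 x + p0 x * (norm (D i x))\<^sup>2)"
    using mult_left_mono[OF _ p0_nonneg[OF x]] p0_nonneg[OF x] by (fastforce simp: abs_mult algebra_simps)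
qed

text \<open>The boundary condition says that \<open>p0 * norm (D i)\<close>, which dominates the flux up to the factor
  \<open>norm g\<close>, has a continuous extension vanishing on the boundary: at each boundary point the product of \<open>p0\<close> and
  \<open>norm (D i)\<^sup>2\<close> is zero, so one of the factors is.\<close>

lemma continuous_flux: "continuous_on UNIV (\<lambda>x. if x \<in> \<Omega> then p0 x * (D i x \<bullet> g) else 0)"
proof (rule continuous_on_zero_extension[OF open_\<Omega>])
  let ?k1 = "dir_derivs [fst_dir i, snd_dir i] k"
  let ?k1e = "cont_extension (\<Omega> \<times> \<Omega>) ?k1" and ?pe = "cont_extension \<Omega> p0"
  have pe: "continuous_on (closure \<Omega>) ?pe" "\<And>x. x \<in> \<Omega> \<Longrightarrow> ?pe x = p0 x"
    using cont_extension[of \<Omega> p0] regularity by (auto simp: regularity_assm_def)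
  have ke: "continuous_on (closure \<Omega> \<times> closure \<Omega>) ?k1e" "\<And>z. z \<in> \<Omega> \<times> \<Omega> \<Longrightarrow> ?k1e z = ?k1 z"
    using cont_extension[OF regularity_assm_1(3)[OF regularity]] by (auto simp: closure_Times)
  show "continuous_on \<Omega> (\<lambda>x. p0 x * (D i x \<bullet> g))"
    by (intro continuous_intros continuous_on_p0 continuous_on_dk1)
  have "continuous_on (closure \<Omega>) (\<lambda>x. ?k1e (x, x))"
    by (rule continuous_on_compose2[OF ke(1)]) (auto intro!: continuous_intros)
  then show "continuous_on (closure \<Omega>) (\<lambda>x. norm g * (?pe x * sqrt (?k1e (x, x))))"
    by (intro continuous_intros pe)
  show "\<bar>p0 x * (D i x \<bullet> g)\<bar> \<le> norm g * (?pe x * sqrt (?k1e (x, x)))" if x: "x \<in> \<Omega>" for x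
    using mult_left_mono[OF Cauchy_Schwarz_ineq2[of "D i x" g] p0_nonneg[OF x]] p0_nonneg[OF x] x
    by (simp add: pe(2) ke(2) norm_dk1 abs_mult mult_ac)
  show "norm g * (?pe x * sqrt (?k1e (x, x))) = 0" if "x \<in> closure \<Omega> - \<Omega>" for x
  proof -
    have "?k1e (x, x) * ?pe x = 0" using boundary that by (simp add: boundary_assm_def)
    then show ?thesis by auto
  qed
qed

lemma derivative_flux:
  assumes x: "x \<in> \<Omega>"
  shows "((\<lambda>t. p0 (x + t *\<^sub>R axis i 1) * (D i (x + t *\<^sub>R axis i 1) \<bullet> g)) has_real_derivative
      p0 x * ((D i x \<bullet> f0) * (D i x \<bullet> g)) + (dlog i x * (D i x \<bullet> g) + p0 x * (W i x \<bullet> g))) (at 0)"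
proof -
  have "((\<lambda>t. g \<bullet> D i (x + t *\<^sub>R axis i 1)) has_real_derivative g \<bullet> W i x) (at 0)"
    using tendsto_dk2[OF x] by (intro has_real_derivative_inner) simp
  from DERIV_mult[OF DERIV_mult[OF derivative_ratio[OF x, of i] derivative_q0[OF x, of i]] this]
  show ?thesis by (simp add: p0_eq dlog_def inner_commute algebra_simps)
qed

text \<open>The integrand is \<open>\<partial>\<^sub>i (p0 * (D i \<bullet> g))\<close>, since \<open>\<partial>\<^sub>i p0 = p0 * (D i \<bullet> f0) + dlog i\<close>.\<close>

lemma integral_divergence:
  shows "integrable (leb_on \<Omega>) (\<lambda>x. p0 x * ((D i x \<bullet> f0) * (D i x \<bullet> g))
      + (dlog i x * (D i x \<bullet> g) + p0 x * (W i x \<bullet> g)))" (is "integrable _ ?w")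
    and "(\<integral>x. p0 x * ((D i x \<bullet> f0) * (D i x \<bullet> g))
      + (dlog i x * (D i x \<bullet> g) + p0 x * (W i x \<bullet> g)) \<partial>leb_on \<Omega>) = 0"
proof -
  show w: "integrable (leb_on \<Omega>) ?w"
  proof (rule integrable_continuous_bound)
    show "continuous_on \<Omega> ?w"
      by (intro continuous_intros continuous_on_p0 continuous_on_dk1 continuous_on_dk2 continuous_on_dlog)
    let ?B = "\<lambda>x. norm f0 * norm g * (p0 x * (norm (D i x))\<^sup>2)
      + (norm g * (\<bar>dlog i x\<bar> * norm (D i x)) + norm g * (p0 x * norm (W i x)))"
    show "integrable (leb_on \<Omega>) ?B"
      by (intro integrable_mult_right Bochner_Integration.integrable_add integrable_sq_dk1
          integrable_dlog_dk1 integrable_dk2)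
    fix x assume x: "x \<in> \<Omega>"
    have "\<bar>p0 x * ((D i x \<bullet> f0) * (D i x \<bullet> g))\<bar> \<le> p0 x * ((norm (D i x) * norm f0) * (norm (D i x) * norm g))"
      using p0_nonneg[OF x] unfolding abs_mult
      by (simp only: abs_of_nonneg) (intro mult_left_mono mult_mono Cauchy_Schwarz_ineq2; simp)
    moreover have "\<bar>dlog i x * (D i x \<bullet> g)\<bar> \<le> \<bar>dlog i x\<bar> * (norm (D i x) * norm g)"
      unfolding abs_mult by (intro mult_left_mono Cauchy_Schwarz_ineq2) simp
    moreover have "\<bar>p0 x * (W i x \<bullet> g)\<bar> \<le> p0 x * (norm (W i x) * norm g)"
      using p0_nonneg[OF x] unfolding abs_mult
      by (simp only: abs_of_nonneg) (intro mult_left_mono Cauchy_Schwarz_ineq2)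
    ultimately have "\<bar>?w x\<bar> \<le> p0 x * ((norm (D i x) * norm f0) * (norm (D i x) * norm g))
        + (\<bar>dlog i x\<bar> * (norm (D i x) * norm g) + p0 x * (norm (W i x) * norm g))"
      by linarith
    then show "\<bar>?w x\<bar> \<le> ?B x" by (simp add: power2_eq_square mult_ac)
  qed
  have \<Omega>: "\<Omega> \<inter> space lborel \<in> sets lborel" using open_\<Omega> by simp
  let ?v = "\<lambda>x. p0 x * (D i x \<bullet> g)"
  have ext: "integrable lborel (\<lambda>x. if x \<in> \<Omega> then f x else 0)
      \<and> (\<integral>x. f x \<partial>leb_on \<Omega>) = (\<integral>x. (if x \<in> \<Omega> then f x else 0) \<partial>lborel)"
    if "integrable (leb_on \<Omega>) f" for f :: "real^'n::{finite,linorder} \<Rightarrow> real"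
  proof -
    have "(\<lambda>x. indicator \<Omega> x *\<^sub>R f x) = (\<lambda>x. if x \<in> \<Omega> then f x else 0)"
      by (auto simp: indicator_def)
    then show ?thesis
      using that integrable_restrict_space[OF \<Omega>, of f] integral_restrict_space[OF \<Omega>, of f] by simp
  qed
  have "(\<integral>x. (if x \<in> \<Omega> then ?w x else 0) \<partial>lborel) = 0"
  proof (rule integral_dir_deriv_of_zero_extension[where \<Omega> = \<Omega> and e = "axis i 1", OF continuous_flux])
    show "((\<lambda>t. if x + t *\<^sub>R axis i 1 \<in> \<Omega> then ?v (x + t *\<^sub>R axis i 1) else 0)
        has_real_derivative (if x \<in> \<Omega> then ?w x else 0)) (at 0)" if "x \<in> \<Omega>" for x
      using that
      by (simp add: has_derivative_along_axis_cong[where e = "axis i 1", OF that derivative_flux[OF that, of i g]])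
  qed (use ext[OF w] ext[OF integrable_flux] in auto)
  then show "(\<integral>x. ?w x \<partial>leb_on \<Omega>) = 0" using ext[OF w] by simp
qed

text \<open>Paired with \<open>g\<close>, the vector \<open>C f0 + \<xi>\<close> is the sum of the integrals of \<open>\<partial>\<^sub>i (p0 * (D i \<bullet> g))\<close>.\<close>

lemma cov_f0: "C f0 = - \<xi>"
proof -
  have "g \<bullet> (C f0 + \<xi>) = 0" for g
  proof -
    let ?w = "\<lambda>i x. p0 x * ((D i x \<bullet> f0) * (D i x \<bullet> g)) + (dlog i x * (D i x \<bullet> g) + p0 x * (W i x \<bullet> g))"
    have "has_bochner_integral (leb_on \<Omega>) (\<lambda>x. p0 x * (\<Sum>i\<in>UNIV. (D i x \<bullet> f0) * (D i x \<bullet> g))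
        + (\<Sum>i\<in>UNIV. dlog i x * (D i x \<bullet> g) + p0 x * (W i x \<bullet> g))) (g \<bullet> C f0 + g \<bullet> \<xi>)"
      by (intro has_bochner_integral_add has_bochner_integral_cov has_bochner_integral_xi)
    moreover have "(\<lambda>x. p0 x * (\<Sum>i\<in>UNIV. (D i x \<bullet> f0) * (D i x \<bullet> g))
        + (\<Sum>i\<in>UNIV. dlog i x * (D i x \<bullet> g) + p0 x * (W i x \<bullet> g))) = (\<lambda>x. \<Sum>i\<in>UNIV. ?w i x)"
      by (simp add: sum.distrib sum_distrib_left)
    ultimately have "g \<bullet> C f0 + g \<bullet> \<xi> = (\<integral>x. (\<Sum>i\<in>UNIV. ?w i x) \<partial>leb_on \<Omega>)"
      by (simp add: has_bochner_integral_integral_eq)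
    also have "\<dots> = (\<Sum>i\<in>UNIV. \<integral>x. ?w i x \<partial>leb_on \<Omega>)"
      by (rule Bochner_Integration.integral_sum) (rule integral_divergence(1))
    also have "\<dots> = 0" by (simp only: integral_divergence(2) sum.neutral_const)
    finally show ?thesis by (simp add: inner_add_right)
  qed
  from this[of "C f0 + \<xi>"] show ?thesis by (simp add: add_eq_0_iff2)
qed

lemma quadratic_expansion:
  "(f - f0) \<bullet> C (f - f0) = f \<bullet> C f + 2 * (f \<bullet> \<xi>) + f0 \<bullet> C f0"
proof -
  have "f0 \<bullet> C f = f \<bullet> C f0" using positive_op_cov by (metis inner_commute positive_op_def)
  then show ?thesis using cov_f0 by (simp add: blinfun.diff_right inner_diff_left inner_diff_right inner_add_right)
qed

end

section \<open>Population and empirical minimizers\<close>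

lemma positive_op_cov_at: "positive_op (cov_at \<Omega> k evf x)"
  unfolding cov_at_def by (intro positive_op_sum positive_op_tensor_op)

lemma positive_op_emp_cov_op: "positive_op (emp_cov_op \<Omega> k evf n x)"
  unfolding emp_cov_op_def by (intro positive_op_scaleR positive_op_sum positive_op_cov_at) simp

theorem theorem3:
  fixes \<Omega> :: "(real^'n::{finite,linorder}) set"
    and k :: "(real^'n::{finite,linorder}) \<times> (real^'n::{finite,linorder}) \<Rightarrow> real"
    and q0 p0 :: "real^'n::{finite,linorder} \<Rightarrow> real"
    and evf :: "'h::{real_inner,banach} \<Rightarrow> real^'n::{finite,linorder} \<Rightarrow> real"
    and f0 :: 'h
  assumes "prob_density_on \<Omega> q0"
    and "rkhs_on \<Omega> k evf"
    and "f0 \<in> natural_params \<Omega> q0 evf"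
    and "p0 = exp_density \<Omega> q0 (evf f0)"
    and "domain_assm \<Omega>"
    and "regularity_assm \<Omega> k p0"
    and "boundary_assm \<Omega> k p0"
    and "integrability_assm 1 \<Omega> k q0 p0"
  shows
    "let F = natural_params \<Omega> q0 evf;
         J = (\<lambda>f. fisher_div \<Omega> p0 (exp_density \<Omega> q0 (evf f)));
         J0 = fisher_div \<Omega> p0 q0;
         C = cov_op \<Omega> k p0 evf;
         \<xi> = xi_vec \<Omega> k q0 p0 evf
     in
       (\<forall>f\<in>F. J f < \<infinity>) \<and>
       \<comment> \<open>(i)\<close>
       (bochner_integrable (leb_on \<Omega>) (\<lambda>x. p0 x *\<^sub>R cov_at \<Omega> k evf x) \<and>
        trace_class C \<and> positive_op C \<and>
        (\<forall>f. has_bochner (leb_on \<Omega>)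
               (\<lambda>x. p0 x *\<^sub>R (\<Sum>i\<in>UNIV. partial i (evf f) x *\<^sub>R dk1 \<Omega> k evf i x)) (blinfun_apply C f)) \<and>
        (\<forall>f\<in>F. enn2real (J f) = 1/2 * ((f - f0) \<bullet> blinfun_apply C (f - f0)))) \<and>
       \<comment> \<open>(ii)\<close>
       (bochner_integrable (leb_on \<Omega>) (\<lambda>x. p0 x *\<^sub>R xi_at \<Omega> k q0 evf x) \<and>
        J0 < \<infinity> \<and>
        (\<forall>f\<in>F. enn2real (J f) = 1/2 * (f \<bullet> blinfun_apply C f) + f \<bullet> \<xi> + enn2real J0) \<and>
        blinfun_apply C f0 = - \<xi>) \<and>
       \<comment> \<open>(iii)\<close>
       (\<forall>lam>0. let J_lam = (\<lambda>f. 1/2 * ((f - f0) \<bullet> blinfun_apply C (f - f0)) + lam/2 * (norm f)\<^sup>2) in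
          bij (blinfun_apply (ridge_op C lam)) \<and>
          (\<exists>!f. is_arg_min J_lam (\<lambda>_. True) f) \<and>
          (\<forall>f. is_arg_min J_lam (\<lambda>_. True) f \<longrightarrow>
             f = - op_inv (ridge_op C lam) \<xi> \<and> f = op_inv (ridge_op C lam) (blinfun_apply C f0))) \<and>
       \<comment> \<open>(iv)\<close>
       (\<forall>(M::'w measure) X n. n \<ge> 1 \<and> iid_sample M \<Omega> p0 n X \<longrightarrow>
          (\<forall>lam>0. \<forall>\<omega>\<in>space M.
             let C_emp = emp_cov_op \<Omega> k evf n (\<lambda>a. X a \<omega>);
                 xi_emp = emp_xi \<Omega> k q0 evf n (\<lambda>a. X a \<omega>);
                 J_emp = (\<lambda>f. 1/2 * (f \<bullet> blinfun_apply C_emp f) + f \<bullet> xi_emp + enn2real J0);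
                 J_emp_lam = (\<lambda>f. J_emp f + lam/2 * (norm f)\<^sup>2)
             in
               bij (blinfun_apply (ridge_op C_emp lam)) \<and>
               (\<exists>!f. is_arg_min J_emp_lam (\<lambda>_. True) f) \<and>
               (\<forall>f. is_arg_min J_emp_lam (\<lambda>_. True) f \<longrightarrow> f = - op_inv (ridge_op C_emp lam) xi_emp)))"
proof -
  interpret score_matching \<Omega> k q0 p0 evf f0 by unfold_locales (fact assms)+
  have J: "enn2real (fisher_div \<Omega> p0 (exp_density \<Omega> q0 (evf f))) = 1/2 * ((f - f0) \<bullet> C (f - f0))" for f
    using positive_op_cov unfolding fisher_div_exp_density by (simp add: positive_op_def)
  have J0: "enn2real (fisher_div \<Omega> p0 q0) = 1/2 * (f0 \<bullet> C f0)"
    using positive_op_cov unfolding fisher_div_q0 by (simp add: positive_op_def)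
  have i_app: "has_bochner (leb_on \<Omega>)
      (\<lambda>x. p0 x *\<^sub>R (\<Sum>i\<in>UNIV. partial i (evf f) x *\<^sub>R D i x)) (C f)" for f
    using has_bochner_cov_apply[of f]
    by (subst has_bochner_cong) (auto simp: space_restrict_space partial_evf inner_commute)
  have iii: "is_arg_min (\<lambda>f. 1/2 * ((f - f0) \<bullet> C (f - f0)) + lam/2 * (norm f)\<^sup>2) (\<lambda>_. True) f
      \<longleftrightarrow> f = - op_inv (ridge_op C lam) \<xi>" if "0 < lam" for lam f
    by (rule ridge_minimizer[OF positive_op_cov that, where c = "1/2 * (f0 \<bullet> C f0)"])
      (simp add: quadratic_expansion)
  have op_inv_cov: "op_inv (ridge_op C lam) (C f0) = - op_inv (ridge_op C lam) \<xi>" if "0 < lam" for lam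
  proof (rule inv_f_eq)
    note bij = bij_ridge_op[OF positive_op_cov that]
    show "inj (blinfun_apply (ridge_op C lam))" using bij by (rule bij_is_inj)
    show "blinfun_apply (ridge_op C lam) (- op_inv (ridge_op C lam) \<xi>) = C f0"
      by (simp only: blinfun.minus_right surj_f_inv_f[OF bij_is_surj[OF bij]] cov_f0)
  qed
  have iv: "is_arg_min (\<lambda>f. 1/2 * (f \<bullet> blinfun_apply T f) + f \<bullet> b + c + lam/2 * (norm f)\<^sup>2) (\<lambda>_. True) f
      \<longleftrightarrow> f = - op_inv (ridge_op T lam) b" if "positive_op T" "0 < lam" for T and b f :: 'h and c lam
    by (rule ridge_minimizer[OF that]) (rule refl)
  show ?thesis
    unfolding Let_def
  proof (intro conjI allI impI ballI)
    show "fisher_div \<Omega> p0 (exp_density \<Omega> q0 (evf f)) < \<infinity>" for f by (simp add: fisher_div_exp_density)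
    show "enn2real (fisher_div \<Omega> p0 (exp_density \<Omega> q0 (evf f)))
        = 1/2 * (f \<bullet> C f) + f \<bullet> \<xi> + enn2real (fisher_div \<Omega> p0 q0)" for f
      by (simp add: J J0 quadratic_expansion)
    show "fisher_div \<Omega> p0 q0 < \<infinity>" by (simp add: fisher_div_q0)
    fix lam :: real assume lam: "0 < lam"
    show "bij (blinfun_apply (ridge_op C lam))" using positive_op_cov lam by (rule bij_ridge_op)
    show "\<exists>!f. is_arg_min (\<lambda>f. 1/2 * ((f - f0) \<bullet> C (f - f0)) + lam/2 * (norm f)\<^sup>2) (\<lambda>_. True) f"
      unfolding iii[OF lam] by blast
    fix f assume "is_arg_min (\<lambda>f. 1/2 * ((f - f0) \<bullet> C (f - f0)) + lam/2 * (norm f)\<^sup>2) (\<lambda>_. True) f"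
    then show "f = - op_inv (ridge_op C lam) \<xi>" "f = op_inv (ridge_op C lam) (C f0)"
      unfolding iii[OF lam] op_inv_cov[OF lam] by assumption+
  next
    fix n lam and X :: "nat \<Rightarrow> 'w \<Rightarrow> real^'n::{finite,linorder}" and \<omega>
    assume lam: "0 < (lam :: real)"
    let ?T = "emp_cov_op \<Omega> k evf n (\<lambda>a. X a \<omega>)" and ?b = "emp_xi \<Omega> k q0 evf n (\<lambda>a. X a \<omega>)"
    let ?Q = "\<lambda>f. 1/2 * (f \<bullet> blinfun_apply ?T f) + f \<bullet> ?b + enn2real (fisher_div \<Omega> p0 q0)
        + lam/2 * (norm f)\<^sup>2"
    have Q: "is_arg_min ?Q (\<lambda>_. True) f \<longleftrightarrow> f = - op_inv (ridge_op ?T lam) ?b" for f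
      by (rule iv[OF positive_op_emp_cov_op lam])
    show "bij (blinfun_apply (ridge_op ?T lam))" using positive_op_emp_cov_op lam by (rule bij_ridge_op)
    show "\<exists>!f. is_arg_min ?Q (\<lambda>_. True) f" unfolding Q by blast
    show "f = - op_inv (ridge_op ?T lam) ?b" if "is_arg_min ?Q (\<lambda>_. True) f" for f
      using that unfolding Q .
  qed (use J i_app bochner_integrable_cov trace_class_cov positive_op_cov bochner_integrable_xi cov_f0 in \<open>simp_all only:\<close>)
qed

end
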